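(* Let $k$ be a field and $A,B$ $k$-algebras. There are functors $$\triangleleft:{}_A\mathrm{Mod}\times{}_{P(A,B)}\mathrm{Comod}\to{}_B\mathrm{Mod},\qquad[-,-]:{}_{P(A,B)}\mathrm{Comod}^{\mathrm{op}}\times{}_B\mathrm{Mod}\to{}_A\mathrm{Mod},$$ providing a tensor–hom adjunction $$\mathrm{Mod}(M,[-,N])\cong\mathrm{Mod}(M\triangleleft-,N),$$ where $M,N$ are modules over $A,B$ respectively.
   Context: Algebras are associative unital, coalgebras coassociative counital over $k$; modules and comodules are left ones, and ${}_A\mathrm{Mod}$, ${}_H\mathrm{Comod}$ denote the categories of $A$-modules and $H$-comodules; $\mathrm{Mod}(-,-)$ denotes module maps. Write $\triangle h=\sum_{(h)}h_{(2)}\otimes h_{(1)}$, and $\triangle_X(x)=\sum_{(x)}x_{(1)}\otimes x_{(0)}\in H\otimes X$ for an $H$-comodule $X$. A linear map $\rho:H\to\mathrm{Hom}_k(A,B)$ measures if $\rho(h)(aa')=\sum\rho(h_{(2)})(a)\rho(h_{(1)})(a')$ and $\rho(h)(1_A)=\epsilon(h)1_B$. $\pi:P(A,B)\to\mathrm{Hom}_k(A,B)$ is the (existing) universal measuring coalgebra, through which every measuring $\rho$ factors by a unique coalgebra map $H\to P(A,B)$. Sweedler product of an algebra and a coalgebra: $A\triangleleft H=T(A\otimes H)/J$, with $J$ the two-sided ideal generated by $aa'\otimes h-\sum_{(h)}(a\otimes h_{(2)})\cdot(a'\otimes h_{(1)})$ and $1_A\otimes h-\epsilon(h)1$. Sweedler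 product of a module and a comodule: let $H\to\mathrm{Hom}_k(A,B)$ measure. For an $A$-module $M$ and an $H$-comodule $X$, $M\triangleleft X=(A\triangleleft H\otimes M\otimes X)/R$, where $R$ is the $A\triangleleft H$-submodule generated by the elements $1\otimes am\otimes x-\sum_{(x)}(a\otimes x_{(1)})\otimes m\otimes x_{(0)}$. Here $H=P(A,B)$. For a $P(A,B)$-comodule $X$ and a $B$-module $N$, $[X,N]=\mathrm{Hom}_k(X,N)$ is an $A$-module by $(a\cdot\nu)(x)=\sum_{(x)}\pi(x_{(1)})(a)\,\nu(x_{(0)})$.
   Formalization: The M◁X defined in the context is only a module over A◁P(A,B), not over B (e.g. A=k, B=M_2(k), M=X=k); here the functor ◁ into B-modules is its base change B⊗_{A◁P(A,B)}(M◁X) along the algebra map a⊗h↦π(h)(a). *)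

theory Defs
  imports "HOL-Algebra.Module" "HOL-Algebra.QuotRing"
begin

section \<open>Categories and functors\<close>

text \<open>\<open>Comp C X Y Z g f\<close> is the composite of \<open>f : X \<rightarrow> Y\<close> and \<open>g : Y \<rightarrow> Z\<close>.\<close>

record ('o, 'f) category =
  Obj :: "'o set"
  Arr :: "'o \<Rightarrow> 'o \<Rightarrow> 'f set"
  Ident :: "'o \<Rightarrow> 'f"
  Comp :: "'o \<Rightarrow> 'o \<Rightarrow> 'o \<Rightarrow> 'f \<Rightarrow> 'f \<Rightarrow> 'f"

definition is_category :: "('o, 'f) category \<Rightarrow> bool" where
  "is_category C \<longleftrightarrow>
     (\<forall>X\<in>Obj C. Ident C X \<in> Arr C X X) \<and>
     (\<forall>X\<in>Obj C. \<forall>Y\<in>Obj C. \<forall>Z\<in>Obj C. \<forall>f\<in>Arr C X Y. \<forall>g\<in>Arr C Y Z.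
        Comp C X Y Z g f \<in> Arr C X Z) \<and>
     (\<forall>X\<in>Obj C. \<forall>Y\<in>Obj C. \<forall>f\<in>Arr C X Y.
        Comp C X X Y f (Ident C X) = f \<and> Comp C X Y Y (Ident C Y) f = f) \<and>
     (\<forall>W\<in>Obj C. \<forall>X\<in>Obj C. \<forall>Y\<in>Obj C. \<forall>Z\<in>Obj C.
        \<forall>f\<in>Arr C W X. \<forall>g\<in>Arr C X Y. \<forall>h\<in>Arr C Y Z.
        Comp C W X Z (Comp C X Y Z h g) f = Comp C W Y Z h (Comp C W X Y g f))"

definition op_cat :: "('o, 'f) category \<Rightarrow> ('o, 'f) category" where
  "op_cat C = \<lparr>Obj = Obj C, Arr = (\<lambda>X Y. Arr C Y X), Ident = Ident C,
     Comp = (\<lambda>X Y Z g f. Comp C Z Y X f g)\<rparr>"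

definition prod_cat ::
  "('o, 'f) category \<Rightarrow> ('p, 'g) category \<Rightarrow> ('o \<times> 'p, 'f \<times> 'g) category" where
  "prod_cat C D = \<lparr>Obj = Obj C \<times> Obj D,
     Arr = (\<lambda>X Y. Arr C (fst X) (fst Y) \<times> Arr D (snd X) (snd Y)),
     Ident = (\<lambda>X. (Ident C (fst X), Ident D (snd X))),
     Comp = (\<lambda>X Y Z g f. (Comp C (fst X) (fst Y) (fst Z) (fst g) (fst f),
                          Comp D (snd X) (snd Y) (snd Z) (snd g) (snd f)))\<rparr>"

definition is_functor ::
  "('o, 'f) category \<Rightarrow> ('p, 'g) category \<Rightarrow> ('o \<Rightarrow> 'p) \<Rightarrow> ('o \<Rightarrow> 'o \<Rightarrow> 'f \<Rightarrow> 'g) \<Rightarrow> bool" where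
  "is_functor C D F Fa \<longleftrightarrow>
     is_category C \<and> is_category D \<and>
     (\<forall>X\<in>Obj C. F X \<in> Obj D) \<and>
     (\<forall>X\<in>Obj C. \<forall>Y\<in>Obj C. \<forall>f\<in>Arr C X Y. Fa X Y f \<in> Arr D (F X) (F Y)) \<and>
     (\<forall>X\<in>Obj C. Fa X X (Ident C X) = Ident D (F X)) \<and>
     (\<forall>X\<in>Obj C. \<forall>Y\<in>Obj C. \<forall>Z\<in>Obj C. \<forall>f\<in>Arr C X Y. \<forall>g\<in>Arr C Y Z.
        Fa X Z (Comp C X Y Z g f) = Comp D (F X) (F Y) (F Z) (Fa Y Z g) (Fa X Y f))"


section \<open>Modules over noncommutative rings, algebras\<close>

text \<open>The library locale \<^locale>\<open>module\<close> is restricted to commutative rings, and the library locale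
  \<^locale>\<open>algebra\<close> to commutative algebras. As in the library, the \<open>mult\<close> and \<open>one\<close> fields of a
  module record play no role.\<close>

locale left_module = R?: ring R + M?: abelian_group M
  for R (structure) and M (structure) +
  assumes lsmult_closed: "\<lbrakk>a \<in> carrier R; x \<in> carrier M\<rbrakk> \<Longrightarrow> a \<odot>\<^bsub>M\<^esub> x \<in> carrier M"
    and lsmult_l_distr: "\<lbrakk>a \<in> carrier R; b \<in> carrier R; x \<in> carrier M\<rbrakk> \<Longrightarrow>
      (a \<oplus> b) \<odot>\<^bsub>M\<^esub> x = a \<odot>\<^bsub>M\<^esub> x \<oplus>\<^bsub>M\<^esub> b \<odot>\<^bsub>M\<^esub> x"
    and lsmult_r_distr: "\<lbrakk>a \<in> carrier R; x \<in> carrier M; y \<in> carrier M\<rbrakk> \<Longrightarrow>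
      a \<odot>\<^bsub>M\<^esub> (x \<oplus>\<^bsub>M\<^esub> y) = a \<odot>\<^bsub>M\<^esub> x \<oplus>\<^bsub>M\<^esub> a \<odot>\<^bsub>M\<^esub> y"
    and lsmult_assoc: "\<lbrakk>a \<in> carrier R; b \<in> carrier R; x \<in> carrier M\<rbrakk> \<Longrightarrow>
      (a \<otimes> b) \<odot>\<^bsub>M\<^esub> x = a \<odot>\<^bsub>M\<^esub> (b \<odot>\<^bsub>M\<^esub> x)"
    and lsmult_one: "x \<in> carrier M \<Longrightarrow> \<one> \<odot>\<^bsub>M\<^esub> x = x"

locale k_algebra = K?: field K + A?: ring A + module K A
  for K (structure) and A (structure) +
  assumes smult_mult_left: "\<lbrakk>c \<in> carrier K; x \<in> carrier A; y \<in> carrier A\<rbrakk> \<Longrightarrow>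
      (c \<odot>\<^bsub>A\<^esub> x) \<otimes>\<^bsub>A\<^esub> y = c \<odot>\<^bsub>A\<^esub> (x \<otimes>\<^bsub>A\<^esub> y)"
    and smult_mult_right: "\<lbrakk>c \<in> carrier K; x \<in> carrier A; y \<in> carrier A\<rbrakk> \<Longrightarrow>
      x \<otimes>\<^bsub>A\<^esub> (c \<odot>\<^bsub>A\<^esub> y) = c \<odot>\<^bsub>A\<^esub> (x \<otimes>\<^bsub>A\<^esub> y)"

definition mod_hom ::
  "('r, 'c) ring_scheme \<Rightarrow> ('r, 'm, 'd) module_scheme \<Rightarrow> ('r, 'n, 'e) module_scheme
   \<Rightarrow> ('m \<Rightarrow> 'n) set" where
  "mod_hom R M N = {f \<in> carrier M \<rightarrow> carrier N.
     (\<forall>x\<in>carrier M. \<forall>y\<in>carrier M. f (x \<oplus>\<^bsub>M\<^esub> y) = f x \<oplus>\<^bsub>N\<^esub> f y) \<and>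
     (\<forall>r\<in>carrier R. \<forall>x\<in>carrier M. f (r \<odot>\<^bsub>M\<^esub> x) = r \<odot>\<^bsub>N\<^esub> f x)}"

definition with_action :: "('m, 'd) ring_scheme \<Rightarrow> ('r \<Rightarrow> 'm \<Rightarrow> 'm) \<Rightarrow> ('r, 'm) module" where
  "with_action M act = \<lparr>carrier = carrier M, mult = mult M, one = one M, zero = zero M,
     add = add M, smult = act\<rparr>"

definition self_module :: "('k, 'c) ring_scheme \<Rightarrow> ('k, 'k) module" where
  "self_module K = with_action K (\<lambda>c x. c \<otimes>\<^bsub>K\<^esub> x)"

text \<open>The \<open>k\<close>-vector space underlying a module \<open>M\<close> over a \<open>k\<close>-algebra \<open>A\<close>.\<close>

definition kmod :: "('k, 'a, 'c) module_scheme \<Rightarrow> ('a, 'm, 'd) module_scheme \<Rightarrow> ('k, 'm) module"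
  where "kmod A M = with_action M (\<lambda>c m. (c \<odot>\<^bsub>A\<^esub> \<one>\<^bsub>A\<^esub>) \<odot>\<^bsub>M\<^esub> m)"

text \<open>The set \<open>Mod(M, N)\<close>. Its elements are \<^const>\<open>undefined\<close> outside \<open>carrier M\<close>, so that two module
  maps are equal as soon as they agree on \<open>carrier M\<close>.\<close>

definition Mod_hom ::
  "('r, 'c) ring_scheme \<Rightarrow> ('r, 'm, 'd) module_scheme \<Rightarrow> ('r, 'n, 'e) module_scheme
   \<Rightarrow> ('m \<Rightarrow> 'n) set" where
  "Mod_hom R M N = mod_hom R M N \<inter> extensional (carrier M)"

definition hom_space ::
  "('k, 'c) ring_scheme \<Rightarrow> ('k, 'v, 'd) module_scheme \<Rightarrow> ('k, 'w, 'e) module_scheme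
   \<Rightarrow> ('k, 'v \<Rightarrow> 'w) module" where
  "hom_space K V W = \<lparr>carrier = Mod_hom K V W,
     mult = undefined, one = undefined,
     zero = (\<lambda>v\<in>carrier V. \<zero>\<^bsub>W\<^esub>),
     add = (\<lambda>f g. \<lambda>v\<in>carrier V. f v \<oplus>\<^bsub>W\<^esub> g v),
     smult = (\<lambda>c f. \<lambda>v\<in>carrier V. c \<odot>\<^bsub>W\<^esub> f v)\<rparr>"

definition alg_hom ::
  "('k, 'c) ring_scheme \<Rightarrow> ('k, 'a, 'd) module_scheme \<Rightarrow> ('k, 'b, 'e) module_scheme
   \<Rightarrow> ('a \<Rightarrow> 'b) set" where
  "alg_hom K A B = ring_hom A B \<inter> mod_hom K A B"


section \<open>Quotients\<close>

definition submod_gen ::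
  "('r, 'c) ring_scheme \<Rightarrow> ('r, 'm, 'd) module_scheme \<Rightarrow> 'm set \<Rightarrow> 'm set" where
  "submod_gen R M S = \<Inter>{N. submodule N R M \<and> S \<subseteq> N}"

text \<open>This serves both for the quotient of a module by a submodule and for the quotient of an algebra
  by a two-sided ideal; the \<open>mult\<close> and \<open>one\<close> fields are meaningful in the second case only.\<close>

definition quot :: "('r, 'm, 'd) module_scheme \<Rightarrow> 'm set \<Rightarrow> ('r, 'm set) module" where
  "quot M N = \<lparr>carrier = a_rcosets\<^bsub>M\<^esub> N, mult = rcoset_mult M N, one = N +>\<^bsub>M\<^esub> \<one>\<^bsub>M\<^esub>, zero = N,
     add = set_add M, smult = (\<lambda>r C. \<Union>x\<in>C. N +>\<^bsub>M\<^esub> (r \<odot>\<^bsub>M\<^esub> x))\<rparr>"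

definition quot_map :: "('r, 'n, 'd) module_scheme \<Rightarrow> 'n set \<Rightarrow> ('m \<Rightarrow> 'n) \<Rightarrow> 'm set \<Rightarrow> 'n set" where
  "quot_map M' N' f C = the_elem ((\<lambda>x. N' +>\<^bsub>M'\<^esub> f x) ` C)"


section \<open>Tensor products over \<open>k\<close>\<close>

definition single :: "('k, 'c) ring_scheme \<Rightarrow> 's \<Rightarrow> 's \<Rightarrow> 'k" where
  "single K s = (\<lambda>t. if t = s then \<one>\<^bsub>K\<^esub> else \<zero>\<^bsub>K\<^esub>)"

definition free_mod :: "('k, 'c) ring_scheme \<Rightarrow> 's set \<Rightarrow> ('k, 's \<Rightarrow> 'k) module" where
  "free_mod K S = \<lparr>carrier = {f. range f \<subseteq> carrier K \<and> finite {s. f s \<noteq> \<zero>\<^bsub>K\<^esub>} \<and> {s. f s \<noteq> \<zero>\<^bsub>K\<^esub>} \<subseteq> S},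
     mult = undefined, one = undefined,
     zero = (\<lambda>s. \<zero>\<^bsub>K\<^esub>),
     add = (\<lambda>f g s. f s \<oplus>\<^bsub>K\<^esub> g s),
     smult = (\<lambda>c f s. c \<otimes>\<^bsub>K\<^esub> f s)\<rparr>"

definition free_lift ::
  "('k, 'c) ring_scheme \<Rightarrow> ('k, 'u, 'd) module_scheme \<Rightarrow> ('s \<Rightarrow> 'u) \<Rightarrow> ('s \<Rightarrow> 'k) \<Rightarrow> 'u" where
  "free_lift K U b f = (\<Oplus>\<^bsub>U\<^esub>s\<in>{s. f s \<noteq> \<zero>\<^bsub>K\<^esub>}. f s \<odot>\<^bsub>U\<^esub> b s)"

type_synonym ('k, 'v, 'w) tensors = "('v \<times> 'w \<Rightarrow> 'k) set"

definition bilin_rels ::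
  "('k, 'c) ring_scheme \<Rightarrow> ('k, 'v, 'd) module_scheme \<Rightarrow> ('k, 'w, 'e) module_scheme
   \<Rightarrow> ('v \<times> 'w \<Rightarrow> 'k) set" where
  "bilin_rels K V W = (let F = free_mod K (carrier V \<times> carrier W) in
     {single K (v \<oplus>\<^bsub>V\<^esub> v', w) \<ominus>\<^bsub>F\<^esub> (single K (v, w) \<oplus>\<^bsub>F\<^esub> single K (v', w)) | v v' w.
        v \<in> carrier V \<and> v' \<in> carrier V \<and> w \<in> carrier W} \<union>
     {single K (v, w \<oplus>\<^bsub>W\<^esub> w') \<ominus>\<^bsub>F\<^esub> (single K (v, w) \<oplus>\<^bsub>F\<^esub> single K (v, w')) | v w w'.
        v \<in> carrier V \<and> w \<in> carrier W \<and> w' \<in> carrier W} \<union>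
     {single K (c \<odot>\<^bsub>V\<^esub> v, w) \<ominus>\<^bsub>F\<^esub> (c \<odot>\<^bsub>F\<^esub> single K (v, w)) | c v w.
        c \<in> carrier K \<and> v \<in> carrier V \<and> w \<in> carrier W} \<union>
     {single K (v, c \<odot>\<^bsub>W\<^esub> w) \<ominus>\<^bsub>F\<^esub> (c \<odot>\<^bsub>F\<^esub> single K (v, w)) | c v w.
        c \<in> carrier K \<and> v \<in> carrier V \<and> w \<in> carrier W})"

definition tensor_null ::
  "('k, 'c) ring_scheme \<Rightarrow> ('k, 'v, 'd) module_scheme \<Rightarrow> ('k, 'w, 'e) module_scheme
   \<Rightarrow> ('v \<times> 'w \<Rightarrow> 'k) set" where
  "tensor_null K V W = submod_gen K (free_mod K (carrier V \<times> carrier W)) (bilin_rels K V W)"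

definition tensor ::
  "('k, 'c) ring_scheme \<Rightarrow> ('k, 'v, 'd) module_scheme \<Rightarrow> ('k, 'w, 'e) module_scheme
   \<Rightarrow> ('k, ('k, 'v, 'w) tensors) module" where
  "tensor K V W = quot (free_mod K (carrier V \<times> carrier W)) (tensor_null K V W)"

definition tens ::
  "('k, 'c) ring_scheme \<Rightarrow> ('k, 'v, 'd) module_scheme \<Rightarrow> ('k, 'w, 'e) module_scheme
   \<Rightarrow> 'v \<Rightarrow> 'w \<Rightarrow> ('k, 'v, 'w) tensors" where
  "tens K V W v w =
     tensor_null K V W +>\<^bsub>free_mod K (carrier V \<times> carrier W)\<^esub> single K (v, w)"

text \<open>The linear map out of \<open>V \<otimes> W\<close> induced by a bilinear map \<open>\<beta>\<close>: if \<open>t = \<Sum>\<^sub>i v\<^sub>i \<otimes> w\<^sub>i\<close>, then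
  \<open>tensor_lift K U \<beta> t = \<Sum>\<^sub>i \<beta> v\<^sub>i w\<^sub>i\<close>. All Sweedler sums below are written in this way, for example
  \<open>\<Sum> \<beta>(x\<^sub>(\<^sub>1\<^sub>), x\<^sub>(\<^sub>0\<^sub>))\<close> as \<open>tensor_lift K U \<beta> (coact X x)\<close>.\<close>

definition tensor_lift ::
  "('k, 'c) ring_scheme \<Rightarrow> ('k, 'u, 'd) module_scheme \<Rightarrow> ('v \<Rightarrow> 'w \<Rightarrow> 'u)
   \<Rightarrow> ('k, 'v, 'w) tensors \<Rightarrow> 'u" where
  "tensor_lift K U \<beta> t = the_elem (free_lift K U (\<lambda>(v, w). \<beta> v w) ` t)"

text \<open>The map \<open>f \<otimes> g\<close> into \<open>V' \<otimes> W'\<close>.\<close>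

definition tensor_map ::
  "('k, 'c) ring_scheme \<Rightarrow> ('k, 'v2, 'd) module_scheme \<Rightarrow> ('k, 'w2, 'e) module_scheme
   \<Rightarrow> ('v \<Rightarrow> 'v2) \<Rightarrow> ('w \<Rightarrow> 'w2) \<Rightarrow> ('k, 'v, 'w) tensors \<Rightarrow> ('k, 'v2, 'w2) tensors" where
  "tensor_map K V' W' f g =
     tensor_lift K (tensor K V' W') (\<lambda>v w. tens K V' W' (f v) (g w))"

definition tensor_assoc ::
  "('k, 'c) ring_scheme \<Rightarrow> ('k, 'u, 'd) module_scheme \<Rightarrow> ('k, 'v, 'e) module_scheme
   \<Rightarrow> ('k, 'w, 'f) module_scheme
   \<Rightarrow> ('k, ('k, 'u, 'v) tensors, 'w) tensors \<Rightarrow> ('k, 'u, ('k, 'v, 'w) tensors) tensors" where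
  "tensor_assoc K U V W =
     tensor_lift K (tensor K U (tensor K V W)) (\<lambda>t w.
       tensor_lift K (tensor K U (tensor K V W)) (\<lambda>u v.
         tens K U (tensor K V W) u (tens K V W v w)) t)"

text \<open>For a \<open>k\<close>-algebra \<open>S\<close> and a vector space \<open>W\<close>, the left \<open>S\<close>-module \<open>S \<otimes> W\<close>.\<close>

definition extend_scalars ::
  "('k, 'c) ring_scheme \<Rightarrow> ('k, 's, 'd) module_scheme \<Rightarrow> ('k, 'w, 'e) module_scheme
   \<Rightarrow> ('s, ('k, 's, 'w) tensors) module" where
  "extend_scalars K S W =
     with_action (tensor K S W) (\<lambda>s. tensor_map K S W (\<lambda>t. s \<otimes>\<^bsub>S\<^esub> t) (\<lambda>w. w))"


section \<open>Coalgebras, comodules, measurings\<close>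

record ('k, 'h) coalgebra = "('k, 'h) module" +
  comult :: "'h \<Rightarrow> ('k, 'h, 'h) tensors"
  counit :: "'h \<Rightarrow> 'k"

record ('k, 'h, 'x) comodule = "('k, 'x) module" +
  coact :: "'x \<Rightarrow> ('k, 'h, 'x) tensors"

definition is_coalgebra :: "('k, 'c) ring_scheme \<Rightarrow> ('k, 'h) coalgebra \<Rightarrow> bool" where
  "is_coalgebra K H \<longleftrightarrow> field K \<and> module K H \<and>
     comult H \<in> mod_hom K H (tensor K H H) \<and>
     counit H \<in> mod_hom K H (self_module K) \<and>
     (\<forall>h\<in>carrier H.
        tensor_assoc K H H H (tensor_map K (tensor K H H) H (comult H) (\<lambda>x. x) (comult H h))
        = tensor_map K H (tensor K H H) (\<lambda>x. x) (comult H) (comult H h)) \<and>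
     (\<forall>h\<in>carrier H.
        tensor_lift K H (\<lambda>u v. counit H u \<odot>\<^bsub>H\<^esub> v) (comult H h) = h \<and>
        tensor_lift K H (\<lambda>u v. counit H v \<odot>\<^bsub>H\<^esub> u) (comult H h) = h)"

definition coalg_hom ::
  "('k, 'c) ring_scheme \<Rightarrow> ('k, 'g) coalgebra \<Rightarrow> ('k, 'h) coalgebra \<Rightarrow> ('g \<Rightarrow> 'h) set" where
  "coalg_hom K G H = {f \<in> mod_hom K G H.
     (\<forall>g\<in>carrier G. comult H (f g) = tensor_map K H H f f (comult G g) \<and>
                    counit H (f g) = counit G g)}"

definition is_comodule ::
  "('k, 'c) ring_scheme \<Rightarrow> ('k, 'h) coalgebra \<Rightarrow> ('k, 'h, 'x) comodule \<Rightarrow> bool" where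
  "is_comodule K H X \<longleftrightarrow> is_coalgebra K H \<and> module K X \<and>
     coact X \<in> mod_hom K X (tensor K H X) \<and>
     (\<forall>x\<in>carrier X.
        tensor_assoc K H H X (tensor_map K (tensor K H H) X (comult H) (\<lambda>y. y) (coact X x))
        = tensor_map K H (tensor K H X) (\<lambda>h. h) (coact X) (coact X x)) \<and>
     (\<forall>x\<in>carrier X. tensor_lift K X (\<lambda>h y. counit H h \<odot>\<^bsub>X\<^esub> y) (coact X x) = x)"

definition comod_hom ::
  "('k, 'c) ring_scheme \<Rightarrow> ('k, 'h) coalgebra \<Rightarrow> ('k, 'h, 'x) comodule \<Rightarrow> ('k, 'h, 'y) comodule
   \<Rightarrow> ('x \<Rightarrow> 'y) set" where
  "comod_hom K H X Y = {f \<in> mod_hom K X Y.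
     \<forall>x\<in>carrier X. coact Y (f x) = tensor_map K H Y (\<lambda>h. h) f (coact X x)}"

text \<open>With the convention \<open>\<triangle>h = \<Sum> h\<^sub>(\<^sub>2\<^sub>) \<otimes> h\<^sub>(\<^sub>1\<^sub>)\<close>, the first tensor factor of \<open>\<triangle>h\<close> acts on the first
  factor of the product \<open>a a'\<close>.\<close>

definition is_measuring ::
  "('k, 'c) ring_scheme \<Rightarrow> ('k, 'a) module \<Rightarrow> ('k, 'b) module \<Rightarrow> ('k, 'h) coalgebra
   \<Rightarrow> ('h \<Rightarrow> 'a \<Rightarrow> 'b) \<Rightarrow> bool" where
  "is_measuring K A B H \<rho> \<longleftrightarrow> is_coalgebra K H \<and> \<rho> \<in> mod_hom K H (hom_space K A B) \<and>
     (\<forall>h\<in>carrier H. \<forall>a\<in>carrier A. \<forall>a'\<in>carrier A.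
        \<rho> h (a \<otimes>\<^bsub>A\<^esub> a') = tensor_lift K B (\<lambda>h2 h1. \<rho> h2 a \<otimes>\<^bsub>B\<^esub> \<rho> h1 a') (comult H h)) \<and>
     (\<forall>h\<in>carrier H. \<rho> h \<one>\<^bsub>A\<^esub> = counit H h \<odot>\<^bsub>B\<^esub> \<one>\<^bsub>B\<^esub>)"

text \<open>HOL cannot quantify over all types inside a formula, so the universal property refers to the
  coalgebras carried by subsets of a given type \<open>'u\<close>. Theorems about universal measuring coalgebras
  leave \<open>'u\<close> arbitrary; in particular they apply to a coalgebra that is universal for every \<open>'u\<close>.\<close>

definition universal_measuring ::
  "'u itself \<Rightarrow> ('k, 'c) ring_scheme \<Rightarrow> ('k, 'a) module \<Rightarrow> ('k, 'b) module
   \<Rightarrow> ('k, 'p) coalgebra \<Rightarrow> ('p \<Rightarrow> 'a \<Rightarrow> 'b) \<Rightarrow> bool" where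
  "universal_measuring (_ :: 'u itself) K A B P \<pi> \<longleftrightarrow> is_measuring K A B P \<pi> \<and>
     (\<forall>(H :: ('k, 'u) coalgebra) \<rho>. is_measuring K A B H \<rho> \<longrightarrow>
        (\<exists>!f. f \<in> coalg_hom K H P \<inter> extensional (carrier H) \<and>
              (\<forall>h\<in>carrier H. \<pi> (f h) = \<rho> h)))"


section \<open>Sweedler product of an algebra and a coalgebra\<close>

definition free_alg :: "('k, 'c) ring_scheme \<Rightarrow> 's set \<Rightarrow> ('k, 's list \<Rightarrow> 'k) module" where
  "free_alg K S = (free_mod K (lists S))
     \<lparr>mult := (\<lambda>f g w. \<Oplus>\<^bsub>K\<^esub>i\<in>{..length w}. f (take i w) \<otimes>\<^bsub>K\<^esub> g (drop i w)), one := single K []\<rparr>"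

type_synonym ('k, 'v) tensor_words = "('v list \<Rightarrow> 'k) set"

text \<open>The tensor algebra \<open>T(V)\<close> is the free algebra on the set \<open>V\<close> modulo linearity of the inclusion of
  generators. The ideal is spanned by the multilinearity relations on words, so the part of word
  length \<open>n\<close> is the \<open>n\<close>-fold tensor power of \<open>V\<close>.\<close>

definition tensor_alg_ideal ::
  "('k, 'c) ring_scheme \<Rightarrow> ('k, 'v, 'd) module_scheme \<Rightarrow> ('v list \<Rightarrow> 'k) set" where
  "tensor_alg_ideal K V = (let F = free_alg K (carrier V) in
     Idl\<^bsub>F\<^esub> ({single K [v \<oplus>\<^bsub>V\<^esub> v'] \<ominus>\<^bsub>F\<^esub> (single K [v] \<oplus>\<^bsub>F\<^esub> single K [v']) | v v'.
               v \<in> carrier V \<and> v' \<in> carrier V} \<union>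
            {single K [c \<odot>\<^bsub>V\<^esub> v] \<ominus>\<^bsub>F\<^esub> (c \<odot>\<^bsub>F\<^esub> single K [v]) | c v.
               c \<in> carrier K \<and> v \<in> carrier V}))"

definition tensor_alg ::
  "('k, 'c) ring_scheme \<Rightarrow> ('k, 'v, 'd) module_scheme \<Rightarrow> ('k, ('k, 'v) tensor_words) module" where
  "tensor_alg K V = quot (free_alg K (carrier V)) (tensor_alg_ideal K V)"

definition tensor_alg_inc ::
  "('k, 'c) ring_scheme \<Rightarrow> ('k, 'v, 'd) module_scheme \<Rightarrow> 'v \<Rightarrow> ('k, 'v) tensor_words" where
  "tensor_alg_inc K V v = tensor_alg_ideal K V +>\<^bsub>free_alg K (carrier V)\<^esub> single K [v]"

type_synonym ('k, 'a, 'h) sw = "('k, ('k, 'a, 'h) tensors) tensor_words set"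

definition sw_ideal ::
  "('k, 'c) ring_scheme \<Rightarrow> ('k, 'a) module \<Rightarrow> ('k, 'h) coalgebra
   \<Rightarrow> ('k, ('k, 'a, 'h) tensors) tensor_words set" where
  "sw_ideal K A H = (let V = tensor K A H; T = tensor_alg K V;
       i = (\<lambda>a h. tensor_alg_inc K V (tens K A H a h)) in
     Idl\<^bsub>T\<^esub> ({i (a \<otimes>\<^bsub>A\<^esub> a') h \<ominus>\<^bsub>T\<^esub> tensor_lift K T (\<lambda>h2 h1. i a h2 \<otimes>\<^bsub>T\<^esub> i a' h1) (comult H h) | a a' h.
               a \<in> carrier A \<and> a' \<in> carrier A \<and> h \<in> carrier H} \<union>
            {i \<one>\<^bsub>A\<^esub> h \<ominus>\<^bsub>T\<^esub> (counit H h \<odot>\<^bsub>T\<^esub> \<one>\<^bsub>T\<^esub>) | h. h \<in> carrier H}))"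

text \<open>\<open>A \<triangleleft> H\<close>\<close>

definition sw_alg ::
  "('k, 'c) ring_scheme \<Rightarrow> ('k, 'a) module \<Rightarrow> ('k, 'h) coalgebra \<Rightarrow> ('k, ('k, 'a, 'h) sw) module" where
  "sw_alg K A H = quot (tensor_alg K (tensor K A H)) (sw_ideal K A H)"

text \<open>The class of \<open>a \<otimes> h\<close> in \<open>A \<triangleleft> H\<close>.\<close>

definition sw_gen ::
  "('k, 'c) ring_scheme \<Rightarrow> ('k, 'a) module \<Rightarrow> ('k, 'h) coalgebra \<Rightarrow> 'a \<Rightarrow> 'h \<Rightarrow> ('k, 'a, 'h) sw" where
  "sw_gen K A H a h = sw_ideal K A H +>\<^bsub>tensor_alg K (tensor K A H)\<^esub>
     tensor_alg_inc K (tensor K A H) (tens K A H a h)"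

text \<open>A measuring \<open>\<rho> : H \<rightarrow> Hom(A, B)\<close> is the same thing as an algebra map \<open>A \<triangleleft> H \<rightarrow> B\<close>; this is the
  algebra map corresponding to \<open>\<rho>\<close>, the unique one with \<open>a \<otimes> h \<mapsto> \<rho>(h)(a)\<close>.\<close>

definition sw_eval ::
  "('k, 'c) ring_scheme \<Rightarrow> ('k, 'a) module \<Rightarrow> ('k, 'b) module \<Rightarrow> ('k, 'h) coalgebra
   \<Rightarrow> ('h \<Rightarrow> 'a \<Rightarrow> 'b) \<Rightarrow> ('k, 'a, 'h) sw \<Rightarrow> 'b" where
  "sw_eval K A B H \<rho> =
     (THE \<phi>. \<phi> \<in> alg_hom K (sw_alg K A H) B \<inter> extensional (carrier (sw_alg K A H)) \<and>
             (\<forall>a\<in>carrier A. \<forall>h\<in>carrier H. \<phi> (sw_gen K A H a h) = \<rho> h a))"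


section \<open>Sweedler product of a module and a comodule\<close>

text \<open>The left \<open>A \<triangleleft> H\<close>-module \<open>A \<triangleleft> H \<otimes> M \<otimes> X\<close>.\<close>

type_synonym ('k, 'a, 'h, 'm, 'x) swfree = "('k, ('k, 'a, 'h) sw, ('k, 'm, 'x) tensors) tensors"

definition sw_free ::
  "('k, 'c) ring_scheme \<Rightarrow> ('k, 'a) module \<Rightarrow> ('k, 'h) coalgebra \<Rightarrow> ('a, 'm) module
   \<Rightarrow> ('k, 'h, 'x) comodule \<Rightarrow> (('k, 'a, 'h) sw, ('k, 'a, 'h, 'm, 'x) swfree) module" where
  "sw_free K A H M X = extend_scalars K (sw_alg K A H) (tensor K (kmod A M) X)"

definition sw_pure ::
  "('k, 'c) ring_scheme \<Rightarrow> ('k, 'a) module \<Rightarrow> ('k, 'h) coalgebra \<Rightarrow> ('a, 'm) module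
   \<Rightarrow> ('k, 'h, 'x) comodule \<Rightarrow> ('k, 'a, 'h) sw \<Rightarrow> 'm \<Rightarrow> 'x \<Rightarrow> ('k, 'a, 'h, 'm, 'x) swfree" where
  "sw_pure K A H M X s m x =
     tens K (sw_alg K A H) (tensor K (kmod A M) X) s (tens K (kmod A M) X m x)"

definition sw_rel ::
  "('k, 'c) ring_scheme \<Rightarrow> ('k, 'a) module \<Rightarrow> ('k, 'h) coalgebra \<Rightarrow> ('a, 'm) module
   \<Rightarrow> ('k, 'h, 'x) comodule \<Rightarrow> ('k, 'a, 'h, 'm, 'x) swfree set" where
  "sw_rel K A H M X = (let S = sw_alg K A H; F = sw_free K A H M X in
     submod_gen S F
       {sw_pure K A H M X \<one>\<^bsub>S\<^esub> (a \<odot>\<^bsub>M\<^esub> m) x \<ominus>\<^bsub>F\<^esub>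
          tensor_lift K (tensor K S (tensor K (kmod A M) X))
            (\<lambda>x1 x0. sw_pure K A H M X (sw_gen K A H a x1) m x0) (coact X x) | a m x.
        a \<in> carrier A \<and> m \<in> carrier M \<and> x \<in> carrier X})"

text \<open>\<open>M \<triangleleft> X\<close> as a module over \<open>A \<triangleleft> H\<close>, and the map \<open>f \<triangleleft> g : M \<triangleleft> X \<rightarrow> M' \<triangleleft> X'\<close> induced by
  \<open>s \<otimes> m \<otimes> x \<mapsto> s \<otimes> f(m) \<otimes> g(x)\<close>.\<close>

definition sw_mod ::
  "('k, 'c) ring_scheme \<Rightarrow> ('k, 'a) module \<Rightarrow> ('k, 'h) coalgebra \<Rightarrow> ('a, 'm) module
   \<Rightarrow> ('k, 'h, 'x) comodule \<Rightarrow> (('k, 'a, 'h) sw, ('k, 'a, 'h, 'm, 'x) swfree set) module" where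
  "sw_mod K A H M X = quot (sw_free K A H M X) (sw_rel K A H M X)"

definition sw_mod_map ::
  "('k, 'c) ring_scheme \<Rightarrow> ('k, 'a) module \<Rightarrow> ('k, 'h) coalgebra
   \<Rightarrow> ('a, 'n) module \<Rightarrow> ('k, 'h, 'y) comodule \<Rightarrow> ('m \<Rightarrow> 'n) \<Rightarrow> ('x \<Rightarrow> 'y)
   \<Rightarrow> ('k, 'a, 'h, 'm, 'x) swfree set \<Rightarrow> ('k, 'a, 'h, 'n, 'y) swfree set" where
  "sw_mod_map K A H M' X' f g =
     quot_map (sw_free K A H M' X') (sw_rel K A H M' X')
       (tensor_map K (sw_alg K A H) (tensor K (kmod A M') X') (\<lambda>s. s)
         (tensor_map K (kmod A M') X' f g))"

text \<open>Base change \<open>B \<otimes>\<^sub>S Y\<close> of a left \<open>S\<close>-module \<open>Y\<close> along an algebra map \<open>\<phi> : S \<rightarrow> B\<close>.\<close>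

definition base_change_rel ::
  "('k, 'c) ring_scheme \<Rightarrow> ('k, 's) module \<Rightarrow> ('k, 'b) module \<Rightarrow> ('s \<Rightarrow> 'b) \<Rightarrow> ('s, 'y) module
   \<Rightarrow> ('k, 'b, 'y) tensors set" where
  "base_change_rel K S B \<phi> Y = (let F = extend_scalars K B (kmod S Y) in
     submod_gen B F
       {tens K B (kmod S Y) (b \<otimes>\<^bsub>B\<^esub> \<phi> s) y \<ominus>\<^bsub>F\<^esub> tens K B (kmod S Y) b (s \<odot>\<^bsub>Y\<^esub> y) | b s y.
        b \<in> carrier B \<and> s \<in> carrier S \<and> y \<in> carrier Y})"

definition base_change ::
  "('k, 'c) ring_scheme \<Rightarrow> ('k, 's) module \<Rightarrow> ('k, 'b) module \<Rightarrow> ('s \<Rightarrow> 'b) \<Rightarrow> ('s, 'y) module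
   \<Rightarrow> ('b, ('k, 'b, 'y) tensors set) module" where
  "base_change K S B \<phi> Y = quot (extend_scalars K B (kmod S Y)) (base_change_rel K S B \<phi> Y)"

definition base_change_map ::
  "('k, 'c) ring_scheme \<Rightarrow> ('k, 's) module \<Rightarrow> ('k, 'b) module \<Rightarrow> ('s \<Rightarrow> 'b) \<Rightarrow> ('s, 'z) module
   \<Rightarrow> ('y \<Rightarrow> 'z) \<Rightarrow> ('k, 'b, 'y) tensors set \<Rightarrow> ('k, 'b, 'z) tensors set" where
  "base_change_map K S B \<phi> Y' f =
     quot_map (extend_scalars K B (kmod S Y')) (base_change_rel K S B \<phi> Y')
       (tensor_map K B (kmod S Y') (\<lambda>b. b) f)"


section \<open>The two functors\<close>

text \<open>Objects are all modules (comodules) carried by subsets of a fixed type; arrows are the module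
  (comodule) maps.\<close>

definition Mod_cat :: "('a, 'c) ring_scheme \<Rightarrow> (('a, 'm) module, 'm \<Rightarrow> 'm) category" where
  "Mod_cat A = \<lparr>Obj = {M. left_module A M},
     Arr = Mod_hom A,
     Ident = (\<lambda>M. \<lambda>m\<in>carrier M. m),
     Comp = (\<lambda>L M N g f. compose (carrier L) g f)\<rparr>"

definition Comod_cat ::
  "('k, 'c) ring_scheme \<Rightarrow> ('k, 'h) coalgebra \<Rightarrow> (('k, 'h, 'x) comodule, 'x \<Rightarrow> 'x) category" where
  "Comod_cat K H = \<lparr>Obj = {X. is_comodule K H X},
     Arr = (\<lambda>X Y. comod_hom K H X Y \<inter> extensional (carrier X)),
     Ident = (\<lambda>X. \<lambda>x\<in>carrier X. x),
     Comp = (\<lambda>X Y Z g f. compose (carrier X) g f)\<rparr>"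

text \<open>The functor \<open>\<triangleleft>\<close> with values in \<open>B\<close>-modules: \<open>M \<triangleleft> X\<close> is an \<open>A \<triangleleft> H\<close>-module, which becomes a
  \<open>B\<close>-module by base change along the algebra map \<open>A \<triangleleft> H \<rightarrow> B\<close> given by the measuring \<open>\<rho>\<close>.\<close>

definition sw_functor ::
  "('k, 'c) ring_scheme \<Rightarrow> ('k, 'a) module \<Rightarrow> ('k, 'b) module \<Rightarrow> ('k, 'h) coalgebra
   \<Rightarrow> ('h \<Rightarrow> 'a \<Rightarrow> 'b) \<Rightarrow> ('a, 'm) module \<times> ('k, 'h, 'x) comodule
   \<Rightarrow> ('b, ('k, 'b, ('k, 'a, 'h, 'm, 'x) swfree set) tensors set) module" where
  "sw_functor K A B H \<rho> = (\<lambda>(M, X).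
     base_change K (sw_alg K A H) B (sw_eval K A B H \<rho>) (sw_mod K A H M X))"

definition sw_functor_map ::
  "('k, 'c) ring_scheme \<Rightarrow> ('k, 'a) module \<Rightarrow> ('k, 'b) module \<Rightarrow> ('k, 'h) coalgebra
   \<Rightarrow> ('h \<Rightarrow> 'a \<Rightarrow> 'b) \<Rightarrow> ('a, 'm) module \<times> ('k, 'h, 'x) comodule
   \<Rightarrow> ('a, 'm) module \<times> ('k, 'h, 'x) comodule \<Rightarrow> ('m \<Rightarrow> 'm) \<times> ('x \<Rightarrow> 'x)
   \<Rightarrow> ('k, 'b, ('k, 'a, 'h, 'm, 'x) swfree set) tensors set
   \<Rightarrow> ('k, 'b, ('k, 'a, 'h, 'm, 'x) swfree set) tensors set" where
  "sw_functor_map K A B H \<rho> = (\<lambda>MX (M', X') (f, g).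
     \<lambda>z\<in>carrier (sw_functor K A B H \<rho> MX).
       base_change_map K (sw_alg K A H) B (sw_eval K A B H \<rho>) (sw_mod K A H M' X')
         (sw_mod_map K A H M' X' f g) z)"

definition hom_functor ::
  "('k, 'c) ring_scheme \<Rightarrow> ('k, 'a) module \<Rightarrow> ('k, 'b) module \<Rightarrow> ('k, 'h) coalgebra
   \<Rightarrow> ('h \<Rightarrow> 'a \<Rightarrow> 'b) \<Rightarrow> ('k, 'h, 'x) comodule \<times> ('b, 'n) module \<Rightarrow> ('a, 'x \<Rightarrow> 'n) module" where
  "hom_functor K A B H \<rho> = (\<lambda>(X, N). with_action (hom_space K X (kmod B N))
     (\<lambda>a \<nu>. \<lambda>x\<in>carrier X.
        tensor_lift K (kmod B N) (\<lambda>x1 x0. \<rho> x1 a \<odot>\<^bsub>N\<^esub> \<nu> x0) (coact X x)))"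

text \<open>For \<open>g : X' \<rightarrow> X\<close> and \<open>h : N \<rightarrow> N'\<close>, the map \<open>\<nu> \<mapsto> h \<circ> \<nu> \<circ> g\<close> from \<open>[X, N]\<close> to \<open>[X', N']\<close>.\<close>

definition hom_functor_map ::
  "('k, 'c) ring_scheme \<Rightarrow> ('k, 'a) module \<Rightarrow> ('k, 'b) module \<Rightarrow> ('k, 'h) coalgebra
   \<Rightarrow> ('h \<Rightarrow> 'a \<Rightarrow> 'b) \<Rightarrow> ('k, 'h, 'x) comodule \<times> ('b, 'n) module
   \<Rightarrow> ('k, 'h, 'x) comodule \<times> ('b, 'n) module \<Rightarrow> ('x \<Rightarrow> 'x) \<times> ('n \<Rightarrow> 'n)
   \<Rightarrow> ('x \<Rightarrow> 'n) \<Rightarrow> ('x \<Rightarrow> 'n)" where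
  "hom_functor_map K A B H \<rho> = (\<lambda>XN (X', N') (g, h).
     \<lambda>\<nu>\<in>carrier (hom_functor K A B H \<rho> XN). \<lambda>x\<in>carrier X'. h (\<nu> (g x)))"

end

theory Submission
  imports Defs
begin

text \<open>A \<open>K\<close>-bilinear map \<open>\<beta> : M \<times> X \<rightarrow> N\<close> into a \<open>B\<close>-module is called balanced if
  \<open>\<beta>(a m, x) = \<Sum> \<pi>(x\<^sub>(\<^sub>1\<^sub>))(a) \<beta>(m, x\<^sub>(\<^sub>0\<^sub>))\<close>. The relations that define \<open>M \<triangleleft> X\<close> and its base change
  to \<open>B\<close> say precisely that \<open>M \<triangleleft> X\<close> carries the universal balanced map; and the action of \<open>A\<close> on
  \<open>[X, N]\<close> is the one for which the evaluation \<open>[X, N] \<times> X \<rightarrow> N\<close> is balanced, so that \<open>A\<close>-linear maps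
  \<open>M \<rightarrow> [X, N]\<close> are the curried balanced maps. Balanced maps are stable under composition with
  morphisms in all three arguments, and \<open>B\<close>-linear maps out of \<open>M \<triangleleft> X\<close> are determined on the universal
  balanced map; functoriality and naturality are read off from this. That \<open>[X, N]\<close> is a module at all
  comes from coassociativity of \<open>X\<close> together with the measuring identity.\<close>

section \<open>Linear maps and quotients\<close>

text \<open>The B-module attached to M and X arises from two quotients of the same shape
  \<open>S \<otimes> W\<close>: the Sweedler product is a quotient of
  \<open>(A \<triangleleft> H) \<otimes> (M \<otimes> X)\<close>, and base change along
  \<open>A \<triangleleft> H \<rightarrow> B\<close> is a quotient of \<open>B \<otimes> Y\<close>.
  Both rest on one fact: a K-linear map from W to an S-module extends uniquely to
  \<open>S \<otimes> W\<close>, and the extension descends once it kills the relations. The algebra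
  map to B exists because the measuring axioms are the relations of
  \<open>A \<triangleleft> H\<close>. The obstacle is the form of Sweedler sums. A coaction is an
  element of a tensor product without chosen terms, so an identity between such sums cannot be
  compared termwise. It is stated as an equality of two linear maps on the whole tensor product and
  checked on pure tensors. Functions are total while linearity concerns carriers only; congruence
  lemmas allow a function inside a Sweedler sum to be exchanged for its restriction. Vector spaces
  are handled as \<open>left_module\<close> over K, so that one set of lemmas serves K, A, B and
  \<open>A \<triangleleft> H\<close>.\<close>

lemma module_iff_left_module: "module K V \<longleftrightarrow> cring K \<and> left_module K V"
  by (auto simp: module_def module_axioms_def left_module_def left_module_axioms_def cring_def)

lemma left_moduleI:
  assumes "ring R" "abelian_group M"
    and "\<And>a x. a \<in> carrier R \<Longrightarrow> x \<in> carrier M \<Longrightarrow> a \<odot>\<^bsub>M\<^esub> x \<in> carrier M"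
    and "\<And>a b x. a \<in> carrier R \<Longrightarrow> b \<in> carrier R \<Longrightarrow> x \<in> carrier M \<Longrightarrow>
      (a \<oplus>\<^bsub>R\<^esub> b) \<odot>\<^bsub>M\<^esub> x = a \<odot>\<^bsub>M\<^esub> x \<oplus>\<^bsub>M\<^esub> b \<odot>\<^bsub>M\<^esub> x"
    and "\<And>a x y. a \<in> carrier R \<Longrightarrow> x \<in> carrier M \<Longrightarrow> y \<in> carrier M \<Longrightarrow>
      a \<odot>\<^bsub>M\<^esub> (x \<oplus>\<^bsub>M\<^esub> y) = a \<odot>\<^bsub>M\<^esub> x \<oplus>\<^bsub>M\<^esub> a \<odot>\<^bsub>M\<^esub> y"
    and "\<And>a b x. a \<in> carrier R \<Longrightarrow> b \<in> carrier R \<Longrightarrow> x \<in> carrier M \<Longrightarrow>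
      (a \<otimes>\<^bsub>R\<^esub> b) \<odot>\<^bsub>M\<^esub> x = a \<odot>\<^bsub>M\<^esub> (b \<odot>\<^bsub>M\<^esub> x)"
    and "\<And>x. x \<in> carrier M \<Longrightarrow> \<one>\<^bsub>R\<^esub> \<odot>\<^bsub>M\<^esub> x = x"
  shows "left_module R M"
  using assms by (simp add: left_module_def left_module_axioms_def)

lemma mod_homI:
  assumes "\<And>x. x \<in> carrier M \<Longrightarrow> f x \<in> carrier N"
    and "\<And>x y. x \<in> carrier M \<Longrightarrow> y \<in> carrier M \<Longrightarrow> f (x \<oplus>\<^bsub>M\<^esub> y) = f x \<oplus>\<^bsub>N\<^esub> f y"
    and "\<And>r x. r \<in> carrier R \<Longrightarrow> x \<in> carrier M \<Longrightarrow> f (r \<odot>\<^bsub>M\<^esub> x) = r \<odot>\<^bsub>N\<^esub> f x"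
  shows "f \<in> mod_hom R M N"
  using assms by (simp add: mod_hom_def)

lemma mod_homD:
  assumes "f \<in> mod_hom R M N"
  shows "\<And>x. x \<in> carrier M \<Longrightarrow> f x \<in> carrier N"
    and "\<And>x y. x \<in> carrier M \<Longrightarrow> y \<in> carrier M \<Longrightarrow> f (x \<oplus>\<^bsub>M\<^esub> y) = f x \<oplus>\<^bsub>N\<^esub> f y"
    and "\<And>r x. r \<in> carrier R \<Longrightarrow> x \<in> carrier M \<Longrightarrow> f (r \<odot>\<^bsub>M\<^esub> x) = r \<odot>\<^bsub>N\<^esub> f x"
  using assms by (auto simp: mod_hom_def)

lemma mod_hom_comp:
  assumes "f \<in> mod_hom R L M" "g \<in> mod_hom R M N"
  shows "(\<lambda>x. g (f x)) \<in> mod_hom R L N"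
  using assms by (auto simp: mod_hom_def Pi_iff)

lemma Mod_homD: "f \<in> Mod_hom R M N \<Longrightarrow> f \<in> mod_hom R M N"
  by (simp add: Mod_hom_def)

text \<open>The conditions evaluate \<open>f\<close> only on \<open>carrier M\<close>, which is
  closed under both operations. Any linear map can therefore be made extensional.\<close>

lemma restrict_mod_hom:
  assumes "left_module R M"
  shows "restrict f (carrier M) \<in> mod_hom R M N \<longleftrightarrow> f \<in> mod_hom R M N"
proof -
  interpret left_module R M by fact
  show ?thesis by (auto simp: mod_hom_def Pi_iff lsmult_closed)
qed

lemma restrict_Mod_hom:
  assumes "left_module R M" "f \<in> mod_hom R M N"
  shows "restrict f (carrier M) \<in> Mod_hom R M N"
  using assms by (simp add: Mod_hom_def restrict_mod_hom)

lemma mod_hom_zero: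
  assumes "left_module R M" "left_module R N" "f \<in> mod_hom R M N"
  shows "f \<zero>\<^bsub>M\<^esub> = \<zero>\<^bsub>N\<^esub>"
proof -
  interpret M: left_module R M by fact
  interpret N: left_module R N by fact
  have "f \<zero>\<^bsub>M\<^esub> \<oplus>\<^bsub>N\<^esub> f \<zero>\<^bsub>M\<^esub> = f \<zero>\<^bsub>M\<^esub>" "f \<zero>\<^bsub>M\<^esub> \<in> carrier N"
    using mod_homD[OF assms(3)] by (metis M.M.l_zero M.M.zero_closed, simp)
  then show ?thesis by (simp add: N.M.add.r_cancel_one)
qed

lemma mod_hom_uminus:
  assumes "left_module R M" "left_module R N" "f \<in> mod_hom R M N" "x \<in> carrier M"
  shows "f (\<ominus>\<^bsub>M\<^esub> x) = \<ominus>\<^bsub>N\<^esub> f x"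
proof -
  interpret M: left_module R M by fact
  interpret N: left_module R N by fact
  have "f (\<ominus>\<^bsub>M\<^esub> x) \<oplus>\<^bsub>N\<^esub> f x = \<zero>\<^bsub>N\<^esub>"
    using mod_homD(2)[OF assms(3), of "\<ominus>\<^bsub>M\<^esub> x" x] mod_hom_zero[OF assms(1-3)] assms(4)
    by (simp add: M.M.l_neg)
  then show ?thesis
    using mod_homD(1)[OF assms(3)] assms(4) by (simp add: N.M.minus_equality)
qed

lemma mod_hom_minus:
  assumes "left_module R M" "left_module R N" "f \<in> mod_hom R M N" "x \<in> carrier M" "y \<in> carrier M"
  shows "f (x \<ominus>\<^bsub>M\<^esub> y) = f x \<ominus>\<^bsub>N\<^esub> f y"
proof -
  interpret M: left_module R M by fact
  show ?thesis
    using assms mod_homD(2)[OF assms(3)] mod_hom_uminus[OF assms(1-3)] by (simp add: a_minus_def)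
qed

lemma left_module_smult_zero:
  assumes "left_module R M" "r \<in> carrier R"
  shows "r \<odot>\<^bsub>M\<^esub> \<zero>\<^bsub>M\<^esub> = \<zero>\<^bsub>M\<^esub>"
proof -
  interpret M: left_module R M by fact
  have "r \<odot>\<^bsub>M\<^esub> \<zero>\<^bsub>M\<^esub> \<oplus>\<^bsub>M\<^esub> r \<odot>\<^bsub>M\<^esub> \<zero>\<^bsub>M\<^esub> = r \<odot>\<^bsub>M\<^esub> \<zero>\<^bsub>M\<^esub>"
    using M.lsmult_r_distr[OF assms(2) M.M.zero_closed M.M.zero_closed] by simp
  moreover have "r \<odot>\<^bsub>M\<^esub> \<zero>\<^bsub>M\<^esub> \<in> carrier M" using M.lsmult_closed assms(2) by simp
  ultimately show ?thesis by (simp add: M.M.add.r_cancel_one)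
qed

lemma left_module_minus_self:
  assumes "left_module R M" "x \<in> carrier M"
  shows "x \<ominus>\<^bsub>M\<^esub> x = \<zero>\<^bsub>M\<^esub>"
proof -
  interpret left_module R M by fact
  show ?thesis using assms(2) by (simp add: a_minus_def M.r_neg)
qed

text \<open>Carries the module structure of \<open>free_mod\<close> over to \<open>free_alg\<close>,
  a record with the same additive structure and action but a multiplication of its own.\<close>

lemma left_module_cong:
  assumes "left_module R M" "carrier M' = carrier M" "add M' = add M" "zero M' = zero M"
    "smult M' = smult M"
  shows "left_module R M'"
proof -
  interpret M: left_module R M by fact
  have "abelian_group M'"
    by (rule abelian_groupI) (auto simp: assms(2-5) M.M.a_ac intro: bexI[of _ "\<ominus>\<^bsub>M\<^esub> x" for x] M.M.l_neg)
  then show ?thesis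
    by (intro left_moduleI M.R.ring_axioms)
      (simp_all add: assms(2-5) M.lsmult_closed M.lsmult_l_distr M.lsmult_r_distr M.lsmult_assoc
        M.lsmult_one)
qed

lemma mod_hom_cong:
  assumes "f \<in> mod_hom R M N" "left_module R M" "\<And>x. x \<in> carrier M \<Longrightarrow> f x = g x"
  shows "g \<in> mod_hom R M N"
proof -
  interpret M: left_module R M by fact
  show ?thesis
    using assms(1,3) M.lsmult_closed by (auto simp: mod_hom_def Pi_iff)
qed

lemma mod_hom_add:
  assumes "left_module R M" "left_module R N" "f \<in> mod_hom R M N" "g \<in> mod_hom R M N"
  shows "(\<lambda>x. f x \<oplus>\<^bsub>N\<^esub> g x) \<in> mod_hom R M N"
proof -
  interpret N: left_module R N by fact
  show ?thesis
    by (rule mod_homI)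
      (simp_all add: mod_homD[OF assms(3)] mod_homD[OF assms(4)] N.lsmult_r_distr N.M.a_ac)
qed

lemma mod_hom_smult:
  assumes "cring K" "left_module K N" "f \<in> mod_hom K M N" "c \<in> carrier K"
  shows "(\<lambda>x. c \<odot>\<^bsub>N\<^esub> f x) \<in> mod_hom K M N"
proof -
  interpret K: cring K by fact
  interpret N: left_module K N by fact
  show ?thesis
    by (rule mod_homI)
      (simp_all add: mod_homD[OF assms(3)] assms(4) N.lsmult_r_distr N.lsmult_closed K.m_comm
        flip: N.lsmult_assoc)
qed

lemma (in left_module) submoduleI_left:
  assumes "N \<subseteq> carrier M" "\<zero>\<^bsub>M\<^esub> \<in> N" "\<And>x. x \<in> N \<Longrightarrow> \<ominus>\<^bsub>M\<^esub> x \<in> N"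
    and "\<And>x y. x \<in> N \<Longrightarrow> y \<in> N \<Longrightarrow> x \<oplus>\<^bsub>M\<^esub> y \<in> N"
    and "\<And>r x. r \<in> carrier R \<Longrightarrow> x \<in> N \<Longrightarrow> r \<odot>\<^bsub>M\<^esub> x \<in> N"
  shows "submodule N R M"
  using assms by (auto simp: submodule_def submodule_axioms_def subgroup_def a_inv_def)

lemma (in left_module) submodule_carrier: "submodule (carrier M) R M"
  by (rule submoduleI_left) (auto simp: lsmult_closed)

lemma submoduleD:
  assumes "submodule N R M"
  shows "N \<subseteq> carrier M" "\<zero>\<^bsub>M\<^esub> \<in> N" "\<And>x. x \<in> N \<Longrightarrow> \<ominus>\<^bsub>M\<^esub> x \<in> N"
    "\<And>x y. x \<in> N \<Longrightarrow> y \<in> N \<Longrightarrow> x \<oplus>\<^bsub>M\<^esub> y \<in> N"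
    "\<And>r x. r \<in> carrier R \<Longrightarrow> x \<in> N \<Longrightarrow> r \<odot>\<^bsub>M\<^esub> x \<in> N"
  using assms by (auto simp: submodule_def submodule_axioms_def subgroup_def a_inv_def)

lemma (in left_module) submodule_kernel:
  assumes "left_module R N" "f \<in> mod_hom R M N"
  shows "submodule {x \<in> carrier M. f x = \<zero>\<^bsub>N\<^esub>} R M"
proof -
  have M: "left_module R M" by (rule left_module_axioms)
  interpret N: left_module R N by fact
  show ?thesis
    by (rule submoduleI_left)
      (auto simp: mod_hom_zero[OF M assms] mod_hom_uminus[OF M assms] mod_homD[OF assms(2)]
        lsmult_closed left_module_smult_zero[OF assms(1)])
qed

lemma (in left_module) submod_gen_submodule:
  assumes "S \<subseteq> carrier M"
  shows "submodule (submod_gen R M S) R M"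
proof -
  have "submod_gen R M S \<subseteq> carrier M"
    unfolding submod_gen_def using assms submodule_carrier by blast
  then show ?thesis
    by (intro submoduleI_left) (auto simp: submod_gen_def intro: submoduleD)
qed

lemma submod_gen_incl: "S \<subseteq> submod_gen R M S"
  by (auto simp: submod_gen_def)

lemma submod_gen_least: "submodule N R M \<Longrightarrow> S \<subseteq> N \<Longrightarrow> submod_gen R M S \<subseteq> N"
  by (auto simp: submod_gen_def)

lemma submodule_abelian_subgroup:
  assumes "left_module R M" "submodule N R M"
  shows "abelian_subgroup N M"
proof -
  interpret M: left_module R M by fact
  show ?thesis
    using assms(2)
    by (intro abelian_subgroupI3 additive_subgroupI) (auto simp: submodule_def M.M.abelian_group_axioms)
qed

text \<open>A linear map that kills N is constant on cosets of N, so the image of a coset is a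
  singleton. This is the well-definedness behind every induced map given as \<open>the_elem\<close>
  of an image.\<close>

lemma the_elem_image_coset:
  assumes "left_module R M" "left_module R U" "submodule N R M"
    and "f \<in> mod_hom R M U" "\<And>n. n \<in> N \<Longrightarrow> f n = \<zero>\<^bsub>U\<^esub>" "x \<in> carrier M"
  shows "the_elem (f ` (N +>\<^bsub>M\<^esub> x)) = f x"
proof -
  interpret M: left_module R M by fact
  interpret U: left_module R U by fact
  have "f (n \<oplus>\<^bsub>M\<^esub> x) = f x" if "n \<in> N" for n
    using that submoduleD(1)[OF assms(3)] assms(4-6) mod_homD[OF assms(4)]
    by (subst mod_homD(2)[OF assms(4)]) auto
  then have "f ` (N +>\<^bsub>M\<^esub> x) = {f x}"
    using submoduleD(2)[OF assms(3)] by (auto simp: a_r_coset_def' image_UN)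
  then show ?thesis by simp
qed

lemma quot_simps:
  "carrier (quot M N) = a_rcosets\<^bsub>M\<^esub> N" "zero (quot M N) = N"
  "one (quot M N) = N +>\<^bsub>M\<^esub> \<one>\<^bsub>M\<^esub>" "mult (quot M N) = rcoset_mult M N"
  "add (quot M N) = set_add M"
  by (simp_all add: quot_def)

lemma quot_carrierE:
  assumes "C \<in> carrier (quot M N)"
  obtains x where "x \<in> carrier M" "C = N +>\<^bsub>M\<^esub> x"
  using assms by (auto simp: quot_simps A_RCOSETS_def')

section \<open>Module structure on the quotient by a submodule\<close>

context
  fixes R :: "('r, 'c) ring_scheme" and M :: "('r, 'm, 'd) module_scheme" and N
  assumes M: "left_module R M" and N: "submodule N R M"
begin

interpretation M: left_module R M by (rule M)
interpretation N: abelian_subgroup N M by (rule submodule_abelian_subgroup[OF M N])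

lemma quot_in_carrier: "x \<in> carrier M \<Longrightarrow> N +>\<^bsub>M\<^esub> x \<in> carrier (quot M N)"
  by (auto simp: quot_simps A_RCOSETS_def')

lemma quot_add: "x \<in> carrier M \<Longrightarrow> y \<in> carrier M \<Longrightarrow>
   (N +>\<^bsub>M\<^esub> x) \<oplus>\<^bsub>quot M N\<^esub> (N +>\<^bsub>M\<^esub> y) = N +>\<^bsub>M\<^esub> (x \<oplus>\<^bsub>M\<^esub> y)"
  by (simp add: quot_simps N.a_rcos_sum)

lemma quot_eqI:
  assumes "x \<in> carrier M" "y \<in> carrier M" "x \<ominus>\<^bsub>M\<^esub> y \<in> N"
  shows "N +>\<^bsub>M\<^esub> x = N +>\<^bsub>M\<^esub> y"
proof -
  have "x \<in> N +>\<^bsub>M\<^esub> y"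
    using assms N.a_rcos_module[of y x] M.M.abelian_group_axioms by (simp add: a_minus_def)
  then show ?thesis
    using N.a_repr_independence'[of x y] assms by simp
qed

lemma quot_zero: "x \<in> N \<Longrightarrow> N +>\<^bsub>M\<^esub> x = \<zero>\<^bsub>quot M N\<^esub>"
  using N.a_rcos_const M.M.abelian_group_axioms by (auto simp: quot_simps)

text \<open>The action on a coset is defined as a union over all representatives. Two
  representatives differ by some n in N, and \<open>r \<odot> n\<close> lies in N again, so the
  cosets in the union coincide.\<close>

lemma quot_smult:
  assumes "r \<in> carrier R" "x \<in> carrier M"
  shows "r \<odot>\<^bsub>quot M N\<^esub> (N +>\<^bsub>M\<^esub> x) = N +>\<^bsub>M\<^esub> (r \<odot>\<^bsub>M\<^esub> x)"
proof -
  have "N +>\<^bsub>M\<^esub> (r \<odot>\<^bsub>M\<^esub> (n \<oplus>\<^bsub>M\<^esub> x)) = N +>\<^bsub>M\<^esub> (r \<odot>\<^bsub>M\<^esub> x)" if "n \<in> N" for n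
  proof (rule quot_eqI)
    have n: "n \<in> carrier M" and rn: "r \<odot>\<^bsub>M\<^esub> n \<in> N"
      using that submoduleD[OF N] assms by auto
    then show "r \<odot>\<^bsub>M\<^esub> (n \<oplus>\<^bsub>M\<^esub> x) \<in> carrier M" "r \<odot>\<^bsub>M\<^esub> x \<in> carrier M"
      using assms M.lsmult_closed by auto
    have "r \<odot>\<^bsub>M\<^esub> (n \<oplus>\<^bsub>M\<^esub> x) \<ominus>\<^bsub>M\<^esub> r \<odot>\<^bsub>M\<^esub> x = r \<odot>\<^bsub>M\<^esub> n"
      using n assms by (simp add: M.lsmult_r_distr M.lsmult_closed a_minus_def M.M.a_assoc M.M.r_neg)
    with rn show "r \<odot>\<^bsub>M\<^esub> (n \<oplus>\<^bsub>M\<^esub> x) \<ominus>\<^bsub>M\<^esub> r \<odot>\<^bsub>M\<^esub> x \<in> N" by simp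
  qed
  then show ?thesis
    using submoduleD(2)[OF N] by (auto simp: quot_def a_r_coset_def' )
qed

lemma quot_left_module: "left_module R (quot M N)"
proof -
  have z: "\<zero>\<^bsub>quot M N\<^esub> = N +>\<^bsub>M\<^esub> \<zero>\<^bsub>M\<^esub>"
    using quot_zero[OF submoduleD(2)[OF N]] by simp
  have "abelian_group (quot M N)"
  proof (rule abelian_groupI)
    fix C assume "C \<in> carrier (quot M N)"
    then obtain x where x: "x \<in> carrier M" "C = N +>\<^bsub>M\<^esub> x" by (rule quot_carrierE)
    show "\<exists>D\<in>carrier (quot M N). D \<oplus>\<^bsub>quot M N\<^esub> C = \<zero>\<^bsub>quot M N\<^esub>"
      by (rule bexI[of _ "N +>\<^bsub>M\<^esub> (\<ominus>\<^bsub>M\<^esub> x)"]) (auto simp: x quot_add z M.M.l_neg quot_in_carrier)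
  qed (auto elim!: quot_carrierE simp: quot_add z quot_in_carrier M.M.a_ac)
  then show ?thesis
    by (intro left_moduleI M.R.ring_axioms)
      (auto elim!: quot_carrierE simp: quot_add quot_smult quot_in_carrier
        M.lsmult_closed M.lsmult_l_distr M.lsmult_r_distr M.lsmult_assoc M.lsmult_one)
qed

lemma quot_proj_mod_hom: "(\<lambda>x. N +>\<^bsub>M\<^esub> x) \<in> mod_hom R M (quot M N)"
  by (intro mod_homI) (simp_all add: quot_in_carrier quot_add quot_smult)

end

context
  fixes R :: "('r, 'c) ring_scheme" and M :: "('r, 'm, 'd) module_scheme"
    and U :: "('r, 'u, 'e) module_scheme" and N and f :: "'m \<Rightarrow> 'u"
  assumes M: "left_module R M" and N: "submodule N R M"
    and U: "left_module R U" and f: "f \<in> mod_hom R M U" and f0: "\<And>x. x \<in> N \<Longrightarrow> f x = \<zero>\<^bsub>U\<^esub>"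
begin

lemma quot_lift_coset: "x \<in> carrier M \<Longrightarrow> the_elem (f ` (N +>\<^bsub>M\<^esub> x)) = f x"
  by (rule the_elem_image_coset[OF M U N f f0])

lemma quot_lift_mod_hom: "(\<lambda>C. the_elem (f ` C)) \<in> mod_hom R (quot M N) U"
proof -
  interpret M: left_module R M by (rule M)
  show ?thesis
    by (intro mod_homI) (auto elim!: quot_carrierE
        simp: quot_add[OF M N] quot_smult[OF M N] quot_lift_coset mod_homD[OF f] M.lsmult_closed)
qed

end

text \<open>The kernel of \<open>f\<close> is a submodule containing S, hence contains the least
  such submodule.\<close>

lemma mod_hom_vanish_submod_gen:
  assumes "left_module R M" "left_module R U" "f \<in> mod_hom R M U" "S \<subseteq> carrier M"
    and "\<And>x. x \<in> S \<Longrightarrow> f x = \<zero>\<^bsub>U\<^esub>" "x \<in> submod_gen R M S"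
  shows "f x = \<zero>\<^bsub>U\<^esub>"
proof -
  have "submod_gen R M S \<subseteq> {x \<in> carrier M. f x = \<zero>\<^bsub>U\<^esub>}"
    using assms left_module.submodule_kernel by (intro submod_gen_least) blast+
  then show ?thesis using assms by blast
qed

section \<open>Free modules and tensor products\<close>

text \<open>Both partial maps are members of \<open>mod_hom\<close>, so that after fixing either
  variable the result can be used wherever a linear map is expected.\<close>

definition bilinear_map where
  "bilinear_map K V W U \<beta> \<longleftrightarrow>
     (\<forall>v\<in>carrier V. \<beta> v \<in> mod_hom K W U) \<and> (\<forall>w\<in>carrier W. (\<lambda>v. \<beta> v w) \<in> mod_hom K V U)"

lemma bilinear_mapD:
  assumes "bilinear_map K V W U \<beta>"
  shows "\<And>v. v \<in> carrier V \<Longrightarrow> \<beta> v \<in> mod_hom K W U"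
    and "\<And>w. w \<in> carrier W \<Longrightarrow> (\<lambda>v. \<beta> v w) \<in> mod_hom K V U"
    and "\<And>v w. v \<in> carrier V \<Longrightarrow> w \<in> carrier W \<Longrightarrow> \<beta> v w \<in> carrier U"
    and "\<And>v v' w. v \<in> carrier V \<Longrightarrow> v' \<in> carrier V \<Longrightarrow> w \<in> carrier W \<Longrightarrow>
       \<beta> (v \<oplus>\<^bsub>V\<^esub> v') w = \<beta> v w \<oplus>\<^bsub>U\<^esub> \<beta> v' w"
    and "\<And>v w w'. v \<in> carrier V \<Longrightarrow> w \<in> carrier W \<Longrightarrow> w' \<in> carrier W \<Longrightarrow>
       \<beta> v (w \<oplus>\<^bsub>W\<^esub> w') = \<beta> v w \<oplus>\<^bsub>U\<^esub> \<beta> v w'"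
    and "\<And>c v w. c \<in> carrier K \<Longrightarrow> v \<in> carrier V \<Longrightarrow> w \<in> carrier W \<Longrightarrow>
       \<beta> (c \<odot>\<^bsub>V\<^esub> v) w = c \<odot>\<^bsub>U\<^esub> \<beta> v w"
    and "\<And>c v w. c \<in> carrier K \<Longrightarrow> v \<in> carrier V \<Longrightarrow> w \<in> carrier W \<Longrightarrow>
       \<beta> v (c \<odot>\<^bsub>W\<^esub> w) = c \<odot>\<^bsub>U\<^esub> \<beta> v w"
  using assms by (auto simp: bilinear_map_def mod_hom_def Pi_iff)

lemma bilinear_mapI:
  assumes "\<And>v w. v \<in> carrier V \<Longrightarrow> w \<in> carrier W \<Longrightarrow> \<beta> v w \<in> carrier U"
    and "\<And>v v' w. v \<in> carrier V \<Longrightarrow> v' \<in> carrier V \<Longrightarrow> w \<in> carrier W \<Longrightarrow>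
       \<beta> (v \<oplus>\<^bsub>V\<^esub> v') w = \<beta> v w \<oplus>\<^bsub>U\<^esub> \<beta> v' w"
    and "\<And>v w w'. v \<in> carrier V \<Longrightarrow> w \<in> carrier W \<Longrightarrow> w' \<in> carrier W \<Longrightarrow>
       \<beta> v (w \<oplus>\<^bsub>W\<^esub> w') = \<beta> v w \<oplus>\<^bsub>U\<^esub> \<beta> v w'"
    and "\<And>c v w. c \<in> carrier K \<Longrightarrow> v \<in> carrier V \<Longrightarrow> w \<in> carrier W \<Longrightarrow>
       \<beta> (c \<odot>\<^bsub>V\<^esub> v) w = c \<odot>\<^bsub>U\<^esub> \<beta> v w"
    and "\<And>c v w. c \<in> carrier K \<Longrightarrow> v \<in> carrier V \<Longrightarrow> w \<in> carrier W \<Longrightarrow>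
       \<beta> v (c \<odot>\<^bsub>W\<^esub> w) = c \<odot>\<^bsub>U\<^esub> \<beta> v w"
  shows "bilinear_map K V W U \<beta>"
  using assms by (auto simp: bilinear_map_def mod_hom_def Pi_iff)

lemma bilinear_map_comp:
  assumes "bilinear_map K V W U \<beta>" "f \<in> mod_hom K U U'"
  shows "bilinear_map K V W U' (\<lambda>v w. f (\<beta> v w))"
  using assms by (intro bilinear_mapI) (simp_all add: bilinear_mapD[OF assms(1)] mod_homD[OF assms(2)])

lemma bilinear_map_precomp:
  assumes "bilinear_map K V W U \<beta>" "f \<in> mod_hom K V' V" "g \<in> mod_hom K W' W"
  shows "bilinear_map K V' W' U (\<lambda>v w. \<beta> (f v) (g w))"
  by (intro bilinear_mapI)
    (simp_all add: bilinear_mapD[OF assms(1)] mod_homD[OF assms(2)] mod_homD[OF assms(3)])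

lemma mod_hom_ident: "(\<lambda>x. x) \<in> mod_hom R M M"
  by (simp add: mod_hom_def)

section \<open>Free modules and linear maps out of them\<close>

context
  fixes K :: "('k, 'c) ring_scheme"
  assumes K: "field K"
begin

interpretation K: field K by (rule K)

lemma free_mod_simps:
  "zero (free_mod K S) = (\<lambda>s. \<zero>\<^bsub>K\<^esub>)" "add (free_mod K S) = (\<lambda>f g s. f s \<oplus>\<^bsub>K\<^esub> g s)"
  "smult (free_mod K S) = (\<lambda>c f s. c \<otimes>\<^bsub>K\<^esub> f s)"
  by (simp_all add: free_mod_def)

lemma free_mod_carrier: "f \<in> carrier (free_mod K S) \<longleftrightarrow>
  (\<forall>s. f s \<in> carrier K) \<and> finite {s. f s \<noteq> \<zero>\<^bsub>K\<^esub>} \<and> {s. f s \<noteq> \<zero>\<^bsub>K\<^esub>} \<subseteq> S"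
  by (auto simp: free_mod_def)

lemma free_modI:
  assumes "\<And>s. f s \<in> carrier K" "finite T" "T \<subseteq> S" "\<And>s. s \<notin> T \<Longrightarrow> f s = \<zero>\<^bsub>K\<^esub>"
  shows "f \<in> carrier (free_mod K S)"
proof -
  have "{s. f s \<noteq> \<zero>\<^bsub>K\<^esub>} \<subseteq> T" using assms by blast
  then show ?thesis using assms by (auto simp: free_mod_carrier intro: finite_subset)
qed

lemma free_mod_left_module: "left_module K (free_mod K S)"
proof -
  let ?F = "free_mod K S"
  have add: "(\<lambda>s. f s \<oplus>\<^bsub>K\<^esub> g s) \<in> carrier ?F" if "f \<in> carrier ?F" "g \<in> carrier ?F" for f g
    using that
    by (intro free_modI[of _ "{s. f s \<noteq> \<zero>\<^bsub>K\<^esub>} \<union> {s. g s \<noteq> \<zero>\<^bsub>K\<^esub>}"]) (auto simp: free_mod_carrier)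
  have smult: "(\<lambda>s. c \<otimes>\<^bsub>K\<^esub> f s) \<in> carrier ?F" if "f \<in> carrier ?F" "c \<in> carrier K" for f c
    using that
    by (intro free_modI[of _ "{s. f s \<noteq> \<zero>\<^bsub>K\<^esub>}"]) (auto simp: free_mod_carrier)
  have c: "f s \<in> carrier K" if "f \<in> carrier ?F" for f s
    using that by (simp add: free_mod_carrier)
  have "abelian_group ?F"
  proof (rule abelian_groupI)
    fix f assume f: "f \<in> carrier ?F"
    show "\<exists>g\<in>carrier ?F. g \<oplus>\<^bsub>?F\<^esub> f = \<zero>\<^bsub>?F\<^esub>"
      using f by (intro bexI[of _ "\<lambda>s. \<ominus>\<^bsub>K\<^esub> f s"] free_modI[of _ "{s. f s \<noteq> \<zero>\<^bsub>K\<^esub>}"])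
          (auto simp: free_mod_simps K.l_neg free_mod_carrier)
  qed (auto simp: free_mod_simps add c fun_eq_iff K.a_ac intro: free_modI[of _ "{}"])
  then show ?thesis
    by (intro left_moduleI K.ring_axioms)
      (auto simp: free_mod_simps smult c fun_eq_iff K.l_distr K.r_distr K.m_assoc)
qed

lemma single_in_free_mod: "s \<in> S \<Longrightarrow> single K s \<in> carrier (free_mod K S)"
  by (rule free_modI[of _ "{s}"]) (auto simp: single_def)

text \<open>Induction over a finite set containing the support, with the function left general, so
  that removing one point gives an instance of the induction hypothesis.\<close>

lemma free_mod_induct [consumes 1, case_names zero add]:
  assumes "f \<in> carrier (free_mod K S)"
    and "P \<zero>\<^bsub>free_mod K S\<^esub>"
    and "\<And>c s g. c \<in> carrier K \<Longrightarrow> s \<in> S \<Longrightarrow> g \<in> carrier (free_mod K S) \<Longrightarrow> P g \<Longrightarrow>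
       P ((c \<odot>\<^bsub>free_mod K S\<^esub> single K s) \<oplus>\<^bsub>free_mod K S\<^esub> g)"
  shows "P f"
proof -
  have "finite T \<Longrightarrow> T \<subseteq> S \<Longrightarrow> \<forall>s. f s \<in> carrier K \<Longrightarrow> {s. f s \<noteq> \<zero>\<^bsub>K\<^esub>} \<subseteq> T \<Longrightarrow> P f" for T f
  proof (induction T arbitrary: f rule: finite_induct)
    case empty
    then have "f = \<zero>\<^bsub>free_mod K S\<^esub>" by (auto simp: free_mod_simps)
    with assms(2) show ?case by simp
  next
    case (insert t T)
    \<comment> \<open>Clearing the value at \<open>t\<close> moves the support into
      \<open>T\<close>; \<open>f\<close> is recovered by adding \<open>f t\<close> times the basis
      vector at \<open>t\<close>.\<close>
    define g where "g = f(t := \<zero>\<^bsub>K\<^esub>)"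
    have "P g" using insert.prems by (intro insert.IH) (auto simp: g_def)
    moreover have "g \<in> carrier (free_mod K S)"
      using insert by (intro free_modI[of _ T]) (auto simp: g_def)
    moreover have "f = (f t \<odot>\<^bsub>free_mod K S\<^esub> single K t) \<oplus>\<^bsub>free_mod K S\<^esub> g"
      using insert.prems by (auto simp: free_mod_simps g_def single_def fun_eq_iff)
    ultimately show ?case using insert.prems assms(3)[of "f t" t g] by auto
  qed
  then show ?thesis using assms(1) by (auto simp: free_mod_carrier)
qed

context
  fixes U :: "('k, 'u, 'd) module_scheme" and S :: "'s set" and b :: "'s \<Rightarrow> 'u"
  assumes U: "left_module K U" and b: "\<And>s. s \<in> S \<Longrightarrow> b s \<in> carrier U"
begin

interpretation U: left_module K U by (rule U)
interpretation Um: module K U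
  using U K.is_cring by (simp add: module_iff_left_module)

text \<open>Terms with coefficient zero contribute nothing. \<open>free_lift\<close> sums over the
  support, which differs for two functions and for their sum; a common finite index set makes these
  sums comparable.\<close>

lemma free_lift_superset:
  assumes "f \<in> carrier (free_mod K S)" "finite T" "T \<subseteq> S" "{s. f s \<noteq> \<zero>\<^bsub>K\<^esub>} \<subseteq> T"
  shows "free_lift K U b f = (\<Oplus>\<^bsub>U\<^esub>s\<in>T. f s \<odot>\<^bsub>U\<^esub> b s)"
  unfolding free_lift_def using assms b
  by (intro U.M.add.finprod_mono_neutral_cong_left) (auto simp: free_mod_carrier)

lemma free_lift_mod_hom: "free_lift K U b \<in> mod_hom K (free_mod K S) U"
proof -
  interpret F: left_module K "free_mod K S" by (rule free_mod_left_module)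
  show ?thesis
  proof (rule mod_homI)
    fix f assume f: "f \<in> carrier (free_mod K S)"
    then show "free_lift K U b f \<in> carrier U"
      unfolding free_lift_def using b by (intro U.M.finsum_closed) (auto simp: free_mod_carrier)
    fix c assume c: "c \<in> carrier K"
    have "free_lift K U b (c \<odot>\<^bsub>free_mod K S\<^esub> f) =
       (\<Oplus>\<^bsub>U\<^esub>s\<in>{s. f s \<noteq> \<zero>\<^bsub>K\<^esub>}. (c \<odot>\<^bsub>free_mod K S\<^esub> f) s \<odot>\<^bsub>U\<^esub> b s)"
      using f c by (intro free_lift_superset F.lsmult_closed) (auto simp: free_mod_simps free_mod_carrier)
    also have "\<dots> = (\<Oplus>\<^bsub>U\<^esub>s\<in>{s. f s \<noteq> \<zero>\<^bsub>K\<^esub>}. c \<odot>\<^bsub>U\<^esub> (f s \<odot>\<^bsub>U\<^esub> b s))"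
      using f c b by (intro U.M.finsum_cong') (auto simp: free_mod_simps free_mod_carrier Um.smult_assoc1)
    also have "\<dots> = c \<odot>\<^bsub>U\<^esub> free_lift K U b f"
      unfolding free_lift_def using f c b
      by (intro Um.finsum_smult_ldistr[symmetric]) (auto simp: free_mod_carrier)
    finally show "free_lift K U b (c \<odot>\<^bsub>free_mod K S\<^esub> f) = c \<odot>\<^bsub>U\<^esub> free_lift K U b f" .
  next
    fix f g assume f: "f \<in> carrier (free_mod K S)" and g: "g \<in> carrier (free_mod K S)"
    define T where "T = {s. f s \<noteq> \<zero>\<^bsub>K\<^esub>} \<union> {s. g s \<noteq> \<zero>\<^bsub>K\<^esub>}"
    have T: "finite T" "T \<subseteq> S" using f g by (auto simp: T_def free_mod_carrier)
    have "free_lift K U b (f \<oplus>\<^bsub>free_mod K S\<^esub> g) = (\<Oplus>\<^bsub>U\<^esub>s\<in>T. (f \<oplus>\<^bsub>free_mod K S\<^esub> g) s \<odot>\<^bsub>U\<^esub> b s)"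
      using f g T by (intro free_lift_superset F.M.a_closed) (auto simp: free_mod_simps T_def)
    also have "\<dots> = (\<Oplus>\<^bsub>U\<^esub>s\<in>T. (f s \<odot>\<^bsub>U\<^esub> b s) \<oplus>\<^bsub>U\<^esub> (g s \<odot>\<^bsub>U\<^esub> b s))"
      using f g T b
      by (intro U.M.finsum_cong') (auto simp: free_mod_simps free_mod_carrier Um.smult_l_distr subset_iff)
    also have "\<dots> = (\<Oplus>\<^bsub>U\<^esub>s\<in>T. f s \<odot>\<^bsub>U\<^esub> b s) \<oplus>\<^bsub>U\<^esub> (\<Oplus>\<^bsub>U\<^esub>s\<in>T. g s \<odot>\<^bsub>U\<^esub> b s)"
      using f g T b by (intro U.M.finsum_addf) (auto simp: free_mod_carrier subset_iff)
    also have "\<dots> = free_lift K U b f \<oplus>\<^bsub>U\<^esub> free_lift K U b g"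
      using free_lift_superset[OF f T] free_lift_superset[OF g T] by (simp add: T_def)
    finally show "free_lift K U b (f \<oplus>\<^bsub>free_mod K S\<^esub> g) = free_lift K U b f \<oplus>\<^bsub>U\<^esub> free_lift K U b g" .
  qed
qed

lemma free_lift_single: "s \<in> S \<Longrightarrow> free_lift K U b (single K s) = b s"
  using free_lift_superset[OF single_in_free_mod, of s "{s}"] b[of s]
  by (auto simp: single_def)

end

lemma free_mod_hom_ext:
  assumes "left_module K U" "f \<in> mod_hom K (free_mod K S) U" "g \<in> mod_hom K (free_mod K S) U"
    and "\<And>s. s \<in> S \<Longrightarrow> f (single K s) = g (single K s)" "x \<in> carrier (free_mod K S)"
  shows "f x = g x"
  using assms(5)
proof (induction rule: free_mod_induct)
  case zero
  then show ?case
    using mod_hom_zero[OF free_mod_left_module] assms by metis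
next
  case (add c s y)
  interpret F: left_module K "free_mod K S" by (rule free_mod_left_module)
  show ?case using add assms(4)
    by (simp add: mod_homD[OF assms(2)] mod_homD[OF assms(3)] F.lsmult_closed single_in_free_mod)
qed

end

lemma bilinear_map_cong:
  assumes "bilinear_map K V W U \<beta>" "left_module K V" "left_module K W"
    and "\<And>v w. v \<in> carrier V \<Longrightarrow> w \<in> carrier W \<Longrightarrow> \<beta> v w = \<beta>' v w"
  shows "bilinear_map K V W U \<beta>'"
  using assms(1,4) by (auto simp: bilinear_map_def intro: mod_hom_cong assms(2,3))

section \<open>The tensor product of two vector spaces and its universal property\<close>

context
  fixes K :: "('k, 'c) ring_scheme"
    and V :: "('k, 'v, 'd) module_scheme" and W :: "('k, 'w, 'e) module_scheme"
  assumes K: "field K" and V: "left_module K V" and W: "left_module K W"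
begin

interpretation K: field K by (rule K)
interpretation V: left_module K V by (rule V)
interpretation W: left_module K W by (rule W)

private abbreviation (input) "F \<equiv> free_mod K (carrier V \<times> carrier W)"

interpretation F: left_module K F by (rule free_mod_left_module[OF K])

lemma bilin_rels_carrier: "bilin_rels K V W \<subseteq> carrier F"
  by (auto simp: bilin_rels_def Let_def intro!: F.M.minus_closed F.M.a_closed F.lsmult_closed
      single_in_free_mod[OF K] V.lsmult_closed W.lsmult_closed)

lemma bilin_relsI:
  assumes "v \<in> carrier V" "w \<in> carrier W"
  shows "v' \<in> carrier V \<Longrightarrow>
      single K (v \<oplus>\<^bsub>V\<^esub> v', w) \<ominus>\<^bsub>F\<^esub> (single K (v, w) \<oplus>\<^bsub>F\<^esub> single K (v', w)) \<in> bilin_rels K V W"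
    and "w' \<in> carrier W \<Longrightarrow>
      single K (v, w \<oplus>\<^bsub>W\<^esub> w') \<ominus>\<^bsub>F\<^esub> (single K (v, w) \<oplus>\<^bsub>F\<^esub> single K (v, w')) \<in> bilin_rels K V W"
    and "c \<in> carrier K \<Longrightarrow>
      single K (c \<odot>\<^bsub>V\<^esub> v, w) \<ominus>\<^bsub>F\<^esub> (c \<odot>\<^bsub>F\<^esub> single K (v, w)) \<in> bilin_rels K V W"
    and "c \<in> carrier K \<Longrightarrow>
      single K (v, c \<odot>\<^bsub>W\<^esub> w) \<ominus>\<^bsub>F\<^esub> (c \<odot>\<^bsub>F\<^esub> single K (v, w)) \<in> bilin_rels K V W"
  using assms unfolding bilin_rels_def Let_def by blast+

lemma tensor_null_submodule: "submodule (tensor_null K V W) K F"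
  unfolding tensor_null_def by (rule F.submod_gen_submodule[OF bilin_rels_carrier])

lemma tensor_left_module: "left_module K (tensor K V W)"
  unfolding tensor_def by (rule quot_left_module[OF F.left_module_axioms tensor_null_submodule])

text \<open>In each law the two sides come from elements of the free module whose difference is a
  generator in \<open>bilin_rels\<close>, so their classes agree.\<close>

lemma tens_bilinear: "bilinear_map K V W (tensor K V W) (tens K V W)"
proof -
  let ?Q = "quot F (tensor_null K V W)"
  let ?cls = "\<lambda>x. tensor_null K V W +>\<^bsub>F\<^esub> x"
  note q = F.left_module_axioms tensor_null_submodule
  have eq: "?cls x = ?cls y"
    if "x \<in> carrier F" "y \<in> carrier F" "x \<ominus>\<^bsub>F\<^esub> y \<in> bilin_rels K V W" for x y
    using that submod_gen_incl[of "bilin_rels K V W" K F]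
    by (intro quot_eqI[OF q]) (auto simp: tensor_null_def)
  have s: "single K (v, w) \<in> carrier F" if "v \<in> carrier V" "w \<in> carrier W" for v w
    using that by (simp add: single_in_free_mod[OF K])
  show ?thesis
    unfolding tensor_def tens_def
  proof (rule bilinear_mapI)
    fix v v' w assume a: "v \<in> carrier V" "v' \<in> carrier V" "w \<in> carrier W"
    show "?cls (single K (v \<oplus>\<^bsub>V\<^esub> v', w)) =
      (?cls (single K (v, w))) \<oplus>\<^bsub>?Q\<^esub>
      (?cls (single K (v', w)))"
      unfolding quot_add[OF q s[OF a(1,3)] s[OF a(2,3)]]
      by (rule eq) (simp_all add: a s bilin_relsI V.lsmult_closed W.lsmult_closed F.lsmult_closed)
  next
    fix v w w' assume a: "v \<in> carrier V" "w \<in> carrier W" "w' \<in> carrier W"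
    show "?cls (single K (v, w \<oplus>\<^bsub>W\<^esub> w')) =
      (?cls (single K (v, w))) \<oplus>\<^bsub>?Q\<^esub>
      (?cls (single K (v, w')))"
      unfolding quot_add[OF q s[OF a(1,2)] s[OF a(1,3)]]
      by (rule eq) (simp_all add: a s bilin_relsI V.lsmult_closed W.lsmult_closed F.lsmult_closed)
  next
    fix c v w assume a: "c \<in> carrier K" "v \<in> carrier V" "w \<in> carrier W"
    note c = F.lsmult_closed[OF a(1) s[OF a(2,3)]]
    show "?cls (single K (c \<odot>\<^bsub>V\<^esub> v, w)) =
      c \<odot>\<^bsub>?Q\<^esub> (?cls (single K (v, w)))"
      unfolding quot_smult[OF q a(1) s[OF a(2,3)]]
      by (rule eq) (simp_all add: a s bilin_relsI V.lsmult_closed W.lsmult_closed F.lsmult_closed)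
    show "?cls (single K (v, c \<odot>\<^bsub>W\<^esub> w)) =
      c \<odot>\<^bsub>?Q\<^esub> (?cls (single K (v, w)))"
      unfolding quot_smult[OF q a(1) s[OF a(2,3)]]
      by (rule eq) (simp_all add: a s bilin_relsI V.lsmult_closed W.lsmult_closed F.lsmult_closed)
  qed (simp add: quot_in_carrier[OF q] s)
qed

lemmas tens_closed = bilinear_mapD(3)[OF tens_bilinear]

text \<open>A class in the tensor product has a representative that is a finite combination of basis
  vectors \<open>single K (v, w)\<close>, and the class of such a vector is a pure tensor.\<close>

lemma tensor_span:
  assumes N: "submodule N K (tensor K V W)"
    and tens: "\<And>v w. v \<in> carrier V \<Longrightarrow> w \<in> carrier W \<Longrightarrow> tens K V W v w \<in> N"
  shows "carrier (tensor K V W) \<subseteq> N"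
proof
  fix t assume "t \<in> carrier (tensor K V W)"
  then obtain x where x: "x \<in> carrier F" "t = tensor_null K V W +>\<^bsub>F\<^esub> x"
    unfolding tensor_def by (rule quot_carrierE)
  note q = F.left_module_axioms tensor_null_submodule
  from x(1) have "tensor_null K V W +>\<^bsub>F\<^esub> x \<in> N"
  proof (induction rule: free_mod_induct[OF K, consumes 1, case_names zero add])
    case zero
    then show ?case
      using submoduleD(2)[OF N] quot_zero[OF q submoduleD(2)[OF q(2)]] by (simp add: tensor_def)
  next
    case (add c s g)
    have s: "single K s \<in> carrier F" using add by (intro single_in_free_mod[OF K])
    have "tensor_null K V W +>\<^bsub>F\<^esub> single K s \<in> N"
      using add tens by (cases s) (auto simp: tens_def)
    then have "c \<odot>\<^bsub>tensor K V W\<^esub> (tensor_null K V W +>\<^bsub>F\<^esub> single K s)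
        \<oplus>\<^bsub>tensor K V W\<^esub> (tensor_null K V W +>\<^bsub>F\<^esub> g) \<in> N"
      using add submoduleD[OF N] by simp
    then show ?case
      using add s by (simp add: tensor_def quot_smult[OF q] quot_add[OF q] F.lsmult_closed)
  qed
  with x show "t \<in> N" by simp
qed

context
  fixes U :: "('k, 'u, 'f) module_scheme"
  assumes U: "left_module K U"
begin

interpretation U: left_module K U by (rule U)

text \<open>The elements on which two linear maps agree form a submodule; if it contains the pure
  tensors, it is everything. Identities between Sweedler sums are reduced to pure tensors in this
  way.\<close>

lemma tensor_ext:
  assumes f: "f \<in> mod_hom K (tensor K V W) U" and g: "g \<in> mod_hom K (tensor K V W) U"
    and "\<And>v w. v \<in> carrier V \<Longrightarrow> w \<in> carrier W \<Longrightarrow> f (tens K V W v w) = g (tens K V W v w)"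
    and "t \<in> carrier (tensor K V W)"
  shows "f t = g t"
proof -
  interpret T: left_module K "tensor K V W" by (rule tensor_left_module)
  have "submodule {t \<in> carrier (tensor K V W). f t = g t} K (tensor K V W)"
    by (rule T.submoduleI_left)
      (auto simp: mod_homD[OF f] mod_homD[OF g] T.lsmult_closed
        mod_hom_zero[OF tensor_left_module U f] mod_hom_zero[OF tensor_left_module U g]
        mod_hom_uminus[OF tensor_left_module U f] mod_hom_uminus[OF tensor_left_module U g])
  from tensor_span[OF this] show ?thesis
    using assms(3,4) tens_closed by auto
qed

context
  fixes \<beta> :: "'v \<Rightarrow> 'w \<Rightarrow> 'u"
  assumes \<beta>: "bilinear_map K V W U \<beta>"
begin

text \<open>Bilinearity of \<open>\<beta>\<close> turns the value on each generator into a
  difference of two equal elements.\<close>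

lemma free_lift_bilin_rels:
  assumes "r \<in> bilin_rels K V W"
  shows "free_lift K U (\<lambda>(v, w). \<beta> v w) r = \<zero>\<^bsub>U\<^esub>"
proof -
  let ?l = "free_lift K U (\<lambda>(v, w). \<beta> v w)"
  have b: "(\<lambda>(v, w). \<beta> v w) s \<in> carrier U" if "s \<in> carrier V \<times> carrier W" for s
    using that bilinear_mapD[OF \<beta>] by auto
  note l = free_lift_mod_hom[OF K U b]
  have ls: "?l (single K (v, w)) = \<beta> v w" if "v \<in> carrier V" "w \<in> carrier W" for v w
    using free_lift_single[OF K U, of "carrier V \<times> carrier W"] b that by auto
  have s: "single K (v, w) \<in> carrier F" if "v \<in> carrier V" "w \<in> carrier W" for v w
    using that by (simp add: single_in_free_mod[OF K])
  have m: "x \<ominus>\<^bsub>U\<^esub> x = \<zero>\<^bsub>U\<^esub>" if "x \<in> carrier U" for x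
    using that by (simp add: a_minus_def U.M.r_neg)
  show ?thesis
    using assms unfolding bilin_rels_def Let_def
    by (auto simp: mod_hom_minus[OF F.left_module_axioms U l] mod_homD[OF l] ls s m
        bilinear_mapD[OF \<beta>] V.lsmult_closed W.lsmult_closed F.lsmult_closed U.lsmult_closed)
qed

lemma free_lift_tensor_null:
  assumes "r \<in> tensor_null K V W"
  shows "free_lift K U (\<lambda>(v, w). \<beta> v w) r = \<zero>\<^bsub>U\<^esub>"
  using assms unfolding tensor_null_def
  by (intro mod_hom_vanish_submod_gen[OF F.left_module_axioms U free_lift_mod_hom[OF K U]
        bilin_rels_carrier free_lift_bilin_rels])
    (auto simp: bilinear_mapD[OF \<beta>])

lemma free_lift_bilinear: "free_lift K U (\<lambda>(v, w). \<beta> v w) \<in> mod_hom K F U"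
  using bilinear_mapD[OF \<beta>] by (intro free_lift_mod_hom[OF K U]) auto

lemma tensor_lift_mod_hom: "tensor_lift K U \<beta> \<in> mod_hom K (tensor K V W) U"
  unfolding tensor_def tensor_lift_def
  by (rule quot_lift_mod_hom[OF F.left_module_axioms tensor_null_submodule U
        free_lift_bilinear free_lift_tensor_null])

lemma tensor_lift_tens:
  assumes "v \<in> carrier V" "w \<in> carrier W"
  shows "tensor_lift K U \<beta> (tens K V W v w) = \<beta> v w"
proof -
  have "tensor_lift K U \<beta> (tens K V W v w) = free_lift K U (\<lambda>(v, w). \<beta> v w) (single K (v, w))"
    unfolding tens_def tensor_lift_def using assms
    by (intro quot_lift_coset[OF F.left_module_axioms tensor_null_submodule U
        free_lift_bilinear free_lift_tensor_null] single_in_free_mod[OF K]) auto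
  also have "\<dots> = \<beta> v w"
    using assms bilinear_mapD[OF \<beta>]
    by (subst free_lift_single[OF K U, of "carrier V \<times> carrier W"]) auto
  finally show ?thesis .
qed

lemmas tensor_lift_closed = mod_homD(1)[OF tensor_lift_mod_hom]

lemma tensor_lift_unique:
  assumes "f \<in> mod_hom K (tensor K V W) U"
    and "\<And>v w. v \<in> carrier V \<Longrightarrow> w \<in> carrier W \<Longrightarrow> f (tens K V W v w) = \<beta> v w"
    and "t \<in> carrier (tensor K V W)"
  shows "tensor_lift K U \<beta> t = f t"
  using tensor_ext[OF tensor_lift_mod_hom assms(1)] assms(2,3) by (simp add: tensor_lift_tens)

end

end

text \<open>Agreement on the carriers makes \<open>\<beta>'\<close> bilinear as well, and the two
  lifts then agree on pure tensors. It is the rule for rewriting under a Sweedler sum.\<close>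

lemma tensor_lift_cong:
  assumes "left_module K U" "bilinear_map K V W U \<beta>"
    and "\<And>v w. v \<in> carrier V \<Longrightarrow> w \<in> carrier W \<Longrightarrow> \<beta> v w = \<beta>' v w"
    and "t \<in> carrier (tensor K V W)"
  shows "tensor_lift K U \<beta> t = tensor_lift K U \<beta>' t"
proof -
  have b': "bilinear_map K V W U \<beta>'" by (rule bilinear_map_cong[OF assms(2) V W]) (rule assms(3))
  show ?thesis
    by (rule tensor_lift_unique[OF assms(1,2) tensor_lift_mod_hom[OF assms(1) b'] _ assms(4)])
      (simp add: tensor_lift_tens[OF assms(1) b'] flip: assms(3))
qed

text \<open>Both sides are linear in \<open>t\<close> and agree on pure tensors. It is the rule for
  moving a linear map inside a Sweedler sum.\<close>

lemma tensor_lift_comp: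
  assumes "left_module K U" "left_module K U'" "bilinear_map K V W U \<beta>" "f \<in> mod_hom K U U'"
    and "t \<in> carrier (tensor K V W)"
  shows "f (tensor_lift K U \<beta> t) = tensor_lift K U' (\<lambda>v w. f (\<beta> v w)) t"
proof -
  note b' = bilinear_map_comp[OF assms(3,4)]
  show ?thesis
    by (rule tensor_lift_unique[symmetric, OF assms(2) b'
          mod_hom_comp[OF tensor_lift_mod_hom[OF assms(1,3)] assms(4)]])
      (simp_all add: tensor_lift_tens[OF assms(1,3)] assms(5))
qed

lemma tensor_map_ident:
  assumes "t \<in> carrier (tensor K V W)"
    and "\<And>v. v \<in> carrier V \<Longrightarrow> f v = v" "\<And>w. w \<in> carrier W \<Longrightarrow> g w = w"
  shows "tensor_map K V W f g t = t"
  unfolding tensor_map_def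
  using assms by (intro tensor_lift_unique[OF tensor_left_module _ mod_hom_ident]
      bilinear_map_cong[OF tens_bilinear V W]) auto

end

section \<open>Tensor products of linear maps\<close>

context
  fixes K :: "('k, 'c) ring_scheme"
    and V :: "('k, 'v, 'd) module_scheme" and W :: "('k, 'w, 'e) module_scheme"
    and V' :: "('k, 'v2, 'd2) module_scheme" and W' :: "('k, 'w2, 'e2) module_scheme"
    and f g
  assumes K: "field K" and V: "left_module K V" and W: "left_module K W"
    and V': "left_module K V'" and W': "left_module K W'"
    and f: "f \<in> mod_hom K V V'" and g: "g \<in> mod_hom K W W'"
begin

lemma tensor_map_bilinear: "bilinear_map K V W (tensor K V' W') (\<lambda>v w. tens K V' W' (f v) (g w))"
  by (rule bilinear_map_precomp[OF tens_bilinear[OF K V' W'] f g])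

lemma tensor_map_mod_hom:
  "tensor_map K V' W' f g \<in> mod_hom K (tensor K V W) (tensor K V' W')"
  unfolding tensor_map_def
  by (rule tensor_lift_mod_hom[OF K V W tensor_left_module[OF K V' W'] tensor_map_bilinear])

lemma tensor_map_tens:
  "v \<in> carrier V \<Longrightarrow> w \<in> carrier W \<Longrightarrow>
   tensor_map K V' W' f g (tens K V W v w) = tens K V' W' (f v) (g w)"
  unfolding tensor_map_def
  by (rule tensor_lift_tens[OF K V W tensor_left_module[OF K V' W'] tensor_map_bilinear])

text \<open>Substitution in a Sweedler sum. It is applied when a coaction is known as the image of
  another one under \<open>f \<otimes> g\<close>, as for comodule maps and for
  coassociativity.\<close>

lemma tensor_lift_tensor_map:
  assumes U: "left_module K U" and \<beta>: "bilinear_map K V' W' U \<beta>"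
    and t: "t \<in> carrier (tensor K V W)"
  shows "tensor_lift K U \<beta> (tensor_map K V' W' f g t) = tensor_lift K U (\<lambda>v w. \<beta> (f v) (g w)) t"
  by (rule tensor_lift_unique[OF K V W U bilinear_map_precomp[OF \<beta> f g]
      mod_hom_comp[OF tensor_map_mod_hom tensor_lift_mod_hom[OF K V' W' U \<beta>]] _ t, symmetric])
    (simp add: tensor_map_tens tensor_lift_tens[OF K V' W' U \<beta>] mod_homD[OF f] mod_homD[OF g])

end

section \<open>Modules over algebras and extension of scalars\<close>

lemma with_action_simps [simp]:
  "carrier (with_action M act) = carrier M" "zero (with_action M act) = zero M"
  "add (with_action M act) = add M" "smult (with_action M act) = act"
  by (simp_all add: with_action_def)

lemma kmod_simps:
  "carrier (kmod A M) = carrier M" "zero (kmod A M) = zero M" "add (kmod A M) = add M"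
  "smult (kmod A M) = (\<lambda>c m. (c \<odot>\<^bsub>A\<^esub> \<one>\<^bsub>A\<^esub>) \<odot>\<^bsub>M\<^esub> m)"
  by (simp_all add: kmod_def)

lemma with_action_abelian_group:
  assumes "abelian_group M"
  shows "abelian_group (with_action M act)"
proof -
  interpret abelian_group M by fact
  show ?thesis by (rule abelian_groupI) (auto simp: a_ac intro: bexI[of _ "\<ominus>\<^bsub>M\<^esub> x" for x] l_neg)
qed

lemma (in k_algebra) left_module_K: "left_module K A"
  using module_axioms by (simp add: module_iff_left_module)

lemma (in k_algebra) smult_one_mult:
  assumes "c \<in> carrier K" "x \<in> carrier A"
  shows "(c \<odot>\<^bsub>A\<^esub> \<one>\<^bsub>A\<^esub>) \<otimes>\<^bsub>A\<^esub> x = c \<odot>\<^bsub>A\<^esub> x" "x \<otimes>\<^bsub>A\<^esub> (c \<odot>\<^bsub>A\<^esub> \<one>\<^bsub>A\<^esub>) = c \<odot>\<^bsub>A\<^esub> x"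
  using assms by (simp_all add: smult_mult_left smult_mult_right)

context
  fixes K :: "('k, 'c) ring_scheme" and A :: "('k, 'a, 'd) module_scheme"
    and M :: "('a, 'm, 'e) module_scheme"
  assumes A: "k_algebra K A" and M: "left_module A M"
begin

interpretation A: k_algebra K A by (rule A)
interpretation M: left_module A M by (rule M)

text \<open>K acts through \<open>c \<mapsto> c \<odot> \<one>\<close>, a ring homomorphism into A;
  its multiplicativity gives associativity of the action.\<close>

lemma kmod_left_module: "left_module K (kmod A M)"
proof (rule left_moduleI[OF A.K.ring_axioms])
  show "abelian_group (kmod A M)"
    unfolding kmod_def by (rule with_action_abelian_group[OF M.M.abelian_group_axioms])
next
  fix a b x assume x: "a \<in> carrier K" "b \<in> carrier K" "x \<in> carrier (kmod A M)"
  have "(a \<otimes>\<^bsub>K\<^esub> b) \<odot>\<^bsub>A\<^esub> \<one>\<^bsub>A\<^esub> = (a \<odot>\<^bsub>A\<^esub> \<one>\<^bsub>A\<^esub>) \<otimes>\<^bsub>A\<^esub> (b \<odot>\<^bsub>A\<^esub> \<one>\<^bsub>A\<^esub>)"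
    using x by (simp add: A.smult_one_mult(1) A.smult_assoc1)
  then show "(a \<otimes>\<^bsub>K\<^esub> b) \<odot>\<^bsub>kmod A M\<^esub> x = a \<odot>\<^bsub>kmod A M\<^esub> (b \<odot>\<^bsub>kmod A M\<^esub> x)"
    using x by (simp add: kmod_simps M.lsmult_assoc)
qed (simp_all add: kmod_simps M.lsmult_closed M.lsmult_l_distr M.lsmult_r_distr M.lsmult_one
    A.smult_l_distr)

text \<open>K-linearity in the module variable needs that the multiples of the unit of A are
  central: \<open>c \<odot> \<one>\<close> commutes with every \<open>v\<close>, both products being
  \<open>c \<odot> v\<close>.\<close>

lemma action_bilinear: "bilinear_map K A (kmod A M) (kmod A M) (\<lambda>a m. a \<odot>\<^bsub>M\<^esub> m)"
proof (rule bilinear_mapI)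
  fix c v w assume x: "c \<in> carrier K" "v \<in> carrier A" "w \<in> carrier (kmod A M)"
  have "c \<odot>\<^bsub>A\<^esub> v = (c \<odot>\<^bsub>A\<^esub> \<one>\<^bsub>A\<^esub>) \<otimes>\<^bsub>A\<^esub> v" "c \<odot>\<^bsub>A\<^esub> v = v \<otimes>\<^bsub>A\<^esub> (c \<odot>\<^bsub>A\<^esub> \<one>\<^bsub>A\<^esub>)"
    using x by (simp_all add: A.smult_one_mult)
  then show "(c \<odot>\<^bsub>A\<^esub> v) \<odot>\<^bsub>M\<^esub> w = c \<odot>\<^bsub>kmod A M\<^esub> (v \<odot>\<^bsub>M\<^esub> w)"
    "v \<odot>\<^bsub>M\<^esub> (c \<odot>\<^bsub>kmod A M\<^esub> w) = c \<odot>\<^bsub>kmod A M\<^esub> (v \<odot>\<^bsub>M\<^esub> w)"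
    using x by (simp_all add: kmod_simps flip: M.lsmult_assoc)
qed (simp_all add: kmod_simps M.lsmult_closed M.lsmult_l_distr M.lsmult_r_distr)

lemmas action_mod_hom = bilinear_mapD(1)[OF action_bilinear]

lemma mod_hom_kmod: "f \<in> mod_hom A M N \<Longrightarrow> f \<in> mod_hom K (kmod A M) (kmod A N)"
  by (auto simp: mod_hom_def kmod_simps)

end

text \<open>Turns a B-module into a module over \<open>A \<triangleleft> H\<close>, so that the
  universal property of \<open>sw_mod\<close> can be applied with a B-module as target.\<close>

definition restrict_scalars where
  "restrict_scalars \<phi> N = with_action N (\<lambda>s n. \<phi> s \<odot>\<^bsub>N\<^esub> n)"

lemma restrict_scalars_simps:
  "carrier (restrict_scalars \<phi> N) = carrier N" "zero (restrict_scalars \<phi> N) = zero N"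
  "add (restrict_scalars \<phi> N) = add N" "smult (restrict_scalars \<phi> N) = (\<lambda>s n. \<phi> s \<odot>\<^bsub>N\<^esub> n)"
  by (simp_all add: restrict_scalars_def)

lemma restrict_scalars_left_module:
  assumes "ring S" "\<phi> \<in> ring_hom S B" "left_module B N"
  shows "left_module S (restrict_scalars \<phi> N)"
proof -
  interpret N: left_module B N by fact
  interpret S: ring S by fact
  show ?thesis
    using with_action_abelian_group[OF N.M.abelian_group_axioms] assms(2)
    by (intro left_moduleI[OF S.ring_axioms])
      (simp_all add: restrict_scalars_def ring_hom_closed ring_hom_add ring_hom_mult ring_hom_one
        N.lsmult_closed N.lsmult_l_distr N.lsmult_r_distr N.lsmult_assoc N.lsmult_one)
qed

text \<open>\<open>\<phi>\<close> sends \<open>c \<odot> \<one>\<close> of S to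
  \<open>c \<odot> \<one>\<close> of B, so N carries the same K-structure whether it is seen over S
  or over B.\<close>

lemma mod_hom_kmod_restrict_scalars:
  assumes "k_algebra K S" "\<phi> \<in> alg_hom K S B"
  shows "mod_hom K V (kmod S (restrict_scalars \<phi> N)) = mod_hom K V (kmod B N)"
proof -
  interpret S: k_algebra K S by fact
  have "\<phi> (c \<odot>\<^bsub>S\<^esub> \<one>\<^bsub>S\<^esub>) = c \<odot>\<^bsub>B\<^esub> \<one>\<^bsub>B\<^esub>" if "c \<in> carrier K" for c
    using that assms(2) ring_hom_one[of \<phi> S B] by (auto simp: alg_hom_def mod_hom_def)
  then show ?thesis
    by (auto simp: mod_hom_def kmod_simps restrict_scalars_simps)
qed

section \<open>The free S-module \<open>S \<otimes> W\<close> on a vector space W\<close>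

context
  fixes K :: "('k, 'c) ring_scheme" and S :: "('k, 's, 'd) module_scheme"
    and W :: "('k, 'w, 'e) module_scheme"
  assumes S: "k_algebra K S" and W: "left_module K W"
begin

interpretation S: k_algebra K S by (rule S)
interpretation W: left_module K W by (rule W)

private abbreviation (input) "E \<equiv> extend_scalars K S W"
private abbreviation (input) "T \<equiv> tensor K S W"

private lemma scalar_field: "field K" by (rule S.K.field_axioms)
private lemma SK: "left_module K S" by (rule S.left_module_K)
private lemma SW_module: "left_module K T" by (rule tensor_left_module[OF scalar_field SK W])

interpretation T: left_module K T by (rule SW_module)

lemma mult_left_mod_hom: "s \<in> carrier S \<Longrightarrow> (\<lambda>t. s \<otimes>\<^bsub>S\<^esub> t) \<in> mod_hom K S S"
  by (intro mod_homI) (simp_all add: S.r_distr S.smult_mult_right)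

lemma extend_scalars_simps:
  "carrier E = carrier T" "zero E = zero T" "add E = add T"
  by (simp_all add: extend_scalars_def)

lemma extend_scalars_smult_mod_hom: "s \<in> carrier S \<Longrightarrow> (\<lambda>t. s \<odot>\<^bsub>E\<^esub> t) \<in> mod_hom K T T"
  using tensor_map_mod_hom[OF scalar_field SK W SK W mult_left_mod_hom mod_hom_ident]
  by (simp add: extend_scalars_def)

lemma extend_scalars_smult_tens:
  "s \<in> carrier S \<Longrightarrow> t \<in> carrier S \<Longrightarrow> w \<in> carrier W \<Longrightarrow>
   s \<odot>\<^bsub>E\<^esub> tens K S W t w = tens K S W (s \<otimes>\<^bsub>S\<^esub> t) w"
  using tensor_map_tens[OF scalar_field SK W SK W mult_left_mod_hom mod_hom_ident]
  by (simp add: extend_scalars_def)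

private lemmas tb = bilinear_mapD[OF tens_bilinear[OF scalar_field SK W]]

text \<open>There are two K-structures on \<open>S \<otimes> W\<close>, one from the tensor product
  and one through the unit of S. They agree on pure tensors, so linear maps for one are linear for
  the other.\<close>

lemma extend_scalars_scalar:
  assumes "c \<in> carrier K" "t \<in> carrier T"
  shows "(c \<odot>\<^bsub>S\<^esub> \<one>\<^bsub>S\<^esub>) \<odot>\<^bsub>E\<^esub> t = c \<odot>\<^bsub>T\<^esub> t"
  by (rule tensor_ext[OF scalar_field SK W SW_module extend_scalars_smult_mod_hom
        mod_hom_smult[OF S.K.is_cring SW_module mod_hom_ident assms(1)] _ assms(2)])
    (use assms in \<open>simp_all add: extend_scalars_smult_tens tb S.smult_one_mult\<close>)

text \<open>Each axiom that concerns a product or sum of scalars, or the unit, equates two K-linear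
  maps in the tensor variable; on pure tensors it becomes a ring law of S.\<close>

lemma extend_scalars_left_module: "left_module S E"
proof (rule left_moduleI[OF S.A.ring_axioms])
  show "abelian_group E"
    unfolding extend_scalars_def by (rule with_action_abelian_group[OF T.M.abelian_group_axioms])
next
  fix a x assume "a \<in> carrier S" "x \<in> carrier E"
  then show "a \<odot>\<^bsub>E\<^esub> x \<in> carrier E"
    using mod_homD(1)[OF extend_scalars_smult_mod_hom] by (simp add: extend_scalars_simps)
next
  fix a b x assume a: "a \<in> carrier S" "b \<in> carrier S" and x: "x \<in> carrier E"
  show "(a \<oplus>\<^bsub>S\<^esub> b) \<odot>\<^bsub>E\<^esub> x = a \<odot>\<^bsub>E\<^esub> x \<oplus>\<^bsub>E\<^esub> b \<odot>\<^bsub>E\<^esub> x"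
    unfolding extend_scalars_simps
    by (rule tensor_ext[OF scalar_field SK W SW_module extend_scalars_smult_mod_hom mod_hom_add[OF SW_module SW_module
            extend_scalars_smult_mod_hom extend_scalars_smult_mod_hom]])
      (use a x in \<open>simp_all add: extend_scalars_simps extend_scalars_smult_tens tb S.l_distr\<close>)
  show "(a \<otimes>\<^bsub>S\<^esub> b) \<odot>\<^bsub>E\<^esub> x = a \<odot>\<^bsub>E\<^esub> (b \<odot>\<^bsub>E\<^esub> x)"
    by (rule tensor_ext[OF scalar_field SK W SW_module extend_scalars_smult_mod_hom mod_hom_comp[OF
            extend_scalars_smult_mod_hom extend_scalars_smult_mod_hom]])
      (use a x in \<open>simp_all add: extend_scalars_simps extend_scalars_smult_tens S.m_assoc\<close>)
next
  fix a x y assume "a \<in> carrier S" "x \<in> carrier E" "y \<in> carrier E"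
  then show "a \<odot>\<^bsub>E\<^esub> (x \<oplus>\<^bsub>E\<^esub> y) = a \<odot>\<^bsub>E\<^esub> x \<oplus>\<^bsub>E\<^esub> a \<odot>\<^bsub>E\<^esub> y"
    using mod_homD(2)[OF extend_scalars_smult_mod_hom] by (simp add: extend_scalars_simps)
next
  fix x assume x: "x \<in> carrier E"
  show "\<one>\<^bsub>S\<^esub> \<odot>\<^bsub>E\<^esub> x = x"
    by (rule tensor_ext[OF scalar_field SK W SW_module extend_scalars_smult_mod_hom mod_hom_ident])
      (use x in \<open>simp_all add: extend_scalars_simps extend_scalars_smult_tens\<close>)
qed

lemma extend_scalars_inc_mod_hom: "(\<lambda>w. tens K S W \<one>\<^bsub>S\<^esub> w) \<in> mod_hom K W T"
  by (rule bilinear_mapD(1)[OF tens_bilinear[OF scalar_field SK W]]) simp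

lemma mod_hom_kmod_extend_scalars': "mod_hom K (kmod S E) V = mod_hom K T V"
  by (auto simp: mod_hom_def kmod_simps extend_scalars_simps extend_scalars_scalar Pi_iff)

context
  fixes Y :: "('s, 'y, 'f) module_scheme"
  assumes Y: "left_module S Y"
begin

interpretation Y: left_module S Y by (rule Y)

private lemma YK: "left_module K (kmod S Y)" by (rule kmod_left_module[OF S Y])

text \<open>A pure tensor \<open>s \<otimes> w\<close> equals s times \<open>1 \<otimes> w\<close>,
  so the elements \<open>1 \<otimes> w\<close> generate \<open>S \<otimes> W\<close> over S.\<close>

lemma extend_scalars_ext:
  assumes f: "f \<in> mod_hom S E Y" and g: "g \<in> mod_hom S E Y"
    and fg: "\<And>w. w \<in> carrier W \<Longrightarrow> f (tens K S W \<one>\<^bsub>S\<^esub> w) = g (tens K S W \<one>\<^bsub>S\<^esub> w)"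
    and t: "t \<in> carrier T"
  shows "f t = g t"
proof (rule tensor_ext[OF scalar_field SK W YK _ _ _ t])
  show "f \<in> mod_hom K T (kmod S Y)" "g \<in> mod_hom K T (kmod S Y)"
    using mod_hom_kmod[OF S extend_scalars_left_module f]
      mod_hom_kmod[OF S extend_scalars_left_module g]
    by (simp_all add: mod_hom_kmod_extend_scalars')
next
  fix s w assume s: "s \<in> carrier S" and w: "w \<in> carrier W"
  have e: "tens K S W s w = s \<odot>\<^bsub>E\<^esub> tens K S W \<one>\<^bsub>S\<^esub> w"
    using s w by (simp add: extend_scalars_smult_tens)
  have c: "tens K S W \<one>\<^bsub>S\<^esub> w \<in> carrier E" using w by (simp add: extend_scalars_simps tb)
  show "f (tens K S W s w) = g (tens K S W s w)"
    unfolding e mod_homD(3)[OF f s c] mod_homD(3)[OF g s c] by (simp add: fg w)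
qed

context
  fixes g assumes g: "g \<in> mod_hom K W (kmod S Y)"
begin

lemma extend_scalars_lift_bilinear: "bilinear_map K S W (kmod S Y) (\<lambda>s w. s \<odot>\<^bsub>Y\<^esub> g w)"
  by (rule bilinear_map_precomp[OF action_bilinear[OF S Y] mod_hom_ident g])

text \<open>The extension sends \<open>s \<otimes> w\<close> to s times \<open>g w\<close>.
  K-linearity comes from the tensor product; S-linearity holds on pure tensors by associativity of
  the action on Y.\<close>

lemma extend_scalars_lift_mod_hom:
  "tensor_lift K (kmod S Y) (\<lambda>s w. s \<odot>\<^bsub>Y\<^esub> g w) \<in> mod_hom S E Y"
proof -
  note l = tensor_lift_mod_hom[OF scalar_field SK W YK extend_scalars_lift_bilinear]
  note lt = tensor_lift_tens[OF scalar_field SK W YK extend_scalars_lift_bilinear]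
  have gc: "g w \<in> carrier Y" if "w \<in> carrier W" for w
    using mod_homD(1)[OF g that] by (simp add: kmod_simps)
  show ?thesis
  proof (rule mod_homI)
    fix s t assume s: "s \<in> carrier S" and t: "t \<in> carrier E"
    show "tensor_lift K (kmod S Y) (\<lambda>s w. s \<odot>\<^bsub>Y\<^esub> g w) (s \<odot>\<^bsub>E\<^esub> t) =
        s \<odot>\<^bsub>Y\<^esub> tensor_lift K (kmod S Y) (\<lambda>s w. s \<odot>\<^bsub>Y\<^esub> g w) t"
      by (rule tensor_ext[OF scalar_field SK W YK mod_hom_comp[OF extend_scalars_smult_mod_hom l]
            mod_hom_comp[OF l action_mod_hom[OF S Y]]])
        (use s t in \<open>simp_all add: extend_scalars_simps extend_scalars_smult_tens lt Y.lsmult_assoc gc\<close>)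
  qed (use mod_homD[OF l] in \<open>simp_all add: extend_scalars_simps kmod_simps\<close>)
qed

lemma extend_scalars_lift_inc:
  "w \<in> carrier W \<Longrightarrow> tensor_lift K (kmod S Y) (\<lambda>s w. s \<odot>\<^bsub>Y\<^esub> g w) (tens K S W \<one>\<^bsub>S\<^esub> w) = g w"
  using tensor_lift_tens[OF scalar_field SK W YK extend_scalars_lift_bilinear] mod_homD(1)[OF g]
  by (simp add: kmod_simps Y.lsmult_one)

end

end

end

section \<open>Quotients of algebras and free algebras\<close>

lemma k_algebraI:
  assumes "field K" "left_module K A" "bilinear_map K A A A (mult A)" "\<one>\<^bsub>A\<^esub> \<in> carrier A"
    and "\<And>x y z. x \<in> carrier A \<Longrightarrow> y \<in> carrier A \<Longrightarrow> z \<in> carrier A \<Longrightarrow>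
      (x \<otimes>\<^bsub>A\<^esub> y) \<otimes>\<^bsub>A\<^esub> z = x \<otimes>\<^bsub>A\<^esub> (y \<otimes>\<^bsub>A\<^esub> z)"
    and "\<And>x. x \<in> carrier A \<Longrightarrow> \<one>\<^bsub>A\<^esub> \<otimes>\<^bsub>A\<^esub> x = x" "\<And>x. x \<in> carrier A \<Longrightarrow> x \<otimes>\<^bsub>A\<^esub> \<one>\<^bsub>A\<^esub> = x"
  shows "k_algebra K A"
proof -
  interpret K: field K by fact
  interpret A: left_module K A by fact
  note b = bilinear_mapD[OF assms(3)]
  have "monoid A" using assms b by (intro monoidI)
  then have "ring A" using b by (intro ringI A.M.abelian_group_axioms)
  moreover have "module K A" using assms(2) K.is_cring by (simp add: module_iff_left_module)
  ultimately show ?thesis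
    using assms(1) b by (simp add: k_algebra_def k_algebra_axioms_def)
qed

lemma (in k_algebra) mult_bilinear: "bilinear_map K A A A (mult A)"
  by (rule bilinear_mapI) (simp_all add: l_distr r_distr smult_mult_left smult_mult_right)

lemma alg_homI:
  assumes "f \<in> mod_hom K A B" "f \<one>\<^bsub>A\<^esub> = \<one>\<^bsub>B\<^esub>"
    and "\<And>x y. x \<in> carrier A \<Longrightarrow> y \<in> carrier A \<Longrightarrow> f (x \<otimes>\<^bsub>A\<^esub> y) = f x \<otimes>\<^bsub>B\<^esub> f y"
  shows "f \<in> alg_hom K A B"
  using assms by (auto simp: alg_hom_def mod_hom_def ring_hom_def)

lemma alg_homD:
  assumes "f \<in> alg_hom K A B"
  shows "f \<in> mod_hom K A B" "f \<in> ring_hom A B" "f \<one>\<^bsub>A\<^esub> = \<one>\<^bsub>B\<^esub>"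
    "\<And>x y. x \<in> carrier A \<Longrightarrow> y \<in> carrier A \<Longrightarrow> f (x \<otimes>\<^bsub>A\<^esub> y) = f x \<otimes>\<^bsub>B\<^esub> f y"
  using assms by (auto simp: alg_hom_def ring_hom_def)

lemma alg_hom_comp: "f \<in> alg_hom K A B \<Longrightarrow> g \<in> alg_hom K B C \<Longrightarrow> (\<lambda>x. g (f x)) \<in> alg_hom K A C"
  by (intro alg_homI mod_hom_comp[of f K A B g C]) (simp_all add: alg_homD mod_homD(1)[OF alg_homD(1)])

text \<open>A scalar multiple \<open>c \<odot> x\<close> is the product of
  \<open>c \<odot> \<one>\<close> with x, so closure under products already gives closure under
  scalars.\<close>

lemma (in k_algebra) ideal_submodule:
  assumes "ideal I A"
  shows "submodule I K A"
proof -
  interpret I: ideal I A by fact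
  interpret M: left_module K A by (rule left_module_K)
  show ?thesis
  proof (rule M.submoduleI_left)
    fix c x assume c: "c \<in> carrier K" and x: "x \<in> I"
    then have "(c \<odot>\<^bsub>A\<^esub> \<one>\<^bsub>A\<^esub>) \<otimes>\<^bsub>A\<^esub> x \<in> I" by (intro I.I_l_closed) auto
    then show "c \<odot>\<^bsub>A\<^esub> x \<in> I" using c x by (simp add: smult_one_mult)
  qed (auto intro: I.a_closed)
qed

section \<open>Quotients of algebras by generated two-sided ideals\<close>

context
  fixes K :: "('k, 'c) ring_scheme" and F :: "('k, 'f, 'd) module_scheme" and S :: "'f set" and I
  assumes F: "k_algebra K F" and S: "S \<subseteq> carrier F"
  defines "I \<equiv> Idl\<^bsub>F\<^esub> S"
begin

interpretation F: k_algebra K F by (rule F)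
interpretation I: ideal I F unfolding I_def by (rule F.genideal_ideal[OF S])

private lemma genideal_modules: "left_module K F" "submodule I K F"
  by (rule F.left_module_K) (rule F.ideal_submodule[OF I.is_ideal])

lemma quot_genideal_mult:
  "x \<in> carrier F \<Longrightarrow> y \<in> carrier F \<Longrightarrow>
   (I +>\<^bsub>F\<^esub> x) \<otimes>\<^bsub>quot F I\<^esub> (I +>\<^bsub>F\<^esub> y) = I +>\<^bsub>F\<^esub> (x \<otimes>\<^bsub>F\<^esub> y)"
  by (simp add: quot_simps I.rcoset_mult_add)

lemma quot_genideal_eqI: "x \<in> carrier F \<Longrightarrow> y \<in> carrier F \<Longrightarrow> x \<ominus>\<^bsub>F\<^esub> y \<in> S \<Longrightarrow> I +>\<^bsub>F\<^esub> x = I +>\<^bsub>F\<^esub> y"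
  using F.genideal_self[OF S] by (intro quot_eqI[OF genideal_modules]) (auto simp: I_def)

lemma quot_genideal_k_algebra: "k_algebra K (quot F I)"
  by (intro k_algebraI F.K.field_axioms quot_left_module[OF genideal_modules] bilinear_mapI)
    (auto elim!: quot_carrierE simp: quot_genideal_mult quot_simps(3) quot_in_carrier[OF genideal_modules]
      quot_add[OF genideal_modules] quot_smult[OF genideal_modules]
      F.l_distr F.r_distr F.m_assoc F.smult_mult_left F.smult_mult_right)

lemma quot_genideal_proj: "(\<lambda>x. I +>\<^bsub>F\<^esub> x) \<in> alg_hom K F (quot F I)"
  by (rule alg_homI[OF quot_proj_mod_hom[OF genideal_modules]]) (simp_all add: quot_genideal_mult quot_simps(3))

context
  fixes B :: "('k, 'b, 'e) module_scheme"
  assumes B: "k_algebra K B"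
begin

interpretation B: k_algebra K B by (rule B)

text \<open>The kernel of an algebra map is a two-sided ideal; containing S, it contains the ideal
  generated by S, and the map descends to the quotient.\<close>

lemma quot_genideal_lift:
  assumes f: "f \<in> alg_hom K F B" and f0: "\<And>x. x \<in> S \<Longrightarrow> f x = \<zero>\<^bsub>B\<^esub>"
  shows "(\<lambda>C. the_elem (f ` C)) \<in> alg_hom K (quot F I) B"
    and "x \<in> carrier F \<Longrightarrow> the_elem (f ` (I +>\<^bsub>F\<^esub> x)) = f x"
proof -
  note fm = alg_homD(1)[OF f] alg_homD(3-)[OF f]
  have z: "f \<zero>\<^bsub>F\<^esub> = \<zero>\<^bsub>B\<^esub>" by (rule mod_hom_zero[OF genideal_modules(1) B.left_module_K fm(1)])
  have m: "f (\<ominus>\<^bsub>F\<^esub> x) = \<ominus>\<^bsub>B\<^esub> f x" if "x \<in> carrier F" for x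
    by (rule mod_hom_uminus[OF genideal_modules(1) B.left_module_K fm(1) that])
  have "ideal {x \<in> carrier F. f x = \<zero>\<^bsub>B\<^esub>} F"
    by (rule idealI[OF F.A.ring_axioms])
      (auto simp: subgroup_def z fm mod_homD[OF fm(1)] m simp flip: a_inv_def)
  then have "I \<subseteq> {x \<in> carrier F. f x = \<zero>\<^bsub>B\<^esub>}"
    unfolding I_def using S f0 by (intro F.genideal_minimal) auto
  then have I0: "f x = \<zero>\<^bsub>B\<^esub>" if "x \<in> I" for x using that by auto
  have l: "the_elem (f ` (I +>\<^bsub>F\<^esub> x)) = f x" if "x \<in> carrier F" for x
    using that by (intro quot_lift_coset[OF genideal_modules B.left_module_K fm(1)] I0)
  show "the_elem (f ` (I +>\<^bsub>F\<^esub> x)) = f x" if "x \<in> carrier F" for x using that by (rule l)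
  show "(\<lambda>C. the_elem (f ` C)) \<in> alg_hom K (quot F I) B"
    by (rule alg_homI[OF quot_lift_mod_hom[OF genideal_modules B.left_module_K fm(1) I0]])
      (auto elim!: quot_carrierE simp: quot_genideal_mult l fm quot_simps(3))
qed

end

end

section \<open>The free algebra on a set and its universal property\<close>

lemma free_alg_simps:
  "carrier (free_alg K S) = carrier (free_mod K (lists S))"
  "zero (free_alg K S) = zero (free_mod K (lists S))"
  "add (free_alg K S) = add (free_mod K (lists S))"
  "smult (free_alg K S) = smult (free_mod K (lists S))"
  "one (free_alg K S) = single K []"
  "mult (free_alg K S) =
     (\<lambda>f g w. \<Oplus>\<^bsub>K\<^esub>i\<in>{..length w}. f (take i w) \<otimes>\<^bsub>K\<^esub> g (drop i w))"
  by (simp_all add: free_alg_def free_mod_def)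

context
  fixes K :: "('k, 'c) ring_scheme" and S :: "'s set"
  assumes K: "field K"
begin

interpretation K: field K by (rule K)

private abbreviation (input) "FA \<equiv> free_alg K S"

lemma free_alg_left_module: "left_module K FA"
  by (rule left_module_cong[OF free_mod_left_module[OF K]]) (simp_all add: free_alg_simps)

interpretation FA: left_module K FA by (rule free_alg_left_module)

lemma mod_hom_free_alg: "mod_hom K FA U = mod_hom K (free_mod K (lists S)) U"
  "mod_hom K U FA = mod_hom K U (free_mod K (lists S))"
  by (simp_all add: mod_hom_def free_alg_simps)

lemma free_alg_hom_ext:
  assumes "left_module K U" "f \<in> mod_hom K FA U" "g \<in> mod_hom K FA U"
    and "\<And>w. w \<in> lists S \<Longrightarrow> f (single K w) = g (single K w)" "x \<in> carrier FA"
  shows "f x = g x"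
  by (rule free_mod_hom_ext[OF K assms(1), of f "lists S"])
    (use assms(2-) in \<open>simp_all add: mod_hom_free_alg free_alg_simps\<close>)

lemma free_alg_in_K: "f \<in> carrier FA \<Longrightarrow> f w \<in> carrier K"
  by (simp add: free_alg_simps free_mod_carrier[OF K])

lemma free_alg_mult_bilinear: "bilinear_map K FA FA FA (mult FA)"
proof (rule bilinear_mapI)
  fix f g assume f: "f \<in> carrier FA" and g: "g \<in> carrier FA"
  let ?s = "\<lambda>f :: 's list \<Rightarrow> 'k. {w. f w \<noteq> \<zero>\<^bsub>K\<^esub>}"
  show "f \<otimes>\<^bsub>FA\<^esub> g \<in> carrier FA"
    unfolding free_alg_simps
  \<comment> \<open>A word at which the convolution is nonzero splits into a word from the support
    of \<open>f\<close> followed by one from the support of \<open>g\<close>; there are finitely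
    many such concatenations.\<close>
  proof (rule free_modI[OF K, of _ "(\<lambda>(u, v). u @ v) ` (?s f \<times> ?s g)"])
    show "finite ((\<lambda>(u, v). u @ v) ` (?s f \<times> ?s g))" "(\<lambda>(u, v). u @ v) ` (?s f \<times> ?s g) \<subseteq> lists S"
      using f g by (auto simp: free_alg_simps free_mod_carrier[OF K] subset_iff in_lists_conv_set)
    fix w assume w: "w \<notin> (\<lambda>(u, v). u @ v) ` (?s f \<times> ?s g)"
    have "f (take i w) \<otimes>\<^bsub>K\<^esub> g (drop i w) = \<zero>\<^bsub>K\<^esub>" for i
    proof -
      have "w = (\<lambda>(u, v). u @ v) (take i w, drop i w)" by simp
      then have "f (take i w) = \<zero>\<^bsub>K\<^esub> \<or> g (drop i w) = \<zero>\<^bsub>K\<^esub>" using w by blast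
      then show ?thesis using free_alg_in_K[OF f] free_alg_in_K[OF g] by auto
    qed
    then show "(\<Oplus>\<^bsub>K\<^esub>i\<in>{..length w}. f (take i w) \<otimes>\<^bsub>K\<^esub> g (drop i w)) = \<zero>\<^bsub>K\<^esub>" by simp
  qed (auto simp: free_alg_in_K f g intro!: K.finsum_closed)
  fix f' assume f': "f' \<in> carrier FA"
  note c = free_alg_in_K[OF f] free_alg_in_K[OF g] free_alg_in_K[OF f']
  show "(f \<oplus>\<^bsub>FA\<^esub> f') \<otimes>\<^bsub>FA\<^esub> g = f \<otimes>\<^bsub>FA\<^esub> g \<oplus>\<^bsub>FA\<^esub> f' \<otimes>\<^bsub>FA\<^esub> g"
    "g \<otimes>\<^bsub>FA\<^esub> (f \<oplus>\<^bsub>FA\<^esub> f') = g \<otimes>\<^bsub>FA\<^esub> f \<oplus>\<^bsub>FA\<^esub> g \<otimes>\<^bsub>FA\<^esub> f'"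
    by (auto simp: free_alg_simps free_mod_simps[OF K] c K.l_distr K.r_distr Pi_iff fun_eq_iff
        simp flip: K.finsum_addf)
next
  fix f g c assume f: "f \<in> carrier FA" and g: "g \<in> carrier FA" and c: "c \<in> carrier K"
  note c = free_alg_in_K[OF f] free_alg_in_K[OF g] c
  show "(c \<odot>\<^bsub>FA\<^esub> f) \<otimes>\<^bsub>FA\<^esub> g = c \<odot>\<^bsub>FA\<^esub> (f \<otimes>\<^bsub>FA\<^esub> g)"
    "f \<otimes>\<^bsub>FA\<^esub> (c \<odot>\<^bsub>FA\<^esub> g) = c \<odot>\<^bsub>FA\<^esub> (f \<otimes>\<^bsub>FA\<^esub> g)"
    by (auto simp: free_alg_simps free_mod_simps[OF K] c K.m_assoc K.m_lcomm Pi_iff fun_eq_iff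
        K.finsum_rdistr intro!: K.finsum_cong')
qed

lemma single_in_free_alg: "w \<in> lists S \<Longrightarrow> single K w \<in> carrier FA"
  by (simp add: free_alg_simps single_in_free_mod[OF K])

lemma free_alg_mult_single: "single K u \<otimes>\<^bsub>FA\<^esub> single K v = single K (u @ v)"
proof
  fix w
  show "(single K u \<otimes>\<^bsub>FA\<^esub> single K v) w = single K (u @ v) w"
  proof (cases "w = u @ v")
    case True
    \<comment> \<open>Among the cuts of \<open>u @ v\<close>, only the one at
      \<open>length u\<close> gives a nonzero term.\<close>
    have "(single K u \<otimes>\<^bsub>FA\<^esub> single K v) w =
      (\<Oplus>\<^bsub>K\<^esub>i\<in>{..length w}. if length u = i then \<one>\<^bsub>K\<^esub> else \<zero>\<^bsub>K\<^esub>)"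
      unfolding free_alg_simps
      by (rule K.finsum_cong') (auto simp: True single_def min_def append_eq_conv_conj)
    also have "\<dots> = \<one>\<^bsub>K\<^esub>"
      using K.finsum_singleton[of "length u" "{..length w}" "\<lambda>_. \<one>\<^bsub>K\<^esub>"] by (simp add: True)
    finally show ?thesis by (simp add: True single_def)
  next
    case False
    then have "single K u (take i w) \<otimes>\<^bsub>K\<^esub> single K v (drop i w) = \<zero>\<^bsub>K\<^esub>" for i
      using append_take_drop_id[of i w] by (auto simp: single_def)
    with False show ?thesis by (simp add: free_alg_simps) (simp add: single_def)
  qed
qed

lemma free_alg_k_algebra: "k_algebra K FA"
proof -
  note b = bilinear_mapD[OF free_alg_mult_bilinear]
  have l: "(\<lambda>x. f x \<otimes>\<^bsub>FA\<^esub> z) \<in> mod_hom K FA FA"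
    if "f \<in> mod_hom K FA FA" "z \<in> carrier FA" for f z
    by (rule mod_hom_comp[OF that(1) b(2)[OF that(2)]])
  have r: "(\<lambda>x. z \<otimes>\<^bsub>FA\<^esub> f x) \<in> mod_hom K FA FA"
    if "f \<in> mod_hom K FA FA" "z \<in> carrier FA" for f z
    by (rule mod_hom_comp[OF that(1) b(1)[OF that(2)]])
  note ext = free_alg_hom_ext[OF free_alg_left_module]
  note s = single_in_free_alg
  note i = mod_hom_ident[of K FA]
  have 1: "\<one>\<^bsub>FA\<^esub> \<in> carrier FA" by (simp add: free_alg_simps(5) s)
  show ?thesis
  proof (rule k_algebraI[OF K free_alg_left_module free_alg_mult_bilinear 1])
    fix x assume x: "x \<in> carrier FA"
    show "\<one>\<^bsub>FA\<^esub> \<otimes>\<^bsub>FA\<^esub> x = x"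
      by (rule ext[OF r[OF i 1] i _ x]) (simp add: free_alg_simps(5) free_alg_mult_single)
    show "x \<otimes>\<^bsub>FA\<^esub> \<one>\<^bsub>FA\<^esub> = x"
      by (rule ext[OF l[OF i 1] i _ x]) (simp add: free_alg_simps(5) free_alg_mult_single)
    fix y z assume y: "y \<in> carrier FA" and z: "z \<in> carrier FA"
    \<comment> \<open>Associativity is made linear in one variable at a time: \<open>3\<close>
      reduces z to words with the other factors already words, \<open>2\<close> reduces y, and the
      last step reduces x. On words it is associativity of concatenation.\<close>
    have 3: "(single K u \<otimes>\<^bsub>FA\<^esub> single K v) \<otimes>\<^bsub>FA\<^esub> z = single K u \<otimes>\<^bsub>FA\<^esub> (single K v \<otimes>\<^bsub>FA\<^esub> z)"
      if "u \<in> lists S" "v \<in> lists S" for u v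
      by (rule ext[OF r[OF i] r[OF r[OF i]] _ z]) (use that s b(3) in \<open>simp_all add: free_alg_mult_single\<close>)
    have 2: "(single K u \<otimes>\<^bsub>FA\<^esub> y) \<otimes>\<^bsub>FA\<^esub> z = single K u \<otimes>\<^bsub>FA\<^esub> (y \<otimes>\<^bsub>FA\<^esub> z)"
      if "u \<in> lists S" for u
      by (rule ext[OF l[OF r[OF i]] r[OF l[OF i]] _ y]) (use that s z 3 in simp_all)
    show "(x \<otimes>\<^bsub>FA\<^esub> y) \<otimes>\<^bsub>FA\<^esub> z = x \<otimes>\<^bsub>FA\<^esub> (y \<otimes>\<^bsub>FA\<^esub> z)"
      by (rule ext[OF l[OF l[OF i]] l[OF i] _ x]) (use s y z 2 b(3) in simp_all)
  qed
qed

context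
  fixes B :: "('k, 'b, 'e) module_scheme"
  assumes B: "k_algebra K B"
begin

interpretation B: k_algebra K B by (rule B)

definition free_alg_lift where
  "free_alg_lift f = free_lift K B (\<lambda>w. foldr (\<lambda>s b. f s \<otimes>\<^bsub>B\<^esub> b) w \<one>\<^bsub>B\<^esub>)"

context
  fixes f assumes f: "\<And>s. s \<in> S \<Longrightarrow> f s \<in> carrier B"
begin

private definition "word_prod = (\<lambda>w. foldr (\<lambda>s b. f s \<otimes>\<^bsub>B\<^esub> b) w \<one>\<^bsub>B\<^esub>)"

private lemma word_prod_closed: "w \<in> lists S \<Longrightarrow> word_prod w \<in> carrier B"
  by (induction w) (auto simp: word_prod_def f)

private lemma word_prod_append: "u \<in> lists S \<Longrightarrow> v \<in> lists S \<Longrightarrow> word_prod (u @ v) = word_prod u \<otimes>\<^bsub>B\<^esub> word_prod v"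
proof (induction u)
  case Nil
  then show ?case using word_prod_closed by (simp add: word_prod_def)
next
  case (Cons s u)
  then show ?case using word_prod_closed[of u] word_prod_closed[of v] f by (simp add: word_prod_def B.m_assoc)
qed

lemma free_alg_lift_alg_hom: "free_alg_lift f \<in> alg_hom K FA B"
  and free_alg_lift_single: "s \<in> S \<Longrightarrow> free_alg_lift f (single K [s]) = f s"
proof -
  have lw: "free_alg_lift f = free_lift K B word_prod" by (simp add: free_alg_lift_def word_prod_def)
  have l: "free_lift K B word_prod \<in> mod_hom K FA B"
    unfolding mod_hom_free_alg by (rule free_lift_mod_hom[OF K B.left_module_K word_prod_closed])
  have ls: "w \<in> lists S \<Longrightarrow> free_lift K B word_prod (single K w) = word_prod w" for w
    by (rule free_lift_single[OF K B.left_module_K word_prod_closed])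
  note bf = bilinear_mapD[OF free_alg_mult_bilinear] and bb = bilinear_mapD[OF B.mult_bilinear]
  note ext = free_alg_hom_ext[OF B.left_module_K]
  note s = single_in_free_alg
  show "free_alg_lift f \<in> alg_hom K FA B"
    unfolding lw
  proof (rule alg_homI[OF l])
    show "free_lift K B word_prod \<one>\<^bsub>FA\<^esub> = \<one>\<^bsub>B\<^esub>"
      using ls[of "[]"] by (simp add: free_alg_simps word_prod_def)
    fix x y assume x: "x \<in> carrier FA" and y: "y \<in> carrier FA"
    \<comment> \<open>Multiplicativity is bilinear in x and y. Here y is reduced to words, where
      \<open>word_prod_append\<close> applies; afterwards x is reduced in the same way.\<close>
    have 1: "free_lift K B word_prod (single K u \<otimes>\<^bsub>FA\<^esub> y) =
        free_lift K B word_prod (single K u) \<otimes>\<^bsub>B\<^esub> free_lift K B word_prod y"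
      if "u \<in> lists S" for u
      by (rule ext[OF mod_hom_comp[OF bf(1) l] mod_hom_comp[OF l bb(1)] _ y])
        (use that s word_prod_closed in \<open>simp_all add: free_alg_mult_single ls word_prod_append\<close>)
    show "free_lift K B word_prod (x \<otimes>\<^bsub>FA\<^esub> y) = free_lift K B word_prod x \<otimes>\<^bsub>B\<^esub> free_lift K B word_prod y"
      by (rule ext[OF mod_hom_comp[OF bf(2) l] mod_hom_comp[OF l bb(2)] _ x])
        (use y 1 mod_homD(1)[OF l] in simp_all)
  qed
  show "free_alg_lift f (single K [s]) = f s" if "s \<in> S"
    using that ls[of "[s]"] f by (simp add: lw word_prod_def)
qed

end

text \<open>Agreement on letters passes to words by multiplicativity, and the words span the free
  algebra.\<close>

lemma free_alg_ext:
  assumes \<phi>: "\<phi> \<in> alg_hom K FA B" and \<psi>: "\<psi> \<in> alg_hom K FA B"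
    and eq: "\<And>s. s \<in> S \<Longrightarrow> \<phi> (single K [s]) = \<psi> (single K [s])" and x: "x \<in> carrier FA"
  shows "\<phi> x = \<psi> x"
proof (rule free_alg_hom_ext[OF B.left_module_K alg_homD(1)[OF \<phi>] alg_homD(1)[OF \<psi>] _ x])
  fix w assume "w \<in> lists S"
  then show "\<phi> (single K w) = \<psi> (single K w)"
  proof (induction w)
    case Nil
    then show ?case using alg_homD(3)[OF \<phi>] alg_homD(3)[OF \<psi>] by (simp add: free_alg_simps)
  next
    case (Cons s w)
    have "single K (s # w) = single K [s] \<otimes>\<^bsub>FA\<^esub> single K w" by (simp add: free_alg_mult_single)
    with Cons show ?case
      by (simp add: alg_homD(4)[OF \<phi>] alg_homD(4)[OF \<psi>] single_in_free_alg eq)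
  qed
qed

end

end

section \<open>Tensor algebras and Sweedler products of algebras and coalgebras\<close>

context
  fixes K :: "('k, 'c) ring_scheme" and V :: "('k, 'v, 'd) module_scheme"
  assumes K: "field K" and V: "left_module K V"
begin

interpretation K: field K by (rule K)
interpretation V: left_module K V by (rule V)

private abbreviation (input) "FV \<equiv> free_alg K (carrier V)"

interpretation FV: k_algebra K FV by (rule free_alg_k_algebra[OF K])
interpretation FVm: left_module K FV by (rule free_alg_left_module[OF K])

text \<open>The generators of \<open>tensor_alg_ideal\<close> receive a name so that the general
  facts on quotients by a generated ideal can be instantiated with them.\<close>

definition "tensor_alg_rels =
  {single K [v \<oplus>\<^bsub>V\<^esub> v'] \<ominus>\<^bsub>FV\<^esub> (single K [v] \<oplus>\<^bsub>FV\<^esub> single K [v']) | v v'.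
     v \<in> carrier V \<and> v' \<in> carrier V} \<union>
  {single K [c \<odot>\<^bsub>V\<^esub> v] \<ominus>\<^bsub>FV\<^esub> (c \<odot>\<^bsub>FV\<^esub> single K [v]) | c v. c \<in> carrier K \<and> v \<in> carrier V}"

private lemma tensor_alg_ideal_eq: "tensor_alg_ideal K V = Idl\<^bsub>FV\<^esub> tensor_alg_rels"
  by (simp add: tensor_alg_ideal_def tensor_alg_rels_def Let_def)

private lemma single_FV: "v \<in> carrier V \<Longrightarrow> single K [v] \<in> carrier FV"
  by (rule single_in_free_alg[OF K]) simp

private lemma tensor_alg_rels_carrier: "tensor_alg_rels \<subseteq> carrier FV"
  by (auto simp: tensor_alg_rels_def single_FV V.lsmult_closed
      intro!: FV.A.minus_closed FV.A.a_closed FVm.lsmult_closed)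

lemma tensor_alg_k_algebra: "k_algebra K (tensor_alg K V)"
  unfolding tensor_alg_def tensor_alg_ideal_eq
  by (rule quot_genideal_k_algebra[OF FV.k_algebra_axioms tensor_alg_rels_carrier])

lemma tensor_alg_inc_mod_hom: "tensor_alg_inc K V \<in> mod_hom K V (tensor_alg K V)"
proof -
  note a = FV.k_algebra_axioms tensor_alg_rels_carrier
  note p = quot_genideal_proj[OF a]
  note pm = mod_homD[OF alg_homD(1)[OF p], folded tensor_alg_ideal_eq, folded tensor_alg_def]
  note eq = quot_genideal_eqI[OF a, folded tensor_alg_ideal_eq]
  show ?thesis
  proof (rule mod_homI)
    fix v assume v: "v \<in> carrier V"
    then show "tensor_alg_inc K V v \<in> carrier (tensor_alg K V)"
      using pm(1) single_FV by (simp add: tensor_alg_inc_def)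
    fix v' assume v': "v' \<in> carrier V"
    show "tensor_alg_inc K V (v \<oplus>\<^bsub>V\<^esub> v') = tensor_alg_inc K V v \<oplus>\<^bsub>tensor_alg K V\<^esub> tensor_alg_inc K V v'"
      unfolding tensor_alg_inc_def pm(2)[OF single_FV[OF v] single_FV[OF v'], symmetric]
    proof (rule eq)
      show "single K [v \<oplus>\<^bsub>V\<^esub> v'] \<ominus>\<^bsub>FV\<^esub> (single K [v] \<oplus>\<^bsub>FV\<^esub> single K [v']) \<in> tensor_alg_rels"
        unfolding tensor_alg_rels_def using v v' by blast
    qed (simp_all add: single_FV v v')
  next
    fix c v assume c: "c \<in> carrier K" and v: "v \<in> carrier V"
    show "tensor_alg_inc K V (c \<odot>\<^bsub>V\<^esub> v) = c \<odot>\<^bsub>tensor_alg K V\<^esub> tensor_alg_inc K V v"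
      unfolding tensor_alg_inc_def pm(3)[OF c single_FV[OF v], symmetric]
    proof (rule eq)
      show "single K [c \<odot>\<^bsub>V\<^esub> v] \<ominus>\<^bsub>FV\<^esub> (c \<odot>\<^bsub>FV\<^esub> single K [v]) \<in> tensor_alg_rels"
        unfolding tensor_alg_rels_def using c v by blast
    qed (simp_all add: single_FV v c V.lsmult_closed FVm.lsmult_closed)
  qed
qed

context
  fixes B :: "('k, 'b, 'e) module_scheme"
  assumes B: "k_algebra K B"
begin

interpretation B: k_algebra K B by (rule B)

text \<open>The extension of \<open>f\<close> to the free algebra kills the two families of
  generators precisely because \<open>f\<close> is additive and homogeneous.\<close>

lemma tensor_alg_lift:
  assumes f: "f \<in> mod_hom K V B"
  obtains \<phi> where "\<phi> \<in> alg_hom K (tensor_alg K V) B"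
    "\<And>v. v \<in> carrier V \<Longrightarrow> \<phi> (tensor_alg_inc K V v) = f v"
proof -
  let ?l = "free_alg_lift K B f"
  note fc = mod_homD(1)[OF f]
  have l: "?l \<in> alg_hom K FV B" by (rule free_alg_lift_alg_hom[OF K B fc])
  have ls: "?l (single K [v]) = f v" if "v \<in> carrier V" for v
    by (rule free_alg_lift_single[OF K B fc that])
  note lm = alg_homD(1)[OF l]
  have l0: "?l r = \<zero>\<^bsub>B\<^esub>" if "r \<in> tensor_alg_rels" for r
    using that unfolding tensor_alg_rels_def
    by (auto simp: mod_hom_minus[OF FVm.left_module_axioms B.left_module_K lm] mod_homD[OF lm]
        single_FV ls mod_homD[OF f] V.lsmult_closed FVm.lsmult_closed
        left_module_minus_self[OF B.left_module_K])
  note q = quot_genideal_lift[OF FV.k_algebra_axioms tensor_alg_rels_carrier B l l0, folded tensor_alg_ideal_eq]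
  show thesis
  proof
    show "(\<lambda>C. the_elem (?l ` C)) \<in> alg_hom K (tensor_alg K V) B"
      using q(1) by (simp add: tensor_alg_def)
    show "the_elem (?l ` tensor_alg_inc K V v) = f v" if "v \<in> carrier V" for v
      using q(2)[OF _ single_FV[OF that]] that by (simp add: tensor_alg_inc_def ls)
  qed
qed

text \<open>Composed with the projection from the free algebra, both maps are algebra maps that
  agree on letters.\<close>

lemma tensor_alg_ext:
  assumes \<phi>: "\<phi> \<in> alg_hom K (tensor_alg K V) B" and \<psi>: "\<psi> \<in> alg_hom K (tensor_alg K V) B"
    and eq: "\<And>v. v \<in> carrier V \<Longrightarrow> \<phi> (tensor_alg_inc K V v) = \<psi> (tensor_alg_inc K V v)"
    and t: "t \<in> carrier (tensor_alg K V)"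
  shows "\<phi> t = \<psi> t"
proof -
  note p = quot_genideal_proj[OF FV.k_algebra_axioms tensor_alg_rels_carrier,
      folded tensor_alg_ideal_eq, folded tensor_alg_def]
  show ?thesis
    using t unfolding tensor_alg_def
  proof (rule quot_carrierE)
    fix x assume "x \<in> carrier FV" "t = tensor_alg_ideal K V +>\<^bsub>FV\<^esub> x"
    then show "\<phi> t = \<psi> t"
      using free_alg_ext[OF K B alg_hom_comp[OF p \<phi>] alg_hom_comp[OF p \<psi>] eq[unfolded tensor_alg_inc_def]]
      by simp
  qed
qed

end

end

lemma bilinear_map_mult:
  assumes B: "k_algebra K B" and f: "f \<in> mod_hom K V B" and g: "g \<in> mod_hom K W B"
  shows "bilinear_map K V W B (\<lambda>v w. f v \<otimes>\<^bsub>B\<^esub> g w)"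
  by (rule bilinear_map_precomp[OF k_algebra.mult_bilinear[OF B] f g])

section \<open>The algebra \<open>A \<triangleleft> H\<close> and algebra maps out of it\<close>

context
  fixes K :: "('k, 'c) ring_scheme" and A :: "('k, 'a) module" and H :: "('k, 'h) coalgebra"
  assumes A: "k_algebra K A" and H: "is_coalgebra K H"
begin

interpretation A: k_algebra K A by (rule A)

private lemma base_field: "field K" by (rule A.K.field_axioms)
private lemma AK: "left_module K A" by (rule A.left_module_K)

lemma coalgebra_left_module: "left_module K H"
  using H by (simp add: is_coalgebra_def module_iff_left_module)

lemma comult_closed: "h \<in> carrier H \<Longrightarrow> comult H h \<in> carrier (tensor K H H)"
  using H mod_homD(1)[of "comult H" K H "tensor K H H" h] by (simp add: is_coalgebra_def)

lemma counit_closed: "h \<in> carrier H \<Longrightarrow> counit H h \<in> carrier K"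
  using H mod_homD(1)[of "counit H" K H "self_module K" h] by (simp add: is_coalgebra_def self_module_def)

private lemmas HK = coalgebra_left_module

private abbreviation (input) "AH \<equiv> tensor K A H"
private abbreviation (input) "TAH \<equiv> tensor_alg K AH"
private abbreviation (input) "gen \<equiv> (\<lambda>a h. tensor_alg_inc K AH (tens K A H a h))"

private lemma AH: "left_module K AH" by (rule tensor_left_module[OF base_field AK HK])
private lemma TAH: "k_algebra K TAH" by (rule tensor_alg_k_algebra[OF base_field AH])

interpretation T: k_algebra K TAH by (rule TAH)

private lemma inc_gen_bilinear: "bilinear_map K A H TAH gen"
  by (rule bilinear_map_comp[OF tens_bilinear[OF base_field AK HK] tensor_alg_inc_mod_hom[OF base_field AH]])

private lemmas ib = bilinear_mapD[OF inc_gen_bilinear]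

private lemma imult: "a \<in> carrier A \<Longrightarrow> a' \<in> carrier A \<Longrightarrow>
  bilinear_map K H H TAH (\<lambda>h2 h1. gen a h2 \<otimes>\<^bsub>TAH\<^esub> gen a' h1)"
  by (intro bilinear_map_mult[OF TAH] ib(1))

definition "sw_alg_rels =
  {gen (a \<otimes>\<^bsub>A\<^esub> a') h \<ominus>\<^bsub>TAH\<^esub> tensor_lift K TAH (\<lambda>h2 h1. gen a h2 \<otimes>\<^bsub>TAH\<^esub> gen a' h1) (comult H h) | a a' h.
     a \<in> carrier A \<and> a' \<in> carrier A \<and> h \<in> carrier H} \<union>
  {gen \<one>\<^bsub>A\<^esub> h \<ominus>\<^bsub>TAH\<^esub> (counit H h \<odot>\<^bsub>TAH\<^esub> \<one>\<^bsub>TAH\<^esub>) | h. h \<in> carrier H}"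

private lemma sw_ideal_eq: "sw_ideal K A H = Idl\<^bsub>TAH\<^esub> sw_alg_rels"
  by (simp add: sw_ideal_def sw_alg_rels_def Let_def)

private lemma sw_lift_closed: "a \<in> carrier A \<Longrightarrow> a' \<in> carrier A \<Longrightarrow> h \<in> carrier H \<Longrightarrow>
   tensor_lift K TAH (\<lambda>h2 h1. gen a h2 \<otimes>\<^bsub>TAH\<^esub> gen a' h1) (comult H h) \<in> carrier TAH"
  by (rule tensor_lift_closed[OF base_field HK HK T.left_module_K imult comult_closed])

private lemma sw_alg_rels_carrier: "sw_alg_rels \<subseteq> carrier TAH"
  by (auto simp: sw_alg_rels_def sw_lift_closed ib counit_closed intro!: T.A.minus_closed)

lemma sw_alg_k_algebra: "k_algebra K (sw_alg K A H)"
  unfolding sw_alg_def sw_ideal_eq by (rule quot_genideal_k_algebra[OF TAH sw_alg_rels_carrier])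

private lemmas proj =
  quot_genideal_proj[OF TAH sw_alg_rels_carrier, folded sw_ideal_eq, folded sw_alg_def]

lemma sw_gen_bilinear: "bilinear_map K A H (sw_alg K A H) (sw_gen K A H)"
  using bilinear_map_comp[OF inc_gen_bilinear alg_homD(1)[OF proj]] unfolding sw_gen_def[abs_def] .

text \<open>The classes of \<open>a \<otimes> h\<close> generate: pure tensors span
  \<open>A \<otimes> H\<close>, which generates the tensor algebra, which projects onto
  \<open>A \<triangleleft> H\<close>. Each of these layers contributes its own extensionality
  lemma.\<close>

lemma sw_alg_ext:
  assumes B: "k_algebra K B"
    and \<phi>: "\<phi> \<in> alg_hom K (sw_alg K A H) B" and \<psi>: "\<psi> \<in> alg_hom K (sw_alg K A H) B"
    and eq: "\<And>a h. a \<in> carrier A \<Longrightarrow> h \<in> carrier H \<Longrightarrow> \<phi> (sw_gen K A H a h) = \<psi> (sw_gen K A H a h)"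
    and t: "t \<in> carrier (sw_alg K A H)"
  shows "\<phi> t = \<psi> t"
proof -
  interpret B: k_algebra K B by (rule B)
  note \<phi>p = alg_hom_comp[OF proj \<phi>] and \<psi>p = alg_hom_comp[OF proj \<psi>]
  note inc = tensor_alg_inc_mod_hom[OF base_field AH]
  have "\<phi> (sw_ideal K A H +>\<^bsub>TAH\<^esub> tensor_alg_inc K AH v) = \<psi> (sw_ideal K A H +>\<^bsub>TAH\<^esub> tensor_alg_inc K AH v)"
    if "v \<in> carrier AH" for v
    by (rule tensor_ext[OF base_field AK HK B.left_module_K mod_hom_comp[OF inc alg_homD(1)[OF \<phi>p]]
          mod_hom_comp[OF inc alg_homD(1)[OF \<psi>p]] eq[unfolded sw_gen_def] that])
  then have "\<phi> (sw_ideal K A H +>\<^bsub>TAH\<^esub> x) = \<psi> (sw_ideal K A H +>\<^bsub>TAH\<^esub> x)" if "x \<in> carrier TAH" for x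
    by (rule tensor_alg_ext[OF base_field AH B \<phi>p \<psi>p _ that])
  then show ?thesis
    using t unfolding sw_alg_def by (auto elim!: quot_carrierE)
qed

context
  fixes B :: "('k, 'b) module" and \<rho>
  assumes B: "k_algebra K B" and \<rho>: "is_measuring K A B H \<rho>"
begin

interpretation B: k_algebra K B by (rule B)

lemma measuring_bilinear: "bilinear_map K A H B (\<lambda>a h. \<rho> h a)"
proof -
  have \<rho>': "\<rho> \<in> mod_hom K H (hom_space K A B)" using \<rho> by (simp add: is_measuring_def)
  have 1: "\<rho> h \<in> mod_hom K A B" if "h \<in> carrier H" for h
    using mod_homD(1)[OF \<rho>' that] by (simp add: hom_space_def Mod_homD)
  show ?thesis
    by (rule bilinear_mapI)
      (simp_all add: mod_homD[OF 1] mod_homD(2-)[OF \<rho>'], simp_all add: hom_space_def)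
qed

private lemmas \<rho>b = bilinear_mapD[OF measuring_bilinear]

text \<open>\<open>sw_eval\<close> is a definite description, so both existence and uniqueness are
  due. The bilinear map \<open>(a, h) \<mapsto> \<rho> h a\<close> extends to the tensor algebra,
  and the two measuring axioms are what makes the extension kill the two families of relations;
  uniqueness is \<open>sw_alg_ext\<close>.\<close>

lemma sw_eval:
  shows sw_eval_alg_hom: "sw_eval K A B H \<rho> \<in> alg_hom K (sw_alg K A H) B"
    and sw_eval_gen: "\<And>a h. a \<in> carrier A \<Longrightarrow> h \<in> carrier H \<Longrightarrow>
      sw_eval K A B H \<rho> (sw_gen K A H a h) = \<rho> h a"
proof -
  note lf = tensor_lift_mod_hom[OF base_field AK HK B.left_module_K measuring_bilinear]
  note lft = tensor_lift_tens[OF base_field AK HK B.left_module_K measuring_bilinear]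
  obtain \<psi> where \<psi>: "\<psi> \<in> alg_hom K TAH B"
    and \<psi>': "\<And>v. v \<in> carrier AH \<Longrightarrow> \<psi> (tensor_alg_inc K AH v) = tensor_lift K B (\<lambda>a h. \<rho> h a) v"
    using tensor_alg_lift[OF base_field AH B lf] by blast
  have \<psi>i: "\<psi> (gen a h) = \<rho> h a" if "a \<in> carrier A" "h \<in> carrier H" for a h
    using that \<psi>' lft tens_closed[OF base_field AK HK] by simp
  note \<psi>m = alg_homD(1)[OF \<psi>]
  \<comment> \<open>The product rule of the measuring enters here: \<open>\<psi>\<close> moves
    inside the Sweedler sum, splits the product there, and the resulting sum in B is the value of
    the measuring on the product of a and a'.\<close>
  have mult: "\<psi> (tensor_lift K TAH (\<lambda>h2 h1. gen a h2 \<otimes>\<^bsub>TAH\<^esub> gen a' h1) (comult H h)) = \<rho> h (a \<otimes>\<^bsub>A\<^esub> a')"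
    if a: "a \<in> carrier A" "a' \<in> carrier A" and h: "h \<in> carrier H" for a a' h
  proof -
    note c = comult_closed[OF h]
    have "\<psi> (tensor_lift K TAH (\<lambda>h2 h1. gen a h2 \<otimes>\<^bsub>TAH\<^esub> gen a' h1) (comult H h)) =
       tensor_lift K B (\<lambda>h2 h1. \<psi> (gen a h2 \<otimes>\<^bsub>TAH\<^esub> gen a' h1)) (comult H h)"
      by (rule tensor_lift_comp[OF base_field HK HK T.left_module_K B.left_module_K imult[OF a] \<psi>m c])
    also have "\<dots> = tensor_lift K B (\<lambda>h2 h1. \<rho> h2 a \<otimes>\<^bsub>B\<^esub> \<rho> h1 a') (comult H h)"
      by (rule tensor_lift_cong[OF base_field HK HK B.left_module_K bilinear_map_comp[OF imult[OF a] \<psi>m] _ c])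
        (simp add: alg_homD(4)[OF \<psi>] ib a \<psi>i)
    also have "\<dots> = \<rho> h (a \<otimes>\<^bsub>A\<^esub> a')" using \<rho> a h by (simp add: is_measuring_def)
    finally show ?thesis .
  qed
  have one: "\<rho> h \<one>\<^bsub>A\<^esub> = counit H h \<odot>\<^bsub>B\<^esub> \<one>\<^bsub>B\<^esub>" if "h \<in> carrier H" for h
    using \<rho> that by (simp add: is_measuring_def)
  have \<psi>0: "\<psi> r = \<zero>\<^bsub>B\<^esub>" if "r \<in> sw_alg_rels" for r
    using that unfolding sw_alg_rels_def
    by (auto simp: mod_hom_minus[OF T.left_module_K B.left_module_K \<psi>m] ib sw_lift_closed counit_closed
        mult \<psi>i one mod_homD(3)[OF \<psi>m] alg_homD(3)[OF \<psi>] left_module_minus_self[OF B.left_module_K] \<rho>b(3))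
  note q = quot_genideal_lift[OF TAH sw_alg_rels_carrier B \<psi> \<psi>0, folded sw_ideal_eq, folded sw_alg_def]
  have ql: "(\<lambda>C. the_elem (\<psi> ` C)) \<in> alg_hom K (sw_alg K A H) B" by (rule q(1))
  have qg: "the_elem (\<psi> ` sw_gen K A H a h) = \<rho> h a" if "a \<in> carrier A" "h \<in> carrier H" for a h
    using q(2)[OF _ ib(3)[OF that]] \<psi>i[OF that] by (simp add: sw_gen_def)
  let ?S = "sw_alg K A H"
  interpret S: k_algebra K ?S by (rule sw_alg_k_algebra)
  note gc = bilinear_mapD(3)[OF sw_gen_bilinear]
  \<comment> \<open>The description ranges over extensional maps, so the induced map has to be cut
    down to the carrier before it can serve as the witness.\<close>
  define \<phi> where "\<phi> = restrict (\<lambda>C. the_elem (\<psi> ` C)) (carrier ?S)"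
  have \<phi>: "\<phi> \<in> alg_hom K ?S B"
    using ql unfolding \<phi>_def alg_hom_def
    by (simp add: restrict_mod_hom[OF S.left_module_K] ring_hom_def Pi_iff)
  have \<phi>g: "\<phi> (sw_gen K A H a h) = \<rho> h a" if "a \<in> carrier A" "h \<in> carrier H" for a h
    using that gc qg by (simp add: \<phi>_def)
  have "\<exists>!\<phi>. \<phi> \<in> alg_hom K ?S B \<inter> extensional (carrier ?S) \<and>
      (\<forall>a\<in>carrier A. \<forall>h\<in>carrier H. \<phi> (sw_gen K A H a h) = \<rho> h a)"
  proof (rule ex1I[of _ \<phi>])
    show "\<phi> \<in> alg_hom K ?S B \<inter> extensional (carrier ?S) \<and>
      (\<forall>a\<in>carrier A. \<forall>h\<in>carrier H. \<phi> (sw_gen K A H a h) = \<rho> h a)"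
      using \<phi> \<phi>g by (simp add: \<phi>_def)
  next
    fix \<chi> assume \<chi>: "\<chi> \<in> alg_hom K ?S B \<inter> extensional (carrier ?S) \<and>
      (\<forall>a\<in>carrier A. \<forall>h\<in>carrier H. \<chi> (sw_gen K A H a h) = \<rho> h a)"
    show "\<chi> = \<phi>"
    proof (rule extensionalityI[of _ "carrier ?S"])
      fix t assume t: "t \<in> carrier ?S"
      have "\<chi> \<in> alg_hom K ?S B" using \<chi> by blast
      then show "\<chi> t = \<phi> t"
        by (rule sw_alg_ext[OF B _ \<phi> _ t]) (use \<chi> \<phi>g in simp)
    next
      show "\<chi> \<in> extensional (carrier ?S)" using \<chi> by blast
    qed (simp add: \<phi>_def)
  qed
  from theI'[OF this, folded sw_eval_def]
  show "sw_eval K A B H \<rho> \<in> alg_hom K ?S B"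
    "\<And>a h. a \<in> carrier A \<Longrightarrow> h \<in> carrier H \<Longrightarrow> sw_eval K A B H \<rho> (sw_gen K A H a h) = \<rho> h a"
    by auto
qed

end

end

section \<open>Universal properties of the Sweedler product of modules\<close>

context
  fixes K :: "('k, 'c) ring_scheme" and S :: "('k, 's, 'd) module_scheme"
    and W :: "('k, 'w, 'e) module_scheme" and R
  assumes S: "k_algebra K S" and W: "left_module K W"
    and R: "R \<subseteq> carrier (extend_scalars K S W)"
begin

interpretation S: k_algebra K S by (rule S)

private abbreviation (input) "ES \<equiv> extend_scalars K S W"
private abbreviation (input) "N \<equiv> submod_gen S ES R"
private abbreviation (input) "Q \<equiv> quot ES N"

interpretation ES: left_module S ES by (rule extend_scalars_left_module[OF S W])

private lemma ext_quot_modules: "left_module S ES" "submodule N S ES"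
  by (rule ES.left_module_axioms) (rule ES.submod_gen_submodule[OF R])

lemma ext_quot_left_module: "left_module S Q"
  by (rule quot_left_module[OF ext_quot_modules])

lemma ext_quot_proj: "(\<lambda>t. N +>\<^bsub>ES\<^esub> t) \<in> mod_hom S ES Q"
  by (rule quot_proj_mod_hom[OF ext_quot_modules])

lemma ext_quot_rel:
  assumes "x \<in> carrier ES" "y \<in> carrier ES" "x \<ominus>\<^bsub>ES\<^esub> y \<in> R"
  shows "N +>\<^bsub>ES\<^esub> x = N +>\<^bsub>ES\<^esub> y"
  using assms submod_gen_incl[of R S ES] by (intro quot_eqI[OF ext_quot_modules]) auto

lemma ext_quot_inc: "(\<lambda>w. N +>\<^bsub>ES\<^esub> tens K S W \<one>\<^bsub>S\<^esub> w) \<in> mod_hom K W (kmod S Q)"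
  using mod_hom_comp[OF extend_scalars_inc_mod_hom[OF S W]
      mod_hom_kmod[OF S extend_scalars_left_module[OF S W] ext_quot_proj,
        unfolded mod_hom_kmod_extend_scalars'[OF S W]]] .

text \<open>Vanishing on the generators R extends to the submodule they generate. The lemma is used
  with \<open>S = A \<triangleleft> H\<close> and \<open>W = M \<otimes> X\<close> for the Sweedler
  product, and with B in place of S for base change.\<close>

lemma ext_quot_lift:
  assumes Y: "left_module S Y" and G: "G \<in> mod_hom S ES Y" and G0: "\<And>r. r \<in> R \<Longrightarrow> G r = \<zero>\<^bsub>Y\<^esub>"
  shows "(\<lambda>C. the_elem (G ` C)) \<in> mod_hom S Q Y"
    and "\<And>t. t \<in> carrier ES \<Longrightarrow> the_elem (G ` (N +>\<^bsub>ES\<^esub> t)) = G t"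
proof -
  have G0': "G r = \<zero>\<^bsub>Y\<^esub>" if "r \<in> N" for r
    by (rule mod_hom_vanish_submod_gen[OF ext_quot_modules(1) Y G R G0 that])
  show "(\<lambda>C. the_elem (G ` C)) \<in> mod_hom S Q Y"
    by (rule quot_lift_mod_hom[OF ext_quot_modules Y G G0'])
  show "\<And>t. t \<in> carrier ES \<Longrightarrow> the_elem (G ` (N +>\<^bsub>ES\<^esub> t)) = G t"
    by (rule quot_lift_coset[OF ext_quot_modules Y G G0'])
qed

text \<open>Both maps are pulled back to \<open>S \<otimes> W\<close>, which the elements
  \<open>1 \<otimes> w\<close> generate over S.\<close>

lemma ext_quot_ext:
  assumes Y: "left_module S Y" and f: "f \<in> mod_hom S Q Y" and g: "g \<in> mod_hom S Q Y"
    and eq: "\<And>w. w \<in> carrier W \<Longrightarrow>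
      f (N +>\<^bsub>ES\<^esub> tens K S W \<one>\<^bsub>S\<^esub> w) = g (N +>\<^bsub>ES\<^esub> tens K S W \<one>\<^bsub>S\<^esub> w)"
    and C: "C \<in> carrier Q"
  shows "f C = g C"
proof -
  from C obtain t where t: "t \<in> carrier ES" "C = N +>\<^bsub>ES\<^esub> t" by (rule quot_carrierE)
  then show ?thesis
    using extend_scalars_ext[OF S W Y mod_hom_comp[OF ext_quot_proj f] mod_hom_comp[OF ext_quot_proj g] eq]
    by (simp add: extend_scalars_simps[OF S W])
qed

end

text \<open>Scalars act on the first tensor factor and \<open>u\<close> on the second, so the two
  operations commute on pure tensors.\<close>

lemma tensor_map_extend_scalars:
  assumes S: "k_algebra K S" and W: "left_module K W" and W': "left_module K W'"
    and u: "u \<in> mod_hom K W W'"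
  shows "tensor_map K S W' (\<lambda>s. s) u \<in> mod_hom S (extend_scalars K S W) (extend_scalars K S W')"
proof -
  interpret S: k_algebra K S by (rule S)
  note f = S.K.field_axioms S.left_module_K
  note m = tensor_map_mod_hom[OF f W S.left_module_K W' mod_hom_ident u]
  note mt = tensor_map_tens[OF f W S.left_module_K W' mod_hom_ident u]
  note es = extend_scalars_simps[OF S W] extend_scalars_simps[OF S W']
  show ?thesis
  proof (rule mod_homI)
    fix s t assume s: "s \<in> carrier S" and t: "t \<in> carrier (extend_scalars K S W)"
    show "tensor_map K S W' (\<lambda>s. s) u (s \<odot>\<^bsub>extend_scalars K S W\<^esub> t) =
      s \<odot>\<^bsub>extend_scalars K S W'\<^esub> tensor_map K S W' (\<lambda>s. s) u t"
      by (rule tensor_ext[OF f W tensor_left_module[OF f W']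
            mod_hom_comp[OF extend_scalars_smult_mod_hom[OF S W s] m]
            mod_hom_comp[OF m extend_scalars_smult_mod_hom[OF S W' s]]])
        (use s t in \<open>simp_all add: es mt extend_scalars_smult_tens[OF S W]
            extend_scalars_smult_tens[OF S W'] mod_homD(1)[OF u]\<close>)
  qed (simp_all add: es mod_homD[OF m])
qed

lemma comodule_left_module:
  assumes "is_comodule K H X"
  shows "left_module K X"
  using assms by (simp add: is_comodule_def module_iff_left_module)

lemma comod_hom_mod_hom: "g \<in> comod_hom K H X Y \<Longrightarrow> g \<in> mod_hom K X Y"
  by (simp add: comod_hom_def)

lemma coact_closed:
  assumes "is_comodule K H X" "x \<in> carrier X"
  shows "coact X x \<in> carrier (tensor K H X)"
  using assms mod_homD(1)[of "coact X" K X "tensor K H X" x] by (simp add: is_comodule_def)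

text \<open>The identity \<open>\<beta>(a m, x) = \<Sum> \<gamma>(a, x\<^sub>(\<^sub>1\<^sub>)) \<beta>(m, x\<^sub>(\<^sub>0\<^sub>))\<close>, with values in a module \<open>Y\<close> over
  an algebra \<open>S\<close>.\<close>

definition balanced where
  "balanced K A M X S Y \<gamma> \<beta> \<longleftrightarrow> (\<forall>a\<in>carrier A. \<forall>m\<in>carrier M. \<forall>x\<in>carrier X.
     \<beta> (a \<odot>\<^bsub>M\<^esub> m) x = tensor_lift K (kmod S Y) (\<lambda>x1 x0. \<gamma> a x1 \<odot>\<^bsub>Y\<^esub> \<beta> m x0) (coact X x))"

section \<open>Stability of balanced maps\<close>

locale algebra_coalgebra =
  fixes K :: "('k, 'c) ring_scheme" and A :: "('k, 'a) module" and H :: "('k, 'h) coalgebra"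
  assumes A: "k_algebra K A" and H: "is_coalgebra K H"
begin

sublocale A: k_algebra K A by (rule A)

lemma field_K: "field K" by (rule A.K.field_axioms)
lemma H_module: "left_module K H" by (rule coalgebra_left_module[OF A H])

text \<open>Ensures that the right-hand side of \<open>balanced\<close> is a lift of a genuinely
  bilinear map, so that the rules for Sweedler sums apply to it.\<close>

lemma action_coact_bilinear:
  assumes S: "k_algebra K S" and Y: "left_module S Y"
    and \<gamma>: "bilinear_map K A H S \<gamma>" and a: "a \<in> carrier A" and b: "b \<in> mod_hom K X (kmod S Y)"
  shows "bilinear_map K H X (kmod S Y) (\<lambda>x1 x0. \<gamma> a x1 \<odot>\<^bsub>Y\<^esub> b x0)"
  by (rule bilinear_map_precomp[OF action_bilinear[OF S Y] bilinear_mapD(1)[OF \<gamma> a] b])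

text \<open>The map \<open>f\<close> moves inside the Sweedler sum by K-linearity and there trades
  \<open>\<gamma>\<close> for \<open>\<gamma>'\<close>. Allowing two algebras covers base change
  from \<open>A \<triangleleft> H\<close> to B, the passage back by restriction of scalars with
  \<open>f\<close> the identity, and composition with a B-linear map.\<close>

lemma balanced_comp:
  assumes X: "is_comodule K H X" and M: "left_module A M"
    and S: "k_algebra K S" and Y: "left_module S Y" and S': "k_algebra K S'" and Y': "left_module S' Y'"
    and \<gamma>: "bilinear_map K A H S \<gamma>" and \<beta>: "bilinear_map K (kmod A M) X (kmod S Y) \<beta>"
    and bal: "balanced K A M X S Y \<gamma> \<beta>"
    and f: "f \<in> mod_hom K (kmod S Y) (kmod S' Y')"
    and f\<gamma>: "\<And>a h y. a \<in> carrier A \<Longrightarrow> h \<in> carrier H \<Longrightarrow> y \<in> carrier Y \<Longrightarrow>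
      f (\<gamma> a h \<odot>\<^bsub>Y\<^esub> y) = \<gamma>' a h \<odot>\<^bsub>Y'\<^esub> f y"
  shows "balanced K A M X S' Y' \<gamma>' (\<lambda>m x. f (\<beta> m x))"
  unfolding balanced_def
proof (intro ballI)
  fix a m x assume a: "a \<in> carrier A" and m: "m \<in> carrier M" and x: "x \<in> carrier X"
  note XK = comodule_left_module[OF X] and c = coact_closed[OF X x]
  note Yk = kmod_left_module[OF S Y] and Yk' = kmod_left_module[OF S' Y']
  have m': "m \<in> carrier (kmod A M)" using m by (simp add: kmod_simps)
  note b = action_coact_bilinear[OF S Y \<gamma> a bilinear_mapD(1)[OF \<beta> m']]
  have "f (\<beta> (a \<odot>\<^bsub>M\<^esub> m) x) = f (tensor_lift K (kmod S Y) (\<lambda>x1 x0. \<gamma> a x1 \<odot>\<^bsub>Y\<^esub> \<beta> m x0) (coact X x))"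
    using bal a m x by (simp add: balanced_def)
  also have "\<dots> = tensor_lift K (kmod S' Y') (\<lambda>x1 x0. f (\<gamma> a x1 \<odot>\<^bsub>Y\<^esub> \<beta> m x0)) (coact X x)"
    by (rule tensor_lift_comp[OF field_K H_module XK Yk Yk' b f c])
  also have "\<dots> = tensor_lift K (kmod S' Y') (\<lambda>x1 x0. \<gamma>' a x1 \<odot>\<^bsub>Y'\<^esub> f (\<beta> m x0)) (coact X x)"
    using bilinear_mapD(3)[OF \<beta> m'] a
    by (intro tensor_lift_cong[OF field_K H_module XK Yk' bilinear_map_comp[OF b f] _ c] f\<gamma>)
      (simp_all add: kmod_simps)
  finally show "f (\<beta> (a \<odot>\<^bsub>M\<^esub> m) x) =
    tensor_lift K (kmod S' Y') (\<lambda>x1 x0. \<gamma>' a x1 \<odot>\<^bsub>Y'\<^esub> f (\<beta> m x0)) (coact X x)" .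
qed

text \<open>A-linearity of \<open>f\<close> handles the left-hand side. On the right the coaction at
  \<open>g x\<close> is the image of the coaction at x under \<open>id \<otimes> g\<close>, and
  substitution in the Sweedler sum finishes.\<close>

lemma balanced_precomp:
  assumes X: "is_comodule K H X" and X': "is_comodule K H X'"
    and M: "left_module A M" and M': "left_module A M'"
    and S: "k_algebra K S" and Y: "left_module S Y"
    and \<gamma>: "bilinear_map K A H S \<gamma>" and \<beta>: "bilinear_map K (kmod A M') X' (kmod S Y) \<beta>"
    and bal: "balanced K A M' X' S Y \<gamma> \<beta>"
    and f: "f \<in> mod_hom A M M'" and g: "g \<in> comod_hom K H X X'"
  shows "balanced K A M X S Y \<gamma> (\<lambda>m x. \<beta> (f m) (g x))"
  unfolding balanced_def
proof (intro ballI)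
  fix a m x assume a: "a \<in> carrier A" and m: "m \<in> carrier M" and x: "x \<in> carrier X"
  have gm: "g \<in> mod_hom K X X'" and gc: "coact X' (g x) = tensor_map K H X' (\<lambda>h. h) g (coact X x)"
    using g x by (auto simp: comod_hom_def)
  note fm = mod_homD(1)[OF f m] and gx = mod_homD(1)[OF gm x]
  have fm': "f m \<in> carrier (kmod A M')" using fm by (simp add: kmod_simps)
  note XK = comodule_left_module[OF X] and XK' = comodule_left_module[OF X']
  note b = action_coact_bilinear[OF S Y \<gamma> a bilinear_mapD(1)[OF \<beta> fm']]
  have "\<beta> (f (a \<odot>\<^bsub>M\<^esub> m)) (g x) =
      tensor_lift K (kmod S Y) (\<lambda>x1 x0. \<gamma> a x1 \<odot>\<^bsub>Y\<^esub> \<beta> (f m) x0) (coact X' (g x))"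
    using bal a fm gx by (simp add: balanced_def mod_homD(3)[OF f a m])
  also have "\<dots> = tensor_lift K (kmod S Y) (\<lambda>x1 x0. \<gamma> a x1 \<odot>\<^bsub>Y\<^esub> \<beta> (f m) (g x0)) (coact X x)"
    unfolding gc
    by (rule tensor_lift_tensor_map[OF field_K H_module XK H_module XK' mod_hom_ident gm
          kmod_left_module[OF S Y] b coact_closed[OF X x]])
  finally show "\<beta> (f (a \<odot>\<^bsub>M\<^esub> m)) (g x) =
    tensor_lift K (kmod S Y) (\<lambda>x1 x0. \<gamma> a x1 \<odot>\<^bsub>Y\<^esub> \<beta> (f m) (g x0)) (coact X x)" .
qed

text \<open>The identity evaluates the map only on carriers, also under the Sweedler sum, so a
  formula valid there may replace it.\<close>

lemma balanced_cong:
  assumes X: "is_comodule K H X" and M: "left_module A M"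
    and S: "k_algebra K S" and Y: "left_module S Y"
    and \<gamma>: "bilinear_map K A H S \<gamma>" and \<beta>: "bilinear_map K (kmod A M) X (kmod S Y) \<beta>"
    and bal: "balanced K A M X S Y \<gamma> \<beta>"
    and eq: "\<And>m x. m \<in> carrier M \<Longrightarrow> x \<in> carrier X \<Longrightarrow> \<beta> m x = \<beta>' m x"
  shows "balanced K A M X S Y \<gamma> \<beta>'"
  unfolding balanced_def
proof (intro ballI)
  fix a m x assume a: "a \<in> carrier A" and m: "m \<in> carrier M" and x: "x \<in> carrier X"
  have m': "m \<in> carrier (kmod A M)" using m by (simp add: kmod_simps)
  have "\<beta>' (a \<odot>\<^bsub>M\<^esub> m) x = tensor_lift K (kmod S Y) (\<lambda>x1 x0. \<gamma> a x1 \<odot>\<^bsub>Y\<^esub> \<beta> m x0) (coact X x)"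
    unfolding eq[OF left_module.lsmult_closed[OF M a m] x, symmetric]
    using bal a m x by (simp add: balanced_def)
  also have "\<dots> = tensor_lift K (kmod S Y) (\<lambda>x1 x0. \<gamma> a x1 \<odot>\<^bsub>Y\<^esub> \<beta>' m x0) (coact X x)"
    by (rule tensor_lift_cong[OF field_K H_module comodule_left_module[OF X] kmod_left_module[OF S Y]
          action_coact_bilinear[OF S Y \<gamma> a bilinear_mapD(1)[OF \<beta> m']] _ coact_closed[OF X x]])
      (simp add: eq[OF m])
  finally show "\<beta>' (a \<odot>\<^bsub>M\<^esub> m) x =
    tensor_lift K (kmod S Y) (\<lambda>x1 x0. \<gamma> a x1 \<odot>\<^bsub>Y\<^esub> \<beta>' m x0) (coact X x)" .
qed

abbreviation "S \<equiv> sw_alg K A H"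

sublocale S: k_algebra K S by (rule sw_alg_k_algebra[OF A H])

lemmas S_alg = S.k_algebra_axioms

lemma gen_bilinear: "bilinear_map K A H S (sw_gen K A H)"
  by (rule sw_gen_bilinear[OF A H])

section \<open>The universal balanced map into \<open>M \<triangleleft> X\<close> over
  \<open>A \<triangleleft> H\<close>\<close>

context
  fixes M :: "('a, 'm) module" and X :: "('k, 'h, 'x) comodule"
  assumes M: "left_module A M" and X: "is_comodule K H X"
begin

interpretation M: left_module A M by (rule M)

private abbreviation (input) "MX \<equiv> tensor K (kmod A M) X"
private abbreviation (input) "E \<equiv> sw_free K A H M X"
private abbreviation (input) "Y \<equiv> sw_mod K A H M X"

lemma sw_M_module: "left_module K (kmod A M)" by (rule kmod_left_module[OF A M])
lemmas sw_X_module = comodule_left_module[OF X]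
lemma sw_MX_module: "left_module K MX"
  by (rule tensor_left_module[OF field_K sw_M_module sw_X_module])

lemma sw_tens_bilinear: "bilinear_map K (kmod A M) X MX (tens K (kmod A M) X)"
  by (rule tens_bilinear[OF field_K sw_M_module sw_X_module])

private lemmas tens_MX = tens_closed[OF field_K sw_M_module sw_X_module, unfolded kmod_simps]
private lemmas tens_E = tens_closed[OF field_K S.left_module_K sw_MX_module]
private lemmas T_module = tensor_left_module[OF field_K S.left_module_K sw_MX_module]
private lemma E_simps: "carrier E = carrier (tensor K S MX)"
  by (simp add: sw_free_def extend_scalars_simps[OF S_alg sw_MX_module])

private abbreviation (input) "pure \<equiv> sw_pure K A H M X"
private abbreviation (input) "coact_sum a m x \<equiv> tensor_lift K (tensor K S MX)
  (\<lambda>x1 x0. pure (sw_gen K A H a x1) m x0) (coact X x)"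

lemma sw_pure_closed: "s \<in> carrier S \<Longrightarrow> m \<in> carrier M \<Longrightarrow> x \<in> carrier X \<Longrightarrow>
    pure s m x \<in> carrier E"
  by (simp add: sw_pure_def E_simps tens_E tens_MX)

lemma sw_pure_bilinear:
  assumes "a \<in> carrier A" "m \<in> carrier M"
  shows "bilinear_map K H X (tensor K S MX) (\<lambda>x1 x0. pure (sw_gen K A H a x1) m x0)"
proof -
  have m: "m \<in> carrier (kmod A M)" using assms by (simp add: kmod_simps)
  show ?thesis
    unfolding sw_pure_def
    by (rule bilinear_map_precomp[OF tens_bilinear[OF field_K S.left_module_K sw_MX_module]
          bilinear_mapD(1)[OF gen_bilinear assms(1)] bilinear_mapD(1)[OF sw_tens_bilinear m]])
qed

lemma sw_pure_one:
  "s \<in> carrier S \<Longrightarrow> m \<in> carrier M \<Longrightarrow> x \<in> carrier X \<Longrightarrow>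
    pure s m x = s \<odot>\<^bsub>E\<^esub> pure \<one>\<^bsub>S\<^esub> m x"
  by (simp add: sw_pure_def sw_free_def extend_scalars_smult_tens[OF S_alg sw_MX_module] tens_MX)

definition "sw_mod_rels =
  {pure \<one>\<^bsub>S\<^esub> (a \<odot>\<^bsub>M\<^esub> m) x \<ominus>\<^bsub>E\<^esub>
     coact_sum a m x | a m x.
     a \<in> carrier A \<and> m \<in> carrier M \<and> x \<in> carrier X}"

lemma sw_rel_eq: "sw_rel K A H M X = submod_gen S E sw_mod_rels"
  by (simp add: sw_rel_def sw_mod_rels_def Let_def)

lemma sw_free_left_module: "left_module S E"
  unfolding sw_free_def by (rule extend_scalars_left_module[OF S_alg sw_MX_module])

interpretation E: left_module S E by (rule sw_free_left_module)

private lemma sum_closed: "a \<in> carrier A \<Longrightarrow> m \<in> carrier M \<Longrightarrow> x \<in> carrier X \<Longrightarrow>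
  coact_sum a m x
    \<in> carrier E"
  unfolding E_simps
  by (rule tensor_lift_closed[OF field_K H_module sw_X_module T_module sw_pure_bilinear coact_closed[OF X]])

lemma sw_mod_rels_carrier: "sw_mod_rels \<subseteq> carrier (extend_scalars K S MX)"
  unfolding sw_free_def[symmetric]
  by (auto simp: sw_mod_rels_def intro!: E.M.minus_closed sw_pure_closed sum_closed M.lsmult_closed)

private lemma Y_eq: "Y = quot (extend_scalars K S MX) (submod_gen S (extend_scalars K S MX) sw_mod_rels)"
  by (simp add: sw_mod_def sw_rel_eq) (simp add: sw_free_def)

lemma sw_mod_left_module: "left_module S Y"
  unfolding Y_eq by (rule ext_quot_left_module[OF S_alg sw_MX_module sw_mod_rels_carrier])

lemma sw_mod_proj: "(\<lambda>t. sw_rel K A H M X +>\<^bsub>E\<^esub> t) \<in> mod_hom S E Y"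
  using ext_quot_proj[OF S_alg sw_MX_module sw_mod_rels_carrier]
  by (simp add: Y_eq sw_rel_eq) (simp add: sw_free_def)

text \<open>Since \<open>s \<otimes> m \<otimes> x\<close> is s times
  \<open>1 \<otimes> m \<otimes> x\<close>, an \<open>A \<triangleleft> H\<close>-linear map sends
  the sum in a defining relation to the sum in the balanced identity, with \<open>sw_gen\<close> in
  the role of \<open>\<gamma>\<close>.\<close>

lemma sw_free_hom_sum:
  assumes N: "left_module S N" and G: "G \<in> mod_hom S E N"
    and a: "a \<in> carrier A" and m: "m \<in> carrier M" and x: "x \<in> carrier X"
  shows "G (coact_sum a m x) =
    tensor_lift K (kmod S N)
      (\<lambda>x1 x0. sw_gen K A H a x1 \<odot>\<^bsub>N\<^esub> G (pure \<one>\<^bsub>S\<^esub> m x0)) (coact X x)"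
proof -
  note Nk = kmod_left_module[OF S_alg N]
  have Gk: "G \<in> mod_hom K (tensor K S MX) (kmod S N)"
    using mod_hom_kmod[OF S_alg sw_free_left_module G]
    unfolding sw_free_def mod_hom_kmod_extend_scalars'[OF S_alg sw_MX_module] .
  note c = coact_closed[OF X x]
  note gc = bilinear_mapD(3)[OF gen_bilinear a]
  have step: "G (pure s m x0) = s \<odot>\<^bsub>N\<^esub> G (pure \<one>\<^bsub>S\<^esub> m x0)"
    if s: "s \<in> carrier S" and x0: "x0 \<in> carrier X" for s x0
    unfolding sw_pure_one[OF s m x0]
    by (rule mod_homD(3)[OF G s sw_pure_closed[OF S.one_closed m x0]])
  have "G (coact_sum a m x) =
    tensor_lift K (kmod S N)
      (\<lambda>x1 x0. G (pure (sw_gen K A H a x1) m x0)) (coact X x)"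
    by (rule tensor_lift_comp[OF field_K H_module sw_X_module T_module Nk sw_pure_bilinear[OF a m] Gk c])
  also have "\<dots> = tensor_lift K (kmod S N)
      (\<lambda>x1 x0. sw_gen K A H a x1 \<odot>\<^bsub>N\<^esub> G (pure \<one>\<^bsub>S\<^esub> m x0)) (coact X x)"
    by (rule tensor_lift_cong[OF field_K H_module sw_X_module Nk
          bilinear_map_comp[OF sw_pure_bilinear[OF a m] Gk] _ c]) (rule step[OF gc])
  finally show ?thesis .
qed

text \<open>By \<open>sw_free_hom_sum\<close>, the value of \<open>G\<close> on a relation is the
  difference of the two sides of the balanced identity.\<close>

lemma sw_free_hom_vanish:
  assumes N: "left_module S N" and G: "G \<in> mod_hom S E N"
    and bal: "balanced K A M X S N (sw_gen K A H) (\<lambda>m x. G (pure \<one>\<^bsub>S\<^esub> m x))"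
    and r: "r \<in> sw_mod_rels"
  shows "G r = \<zero>\<^bsub>N\<^esub>"
proof -
  obtain a m x where r: "r = pure \<one>\<^bsub>S\<^esub> (a \<odot>\<^bsub>M\<^esub> m) x \<ominus>\<^bsub>E\<^esub>
     coact_sum a m x"
    and a: "a \<in> carrier A" and m: "m \<in> carrier M" and x: "x \<in> carrier X"
    using r unfolding sw_mod_rels_def by blast
  note c = sw_pure_closed[OF S.one_closed M.lsmult_closed[OF a m] x]
  show ?thesis
    unfolding r mod_hom_minus[OF sw_free_left_module N G c sum_closed[OF a m x]]
      sw_free_hom_sum[OF N G a m x]
    using bal a m x mod_homD(1)[OF G c] left_module_minus_self[OF N]
    by (simp add: balanced_def)
qed

definition "sw_inc = (\<lambda>m x. sw_rel K A H M X +>\<^bsub>E\<^esub> pure \<one>\<^bsub>S\<^esub> m x)"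

lemma sw_inc_bilinear: "bilinear_map K (kmod A M) X (kmod S Y) sw_inc"
  using bilinear_map_comp[OF sw_tens_bilinear ext_quot_inc[OF S_alg sw_MX_module sw_mod_rels_carrier]]
  by (simp add: sw_inc_def Y_eq sw_rel_eq sw_pure_def) (simp add: sw_free_def)

lemma sw_inc_balanced: "balanced K A M X S Y (sw_gen K A H) sw_inc"
  unfolding balanced_def
proof (intro ballI)
  fix a m x assume a: "a \<in> carrier A" and m: "m \<in> carrier M" and x: "x \<in> carrier X"
  have "sw_inc (a \<odot>\<^bsub>M\<^esub> m) x = sw_rel K A H M X +>\<^bsub>E\<^esub> coact_sum a m x"
    unfolding sw_inc_def sw_rel_eq sw_free_def
  proof (rule ext_quot_rel[OF S_alg sw_MX_module sw_mod_rels_carrier], unfold sw_free_def[symmetric])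
    show "pure \<one>\<^bsub>S\<^esub> (a \<odot>\<^bsub>M\<^esub> m) x \<ominus>\<^bsub>E\<^esub>
     coact_sum a m x \<in> sw_mod_rels"
      unfolding sw_mod_rels_def using a m x by blast
  qed (use a m x in \<open>simp_all add: sw_pure_closed M.lsmult_closed sum_closed\<close>)
  \<comment> \<open>The class of the sum is computed by \<open>sw_free_hom_sum\<close>, applied to
    the projection onto \<open>M \<triangleleft> X\<close> as the module map.\<close>
  then show "sw_inc (a \<odot>\<^bsub>M\<^esub> m) x =
    tensor_lift K (kmod S Y) (\<lambda>x1 x0. sw_gen K A H a x1 \<odot>\<^bsub>Y\<^esub> sw_inc m x0) (coact X x)"
    using sw_free_hom_sum[OF sw_mod_left_module sw_mod_proj a m x] by (simp add: sw_inc_def)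
qed

text \<open>The classes of \<open>1 \<otimes> t\<close> generate the module over
  \<open>A \<triangleleft> H\<close>, and t ranges over \<open>M \<otimes> X\<close>, which pure
  tensors span.\<close>

lemma sw_mod_ext:
  assumes N: "left_module S N" and f: "f \<in> mod_hom S Y N" and g: "g \<in> mod_hom S Y N"
    and eq: "\<And>m x. m \<in> carrier M \<Longrightarrow> x \<in> carrier X \<Longrightarrow> f (sw_inc m x) = g (sw_inc m x)"
    and y: "y \<in> carrier Y"
  shows "f y = g y"
proof (rule ext_quot_ext[OF S_alg sw_MX_module sw_mod_rels_carrier N, folded Y_eq, OF f g _ y],
    fold sw_free_def, fold sw_rel_eq)
  fix t assume t: "t \<in> carrier MX"
  note inc = ext_quot_inc[OF S_alg sw_MX_module sw_mod_rels_carrier, folded Y_eq, folded sw_free_def,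
      folded sw_rel_eq]
  note fk = mod_hom_kmod[OF S_alg sw_mod_left_module f]
  note gk = mod_hom_kmod[OF S_alg sw_mod_left_module g]
  show "f (sw_rel K A H M X +>\<^bsub>E\<^esub> tens K S MX \<one>\<^bsub>S\<^esub> t) = g (sw_rel K A H M X +>\<^bsub>E\<^esub> tens K S MX \<one>\<^bsub>S\<^esub> t)"
    by (rule tensor_ext[OF field_K sw_M_module sw_X_module kmod_left_module[OF S_alg N]
          mod_hom_comp[OF inc fk] mod_hom_comp[OF inc gk] _ t])
      (simp add: eq[unfolded sw_inc_def sw_pure_def] kmod_simps)
qed

text \<open>Bilinearity extends \<open>\<beta>\<close> to \<open>M \<otimes> X\<close>, scalar
  extension to \<open>(A \<triangleleft> H) \<otimes> M \<otimes> X\<close>, and balancedness lets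
  the result descend to the quotient.\<close>

lemma sw_mod_lift:
  assumes N: "left_module S N" and \<beta>: "bilinear_map K (kmod A M) X (kmod S N) \<beta>"
    and bal: "balanced K A M X S N (sw_gen K A H) \<beta>"
  obtains f where "f \<in> mod_hom S Y N"
    "\<And>m x. m \<in> carrier M \<Longrightarrow> x \<in> carrier X \<Longrightarrow> f (sw_inc m x) = \<beta> m x"
proof -
  note Nk = kmod_left_module[OF S_alg N]
  note g = tensor_lift_mod_hom[OF field_K sw_M_module sw_X_module Nk \<beta>]
  note gt = tensor_lift_tens[OF field_K sw_M_module sw_X_module Nk \<beta>, unfolded kmod_simps]
  define G where "G = tensor_lift K (kmod S N) (\<lambda>s w. s \<odot>\<^bsub>N\<^esub> tensor_lift K (kmod S N) \<beta> w)"
  have G: "G \<in> mod_hom S E N"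
    unfolding G_def sw_free_def by (rule extend_scalars_lift_mod_hom[OF S_alg sw_MX_module N g])
  have Gp: "G (pure \<one>\<^bsub>S\<^esub> m x) = \<beta> m x" if "m \<in> carrier M" "x \<in> carrier X" for m x
    using that extend_scalars_lift_inc[OF S_alg sw_MX_module N g] gt tens_MX
    by (simp add: G_def sw_pure_def)
  have "balanced K A M X S N (sw_gen K A H) (\<lambda>m x. G (pure \<one>\<^bsub>S\<^esub> m x))"
    by (rule balanced_cong[OF X M S_alg N gen_bilinear \<beta> bal]) (simp add: Gp)
  note v = sw_free_hom_vanish[OF N G this]
  note l = ext_quot_lift[OF S_alg sw_MX_module sw_mod_rels_carrier N G[unfolded sw_free_def] v,
      folded Y_eq, folded sw_free_def, folded sw_rel_eq]
  show thesis
  proof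
    show "(\<lambda>C. the_elem (G ` C)) \<in> mod_hom S Y N" by (rule l(1))
    show "the_elem (G ` sw_inc m x) = \<beta> m x" if "m \<in> carrier M" "x \<in> carrier X" for m x
      using l(2)[OF _ sw_pure_closed[OF S.one_closed that]] Gp that by (simp add: sw_inc_def)
  qed
qed

end

end

section \<open>Base change along an algebra map\<close>

context
  fixes K :: "('k, 'c) ring_scheme" and S :: "('k, 's) module" and B :: "('k, 'b) module"
    and \<phi> and Y :: "('s, 'y) module"
  assumes S: "k_algebra K S" and B: "k_algebra K B" and \<phi>: "\<phi> \<in> alg_hom K S B"
    and Y: "left_module S Y"
begin

interpretation S: k_algebra K S by (rule S)
interpretation B: k_algebra K B by (rule B)
interpretation Y: left_module S Y by (rule Y)

private abbreviation (input) "EB \<equiv> extend_scalars K B (kmod S Y)"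
private abbreviation (input) "BY \<equiv> base_change K S B \<phi> Y"
private abbreviation (input) "tn \<equiv> tens K B (kmod S Y)"

private lemmas bc_field = S.K.field_axioms
private lemmas bc_B = B.left_module_K
private lemma bc_Y: "left_module K (kmod S Y)" by (rule kmod_left_module[OF S Y])

private lemma bc_tens: "b \<in> carrier B \<Longrightarrow> y \<in> carrier Y \<Longrightarrow> tn b y \<in> carrier EB"
  using tens_closed[OF bc_field bc_B bc_Y] by (simp add: extend_scalars_simps[OF B bc_Y] kmod_simps)

private lemma bc_phi: "s \<in> carrier S \<Longrightarrow> \<phi> s \<in> carrier B"
  using mod_homD(1)[OF alg_homD(1)[OF \<phi>]] .

definition "base_change_rels =
  {tn (b \<otimes>\<^bsub>B\<^esub> \<phi> s) y \<ominus>\<^bsub>EB\<^esub> tn b (s \<odot>\<^bsub>Y\<^esub> y) | b s y.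
     b \<in> carrier B \<and> s \<in> carrier S \<and> y \<in> carrier Y}"

lemma base_change_rel_eq: "base_change_rel K S B \<phi> Y = submod_gen B EB base_change_rels"
  by (simp add: base_change_rel_def base_change_rels_def Let_def)

private lemma BY_eq: "BY = quot EB (submod_gen B EB base_change_rels)"
  by (simp add: base_change_def base_change_rel_eq)

interpretation EB: left_module B EB by (rule extend_scalars_left_module[OF B bc_Y])

lemma base_change_rels_carrier: "base_change_rels \<subseteq> carrier EB"
  by (auto simp: base_change_rels_def Y.lsmult_closed bc_phi intro!: EB.M.minus_closed bc_tens)

private lemmas bc = B bc_Y base_change_rels_carrier

lemma base_change_left_module: "left_module B BY"
  unfolding BY_eq by (rule ext_quot_left_module[OF bc])

lemma base_change_proj: "(\<lambda>t. base_change_rel K S B \<phi> Y +>\<^bsub>EB\<^esub> t) \<in> mod_hom B EB BY"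
  unfolding BY_eq base_change_rel_eq by (rule ext_quot_proj[OF bc])

definition "base_change_inc y = base_change_rel K S B \<phi> Y +>\<^bsub>EB\<^esub> tn \<one>\<^bsub>B\<^esub> y"

lemma base_change_inc_mod_hom: "base_change_inc \<in> mod_hom K (kmod S Y) (kmod B BY)"
  using ext_quot_inc[OF bc] by (simp add: BY_eq base_change_rel_eq base_change_inc_def[abs_def])

private lemma tn_eq: "b \<in> carrier B \<Longrightarrow> y \<in> carrier Y \<Longrightarrow> tn b y = b \<odot>\<^bsub>EB\<^esub> tn \<one>\<^bsub>B\<^esub> y"
  by (simp add: extend_scalars_smult_tens[OF B bc_Y] kmod_simps)

text \<open>This is the defining relation at \<open>b = 1\<close>, combined with
  \<open>\<phi> s \<otimes> y\<close> being \<open>\<phi> s\<close> times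
  \<open>1 \<otimes> y\<close>.\<close>

lemma base_change_inc_smult:
  assumes s: "s \<in> carrier S" and y: "y \<in> carrier Y"
  shows "base_change_inc (s \<odot>\<^bsub>Y\<^esub> y) = \<phi> s \<odot>\<^bsub>BY\<^esub> base_change_inc y"
proof -
  have "tn (\<one>\<^bsub>B\<^esub> \<otimes>\<^bsub>B\<^esub> \<phi> s) y \<ominus>\<^bsub>EB\<^esub> tn \<one>\<^bsub>B\<^esub> (s \<odot>\<^bsub>Y\<^esub> y) \<in> base_change_rels"
    unfolding base_change_rels_def using s y by blast
  then have "tn (\<phi> s) y \<ominus>\<^bsub>EB\<^esub> tn \<one>\<^bsub>B\<^esub> (s \<odot>\<^bsub>Y\<^esub> y) \<in> base_change_rels"
    using s by (simp add: bc_phi)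
  then have "base_change_inc (s \<odot>\<^bsub>Y\<^esub> y) = base_change_rel K S B \<phi> Y +>\<^bsub>EB\<^esub> tn (\<phi> s) y"
    unfolding base_change_inc_def base_change_rel_eq using s y
    by (intro ext_quot_rel[OF bc, symmetric] bc_tens bc_phi Y.lsmult_closed) simp_all
  then show ?thesis
    using mod_homD(3)[OF base_change_proj bc_phi[OF s] bc_tens[OF B.one_closed y]]
      tn_eq[OF bc_phi[OF s] y] by (simp add: base_change_inc_def)
qed

text \<open>The hypothesis is the relation at \<open>b = 1\<close>. The general one follows because
  G is B-linear and \<open>b \<otimes> y\<close> is b times \<open>1 \<otimes> y\<close>.\<close>

lemma base_change_vanish:
  assumes N: "left_module B N" and G: "G \<in> mod_hom B EB N"
    and lin: "\<And>s y. s \<in> carrier S \<Longrightarrow> y \<in> carrier Y \<Longrightarrow>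
      G (tn \<one>\<^bsub>B\<^esub> (s \<odot>\<^bsub>Y\<^esub> y)) = \<phi> s \<odot>\<^bsub>N\<^esub> G (tn \<one>\<^bsub>B\<^esub> y)"
    and r: "r \<in> base_change_rels"
  shows "G r = \<zero>\<^bsub>N\<^esub>"
proof -
  interpret N: left_module B N by (rule N)
  obtain b s y where r: "r = tn (b \<otimes>\<^bsub>B\<^esub> \<phi> s) y \<ominus>\<^bsub>EB\<^esub> tn b (s \<odot>\<^bsub>Y\<^esub> y)"
    and b: "b \<in> carrier B" and s: "s \<in> carrier S" and y: "y \<in> carrier Y"
    using r unfolding base_change_rels_def by blast
  note sy = Y.lsmult_closed[OF s y] and ps = bc_phi[OF s]
  have Gt: "G (tn b y) = b \<odot>\<^bsub>N\<^esub> G (tn \<one>\<^bsub>B\<^esub> y)" if b: "b \<in> carrier B" and y: "y \<in> carrier Y" for b y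
    unfolding tn_eq[OF b y] by (rule mod_homD(3)[OF G b bc_tens[OF B.one_closed y]])
  have c: "G (tn \<one>\<^bsub>B\<^esub> y) \<in> carrier N" by (rule mod_homD(1)[OF G bc_tens[OF B.one_closed y]])
  have "G r = G (tn (b \<otimes>\<^bsub>B\<^esub> \<phi> s) y) \<ominus>\<^bsub>N\<^esub> G (tn b (s \<odot>\<^bsub>Y\<^esub> y))"
    unfolding r by (rule mod_hom_minus[OF EB.left_module_axioms N G]) (simp_all add: bc_tens b y ps sy)
  also have "G (tn b (s \<odot>\<^bsub>Y\<^esub> y)) = b \<odot>\<^bsub>N\<^esub> (\<phi> s \<odot>\<^bsub>N\<^esub> G (tn \<one>\<^bsub>B\<^esub> y))"
    unfolding Gt[OF b sy] lin[OF s y] ..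
  also have "\<dots> = G (tn (b \<otimes>\<^bsub>B\<^esub> \<phi> s) y)"
    unfolding Gt[OF B.m_closed[OF b ps] y] by (simp add: N.lsmult_assoc b ps c)
  also have "G (tn (b \<otimes>\<^bsub>B\<^esub> \<phi> s) y) \<ominus>\<^bsub>N\<^esub> G (tn (b \<otimes>\<^bsub>B\<^esub> \<phi> s) y) = \<zero>\<^bsub>N\<^esub>"
    by (rule left_module_minus_self[OF N mod_homD(1)[OF G]]) (simp add: bc_tens b ps y)
  finally show ?thesis .
qed

text \<open>Linearity of \<open>g\<close> along \<open>\<phi>\<close> is what remains of the base
  change relations after the B-linear extension of \<open>g\<close>, so the extension
  descends.\<close>

lemma base_change_lift:
  assumes N: "left_module B N" and g: "g \<in> mod_hom K (kmod S Y) (kmod B N)"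
    and lin: "\<And>s y. s \<in> carrier S \<Longrightarrow> y \<in> carrier Y \<Longrightarrow> g (s \<odot>\<^bsub>Y\<^esub> y) = \<phi> s \<odot>\<^bsub>N\<^esub> g y"
  obtains f where "f \<in> mod_hom B BY N" "\<And>y. y \<in> carrier Y \<Longrightarrow> f (base_change_inc y) = g y"
proof -
  define G where "G = tensor_lift K (kmod B N) (\<lambda>b y. b \<odot>\<^bsub>N\<^esub> g y)"
  have G: "G \<in> mod_hom B EB N"
    unfolding G_def by (rule extend_scalars_lift_mod_hom[OF B bc_Y N g])
  have Gi: "G (tn \<one>\<^bsub>B\<^esub> y) = g y" if "y \<in> carrier Y" for y
    using that extend_scalars_lift_inc[OF B bc_Y N g] by (simp add: G_def kmod_simps)
  have v: "G r = \<zero>\<^bsub>N\<^esub>" if "r \<in> base_change_rels" for r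
    by (rule base_change_vanish[OF N G _ that]) (simp add: Gi Y.lsmult_closed lin)
  note l = ext_quot_lift[OF bc N G v, folded BY_eq, folded base_change_rel_eq]
  show thesis
  proof
    show "(\<lambda>C. the_elem (G ` C)) \<in> mod_hom B BY N" by (rule l(1))
    show "the_elem (G ` base_change_inc y) = g y" if "y \<in> carrier Y" for y
      using l(2)[OF _ bc_tens[OF B.one_closed that]] Gi that by (simp add: base_change_inc_def)
  qed
qed

lemma base_change_ext:
  assumes N: "left_module B N" and f: "f \<in> mod_hom B BY N" and g: "g \<in> mod_hom B BY N"
    and eq: "\<And>y. y \<in> carrier Y \<Longrightarrow> f (base_change_inc y) = g (base_change_inc y)"
    and z: "z \<in> carrier BY"
  shows "f z = g z"
  by (rule ext_quot_ext[OF bc N, folded BY_eq, folded base_change_rel_eq, OF f g _ z])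
    (use eq in \<open>simp add: base_change_inc_def kmod_simps\<close>)

end

text \<open>The explicit formula is recognised as the lift of G, the projection after
  \<open>id \<otimes> f\<close>. Since \<open>f\<close> is S-linear, G respects the relations; the
  general lifting lemma then supplies linearity and the value on
  \<open>base_change_inc\<close>.\<close>

lemma base_change_map:
  fixes S :: "('k, 's) module" and B :: "('k, 'b) module" and Y :: "('s, 'y) module" and Y' :: "('s, 'z) module"
  assumes S: "k_algebra K S" and B: "k_algebra K B" and \<phi>: "\<phi> \<in> alg_hom K S B"
    and Y: "left_module S Y" and Y': "left_module S Y'" and f: "f \<in> mod_hom S Y Y'"
  shows base_change_map_mod_hom: "base_change_map K S B \<phi> Y' f \<in>
      mod_hom B (base_change K S B \<phi> Y) (base_change K S B \<phi> Y')"
    and base_change_map_inc: "\<And>y. y \<in> carrier Y \<Longrightarrow>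
      base_change_map K S B \<phi> Y' f (base_change_inc K S B \<phi> Y y) = base_change_inc K S B \<phi> Y' (f y)"
proof -
  let ?E = "extend_scalars K B (kmod S Y)" and ?E' = "extend_scalars K B (kmod S Y')"
    and ?Z' = "base_change K S B \<phi> Y'"
  interpret B: k_algebra K B by (rule B)
  interpret Y: left_module S Y by (rule Y)
  note a = S B \<phi> Y and a' = S B \<phi> Y'
  note YK = kmod_left_module[OF S Y] and YK' = kmod_left_module[OF S Y']
  note fk = mod_hom_kmod[OF S Y f]
  note m = tensor_map_extend_scalars[OF B YK YK' fk]
  note mt = tensor_map_tens[OF B.K.field_axioms B.left_module_K YK B.left_module_K YK' mod_hom_ident fk]
  define G where "G = (\<lambda>t. base_change_rel K S B \<phi> Y' +>\<^bsub>?E'\<^esub>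
     tensor_map K B (kmod S Y') (\<lambda>b. b) f t)"
  have G: "G \<in> mod_hom B (?E) (?Z')"
    unfolding G_def by (rule mod_hom_comp[OF m base_change_proj[OF a']])
  have Gi: "G (tens K B (kmod S Y) \<one>\<^bsub>B\<^esub> y) = base_change_inc K S B \<phi> Y' (f y)"
    if "y \<in> carrier Y" for y
    using that mt[of "\<one>\<^bsub>B\<^esub>" y] by (simp add: G_def base_change_inc_def[OF a'] kmod_simps)
  have v: "G r = \<zero>\<^bsub>?Z'\<^esub>" if "r \<in> base_change_rels K S B \<phi> Y" for r
    by (rule base_change_vanish[OF a base_change_left_module[OF a'] G _ that])
      (simp add: Gi Y.lsmult_closed mod_homD[OF f] base_change_inc_smult[OF a'])
  note l = ext_quot_lift[OF B YK base_change_rels_carrier[OF a] base_change_left_module[OF a'] G v,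
      folded base_change_rel_eq[OF a], folded base_change_def]
  have eq: "base_change_map K S B \<phi> Y' f = (\<lambda>C. the_elem (G ` C))"
    by (simp add: base_change_map_def quot_map_def[abs_def] G_def)
  show "base_change_map K S B \<phi> Y' f \<in> mod_hom B (base_change K S B \<phi> Y) (?Z')"
    unfolding eq by (rule l(1))
  show "base_change_map K S B \<phi> Y' f (base_change_inc K S B \<phi> Y y) = base_change_inc K S B \<phi> Y' (f y)"
    if "y \<in> carrier Y" for y
    unfolding eq base_change_inc_def[OF a] Gi[OF that, symmetric]
    using that tens_closed[OF B.K.field_axioms B.left_module_K YK]
    by (intro l(2)) (simp_all add: extend_scalars_simps[OF B YK] kmod_simps)
qed

text \<open>As for base change, the formula on representatives is recognised as the lift of a module
  map G. It descends because the pulled back universal map is balanced.\<close>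

lemma (in algebra_coalgebra) sw_mod_map:
  fixes M :: "('a, 'm) module" and X :: "('k, 'h, 'x) comodule"
    and M' :: "('a, 'n) module" and X' :: "('k, 'h, 'y) comodule"
  assumes M: "left_module A M" and X: "is_comodule K H X"
    and M': "left_module A M'" and X': "is_comodule K H X'"
    and f: "f \<in> mod_hom A M M'" and g: "g \<in> comod_hom K H X X'"
  shows sw_mod_map_mod_hom: "sw_mod_map K A H M' X' f g \<in> mod_hom S (sw_mod K A H M X) (sw_mod K A H M' X')"
    and sw_mod_map_inc: "\<And>m x. m \<in> carrier M \<Longrightarrow> x \<in> carrier X \<Longrightarrow>
      sw_mod_map K A H M' X' f g (sw_inc M X m x) = sw_inc M' X' (f m) (g x)"
proof -
  let ?Y' = "sw_mod K A H M' X'"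
  note a = M X and a' = M' X'
  note gk = comod_hom_mod_hom[OF g]
  note fk = mod_hom_kmod[OF A M f]
  note MK = sw_M_module[OF a] and XK = sw_X_module[OF a]
    and MK' = sw_M_module[OF a'] and XK' = sw_X_module[OF a']
  note fg = tensor_map_mod_hom[OF field_K MK XK MK' XK' fk gk]
  note fgt = tensor_map_tens[OF field_K MK XK MK' XK' fk gk]
  note m = tensor_map_extend_scalars[OF S_alg sw_MX_module[OF a] sw_MX_module[OF a'] fg, folded sw_free_def]
  note mt = tensor_map_tens[OF field_K S.left_module_K sw_MX_module[OF a] S.left_module_K sw_MX_module[OF a']
      mod_hom_ident fg]
  define G where "G = (\<lambda>t. sw_rel K A H M' X' +>\<^bsub>sw_free K A H M' X'\<^esub>
     tensor_map K S (tensor K (kmod A M') X') (\<lambda>s. s) (tensor_map K (kmod A M') X' f g) t)"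
  have G: "G \<in> mod_hom S (sw_free K A H M X) ?Y'"
    unfolding G_def by (rule mod_hom_comp[OF m sw_mod_proj[OF a']])
  have Gi: "G (sw_pure K A H M X \<one>\<^bsub>S\<^esub> m x) = sw_inc M' X' (f m) (g x)"
    if "m \<in> carrier M" "x \<in> carrier X" for m x
    using that tens_closed[OF field_K MK XK]
    by (simp add: G_def sw_inc_def[OF a'] sw_pure_def mt fgt kmod_simps)
  note ib = sw_inc_bilinear[OF a']
  \<comment> \<open>Here the compatibility of \<open>g\<close> with the coactions and the
    A-linearity of \<open>f\<close> are used.\<close>
  note inc_bal = balanced_precomp[OF X X' M M' S_alg sw_mod_left_module[OF a'] gen_bilinear
      ib sw_inc_balanced[OF a'] f g]
  have bal: "balanced K A M X S ?Y' (sw_gen K A H) (\<lambda>m x. G (sw_pure K A H M X \<one>\<^bsub>S\<^esub> m x))"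
    by (rule balanced_cong[OF X M S_alg sw_mod_left_module[OF a'] gen_bilinear
          bilinear_map_precomp[OF ib fk gk] inc_bal]) (simp add: Gi)
  note v = sw_free_hom_vanish[OF a sw_mod_left_module[OF a'] G bal]
  note l = ext_quot_lift[OF S_alg sw_MX_module[OF a] sw_mod_rels_carrier[OF a] sw_mod_left_module[OF a']
      G[unfolded sw_free_def[of K A H M X]] v, folded sw_free_def, folded sw_rel_eq[OF a], folded sw_mod_def]
  have eq: "sw_mod_map K A H M' X' f g = (\<lambda>C. the_elem (G ` C))"
    by (simp add: sw_mod_map_def quot_map_def[abs_def] G_def)
  show "sw_mod_map K A H M' X' f g \<in> mod_hom S (sw_mod K A H M X) ?Y'"
    unfolding eq by (rule l(1))
  show "sw_mod_map K A H M' X' f g (sw_inc M X m x) = sw_inc M' X' (f m) (g x)"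
    if mx: "m \<in> carrier M" "x \<in> carrier X" for m x
    unfolding eq sw_inc_def[OF a] Gi[OF that, symmetric]
    by (rule l(2)) (simp_all add: sw_pure_closed[OF a] mx)
qed

section \<open>The functor to modules over the target of a measuring\<close>

locale measuring = algebra_coalgebra K A H
  for K :: "('k, 'c) ring_scheme" and A :: "('k, 'a) module" and H :: "('k, 'h) coalgebra" +
  fixes B :: "('k, 'b) module" and \<rho> :: "'h \<Rightarrow> 'a \<Rightarrow> 'b"
  assumes B: "k_algebra K B" and \<rho>: "is_measuring K A B H \<rho>"
begin

sublocale B: k_algebra K B by (rule B)

abbreviation "sw_obj \<equiv> sw_functor K A B H \<rho>"
abbreviation "sw_map \<equiv> sw_functor_map K A B H \<rho>"
abbreviation "hom_obj \<equiv> hom_functor K A B H \<rho>"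
abbreviation "hom_map \<equiv> hom_functor_map K A B H \<rho>"
abbreviation "\<phi> \<equiv> sw_eval K A B H \<rho>"
text \<open>The measuring with its arguments in the order that \<open>balanced\<close> expects of
  \<open>\<gamma>\<close>.\<close>

abbreviation "act \<equiv> (\<lambda>a h. \<rho> h a)"

lemmas \<phi> = sw_eval_alg_hom[OF A H B \<rho>]
lemmas \<phi>_gen = sw_eval_gen[OF A H B \<rho>]
lemmas act_bilinear = measuring_bilinear[OF A H B \<rho>]

context
  fixes M :: "('a, 'm) module" and X :: "('k, 'h, 'x) comodule"
  assumes M: "left_module A M" and X: "is_comodule K H X"
begin

private abbreviation (input) "YMX \<equiv> sw_mod K A H M X"
private abbreviation (input) "Z \<equiv> sw_obj (M, X)"

private lemmas YMX_module = sw_mod_left_module[OF M X]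
private lemmas bcs = S_alg B \<phi> YMX_module

private lemma Z_eq: "Z = base_change K S B \<phi> YMX"
  by (simp add: sw_functor_def)

lemma sw_functor_left_module: "left_module B Z"
  unfolding Z_eq by (rule base_change_left_module[OF bcs])

text \<open>The class of \<open>1 \<otimes> (1 \<otimes> m \<otimes> x)\<close>, with the outer unit
  in B and the inner one in \<open>A \<triangleleft> H\<close>.\<close>

definition "univ_map = (\<lambda>m x. base_change_inc K S B \<phi> YMX (sw_inc M X m x))"

lemma univ_map_bilinear: "bilinear_map K (kmod A M) X (kmod B Z) univ_map"
  unfolding univ_map_def Z_eq
  by (rule bilinear_map_comp[OF sw_inc_bilinear[OF M X] base_change_inc_mod_hom[OF bcs]])

lemma univ_map_closed: "m \<in> carrier M \<Longrightarrow> x \<in> carrier X \<Longrightarrow> univ_map m x \<in> carrier Z"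
  using bilinear_mapD(3)[OF univ_map_bilinear] by (simp add: kmod_simps)

text \<open>\<open>sw_inc\<close> is balanced for \<open>sw_gen\<close>, and
  \<open>base_change_inc\<close> turns the action of \<open>sw_gen a h\<close> into that of its
  image \<open>\<rho> h a\<close> in B.\<close>

lemma univ_map_balanced: "balanced K A M X B Z act univ_map"
  unfolding univ_map_def Z_eq
  by (rule balanced_comp[OF X M S_alg YMX_module B base_change_left_module[OF bcs] gen_bilinear
        sw_inc_bilinear[OF M X] sw_inc_balanced[OF M X] base_change_inc_mod_hom[OF bcs]])
    (simp add: base_change_inc_smult[OF bcs] \<phi>_gen bilinear_mapD(3)[OF gen_bilinear])

text \<open>Extensionality for base change reduces the claim to \<open>sw_mod\<close>, and
  extensionality there to pairs (m, x).\<close>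

lemma sw_functor_ext:
  assumes N: "left_module B N" and f: "f \<in> mod_hom B Z N" and g: "g \<in> mod_hom B Z N"
    and eq: "\<And>m x. m \<in> carrier M \<Longrightarrow> x \<in> carrier X \<Longrightarrow> f (univ_map m x) = g (univ_map m x)"
    and z: "z \<in> carrier Z"
  shows "f z = g z"
proof (rule base_change_ext[OF bcs N, folded Z_eq, OF f g _ z])
  fix y assume y: "y \<in> carrier YMX"
  \<comment> \<open>To apply \<open>sw_mod_ext\<close>, the composite with
    \<open>base_change_inc\<close> must be linear over \<open>A \<triangleleft> H\<close>; it is so
    when N is regarded as a module along \<open>\<phi>\<close>.\<close>
  have r: "(\<lambda>y. f (base_change_inc K S B \<phi> YMX y)) \<in> mod_hom S YMX (restrict_scalars \<phi> N)"
    if f: "f \<in> mod_hom B Z N" for f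
  proof -
    have i: "base_change_inc K S B \<phi> YMX y \<in> carrier Z" if "y \<in> carrier YMX" for y
      using mod_homD(1)[OF base_change_inc_mod_hom[OF bcs]] that by (simp add: Z_eq kmod_simps)
    note im = mod_homD(2)[OF base_change_inc_mod_hom[OF bcs], unfolded kmod_simps, folded Z_eq]
    note ims = base_change_inc_smult[OF bcs, folded Z_eq]
    have p: "\<phi> s \<in> carrier B" if "s \<in> carrier S" for s by (rule mod_homD(1)[OF alg_homD(1)[OF \<phi>] that])
    show ?thesis
      by (rule mod_homI) (simp_all add: restrict_scalars_simps im ims mod_homD[OF f] i p)
  qed
  show "f (base_change_inc K S B \<phi> YMX y) = g (base_change_inc K S B \<phi> YMX y)"
    by (rule sw_mod_ext[OF M X restrict_scalars_left_module[OF S.A.ring_axioms alg_homD(2)[OF \<phi>] N]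
          r[OF f] r[OF g] _ y]) (simp add: eq[unfolded univ_map_def])
qed

text \<open>With N regarded as an \<open>A \<triangleleft> H\<close>-module, \<open>\<beta>\<close>
  lifts to the Sweedler product; this lift, being linear along \<open>\<phi>\<close>, lifts once
  more to the base change.\<close>

lemma sw_functor_lift:
  assumes N: "left_module B N" and \<beta>: "bilinear_map K (kmod A M) X (kmod B N) \<beta>"
    and bal: "balanced K A M X B N act \<beta>"
  obtains f where "f \<in> mod_hom B Z N"
    "\<And>m x. m \<in> carrier M \<Longrightarrow> x \<in> carrier X \<Longrightarrow> f (univ_map m x) = \<beta> m x"
proof -
  let ?R = "restrict_scalars \<phi> N"
  have R: "left_module S ?R"
    by (rule restrict_scalars_left_module[OF S.A.ring_axioms alg_homD(2)[OF \<phi>] N])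
  note mR = mod_hom_kmod_restrict_scalars[OF S_alg \<phi>]
  have \<beta>': "bilinear_map K (kmod A M) X (kmod S ?R) \<beta>"
    using \<beta> by (simp add: bilinear_map_def mR)
  \<comment> \<open>The identity of N serves as \<open>f\<close> in \<open>balanced_comp\<close>: it
    exchanges the action of \<open>\<rho> h a\<close> for that of \<open>sw_gen a h\<close>, which
    act alike because \<open>\<phi>\<close> maps one to the other.\<close>
  have "balanced K A M X S ?R (sw_gen K A H) (\<lambda>m x. (\<lambda>n. n) (\<beta> m x))"
    by (rule balanced_comp[OF X M B N S_alg R act_bilinear \<beta> bal])
      (simp_all add: mR mod_hom_ident restrict_scalars_simps \<phi>_gen)
  then obtain g where g: "g \<in> mod_hom S YMX ?R"
    and gi: "\<And>m x. m \<in> carrier M \<Longrightarrow> x \<in> carrier X \<Longrightarrow> g (sw_inc M X m x) = \<beta> m x"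
    using sw_mod_lift[OF M X R \<beta>'] by auto
  have gk: "g \<in> mod_hom K (kmod S YMX) (kmod B N)"
    using mod_hom_kmod[OF S_alg YMX_module g] by (simp add: mR)
  obtain f where f: "f \<in> mod_hom B Z N" "\<And>y. y \<in> carrier YMX \<Longrightarrow> f (base_change_inc K S B \<phi> YMX y) = g y"
    using base_change_lift[OF bcs N gk, folded Z_eq] mod_homD(3)[OF g]
    by (auto simp: restrict_scalars_simps)
  show thesis
    using bilinear_mapD(3)[OF sw_inc_bilinear[OF M X]]
    by (intro that[OF f(1)]) (simp add: univ_map_def f(2) gi kmod_simps)
qed

end

lemma sw_functor_map:
  fixes M :: "('a, 'm) module" and X :: "('k, 'h, 'x) comodule"
    and M' :: "('a, 'm) module" and X' :: "('k, 'h, 'x) comodule"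
  assumes M: "left_module A M" and X: "is_comodule K H X"
    and M': "left_module A M'" and X': "is_comodule K H X'"
    and f: "f \<in> mod_hom A M M'" and g: "g \<in> comod_hom K H X X'"
  shows sw_functor_map_Mod_hom: "sw_map (M, X) (M', X') (f, g) \<in>
      Mod_hom B (sw_obj (M, X)) (sw_obj (M', X'))"
    and sw_functor_map_univ: "\<And>m x. m \<in> carrier M \<Longrightarrow> x \<in> carrier X \<Longrightarrow>
      sw_map (M, X) (M', X') (f, g) (univ_map M X m x) = univ_map M' X' (f m) (g x)"
proof -
  note b = base_change_map[OF S_alg B \<phi> sw_mod_left_module[OF M X] sw_mod_left_module[OF M' X']
      sw_mod_map_mod_hom[OF M X M' X' f g]]
  have eq: "sw_map (M, X) (M', X') (f, g) =
     restrict (base_change_map K S B \<phi> (sw_mod K A H M' X') (sw_mod_map K A H M' X' f g))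
       (carrier (sw_obj (M, X)))"
    by (simp add: sw_functor_map_def)
  show "sw_map (M, X) (M', X') (f, g) \<in>
      Mod_hom B (sw_obj (M, X)) (sw_obj (M', X'))"
    unfolding eq using b(1)
    by (intro restrict_Mod_hom[OF sw_functor_left_module[OF M X]]) (simp add: sw_functor_def)
  show "sw_map (M, X) (M', X') (f, g) (univ_map M X m x) = univ_map M' X' (f m) (g x)"
    if mx: "m \<in> carrier M" "x \<in> carrier X" for m x
  proof -
    have "sw_inc M X m x \<in> carrier (sw_mod K A H M X)"
      using bilinear_mapD(3)[OF sw_inc_bilinear[OF M X], of m x] mx by (simp add: kmod_simps)
    then show ?thesis
      using univ_map_closed[OF M X mx]
      by (simp add: eq univ_map_def[OF M X] univ_map_def[OF M' X'] b(2) sw_mod_map_inc[OF M X M' X' f g mx])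
  qed
qed

end

section \<open>Associativity of tensor products and spaces of linear maps\<close>

context
  fixes K :: "('k, 'c) ring_scheme" and U :: "('k, 'u, 'd) module_scheme"
    and V :: "('k, 'v, 'e) module_scheme" and W :: "('k, 'w, 'f) module_scheme"
  assumes K: "field K" and U: "left_module K U" and V: "left_module K V" and W: "left_module K W"
begin

private lemmas UV = tensor_left_module[OF K U V]
private lemmas VW = tensor_left_module[OF K V W]
private lemmas UVW = tensor_left_module[OF K U VW]

interpretation UVW: left_module K "tensor K U (tensor K V W)" by (rule UVW)

private abbreviation (input) "T3 \<equiv> tensor K U (tensor K V W)"
private abbreviation (input) "tr u v w \<equiv> tens K U (tensor K V W) u (tens K V W v w)"

private abbreviation (input) "lift w \<equiv> tensor_lift K T3 (\<lambda>u v. tr u v w)"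

private lemmas b1 = tens_bilinear[OF K U VW]
private lemmas b2 = tens_bilinear[OF K V W]

lemma tensor_assoc_inner_bilinear:
  assumes w: "w \<in> carrier W"
  shows "bilinear_map K U V T3 (\<lambda>u v. tr u v w)"
  by (rule bilinear_map_precomp[OF b1 mod_hom_ident bilinear_mapD(2)[OF b2 w]])

private lemmas in_lift = tensor_lift_mod_hom[OF K U V UVW tensor_assoc_inner_bilinear]
private lemmas in_tens = tensor_lift_tens[OF K U V UVW tensor_assoc_inner_bilinear]

text \<open>Linearity in \<open>t\<close> is built into the inner lift. Linearity in
  \<open>w\<close> equates two linear maps in \<open>t\<close> and is checked on pure
  tensors.\<close>

lemma tensor_assoc_bilinear:
  "bilinear_map K (tensor K U V) W T3
     (\<lambda>t w. lift w t)"
proof -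
  interpret W: left_module K W by (rule W)
  interpret K: field K by (rule K)
  note bs = bilinear_mapD[OF b1] bilinear_mapD[OF b2]
  note m = mod_homD[OF in_lift]
  show ?thesis
  proof (rule bilinear_mapI)
    fix t w w' assume t: "t \<in> carrier (tensor K U V)" and w: "w \<in> carrier W" "w' \<in> carrier W"
    show "lift (w \<oplus>\<^bsub>W\<^esub> w') t =
      lift w t \<oplus>\<^bsub>T3\<^esub>
      lift w' t"
      by (rule tensor_ext[OF K U V UVW in_lift mod_hom_add[OF UV UVW in_lift in_lift] _ t])
        (simp_all add: w in_tens bs)
  next
    fix c t w assume c: "c \<in> carrier K" and t: "t \<in> carrier (tensor K U V)" and w: "w \<in> carrier W"
    show "lift (c \<odot>\<^bsub>W\<^esub> w) t =
      c \<odot>\<^bsub>T3\<^esub> lift w t"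
      by (rule tensor_ext[OF K U V UVW in_lift mod_hom_smult[OF K.is_cring UVW in_lift] _ t])
        (simp_all add: w c in_tens bs W.lsmult_closed)
  qed (simp_all add: m)
qed

lemma tensor_assoc_mod_hom:
  "tensor_assoc K U V W \<in> mod_hom K (tensor K (tensor K U V) W) T3"
  unfolding tensor_assoc_def by (rule tensor_lift_mod_hom[OF K UV W UVW tensor_assoc_bilinear])

lemma tensor_assoc_tens:
  "t \<in> carrier (tensor K U V) \<Longrightarrow> w \<in> carrier W \<Longrightarrow>
    tensor_assoc K U V W (tens K (tensor K U V) W t w) =
    lift w t"
  unfolding tensor_assoc_def by (rule tensor_lift_tens[OF K UV W UVW tensor_assoc_bilinear])

end

lemma hom_space_simps:
  "carrier (hom_space K V W) = Mod_hom K V W"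
  "zero (hom_space K V W) = (\<lambda>v\<in>carrier V. \<zero>\<^bsub>W\<^esub>)"
  "add (hom_space K V W) = (\<lambda>f g. \<lambda>v\<in>carrier V. f v \<oplus>\<^bsub>W\<^esub> g v)"
  by (simp_all add: hom_space_def)

lemma Mod_hom_extensionalityI:
  assumes "f \<in> Mod_hom R M N" "g \<in> Mod_hom R M N'" "\<And>x. x \<in> carrier M \<Longrightarrow> f x = g x"
  shows "f = g"
  using assms by (intro extensionalityI[of f "carrier M" g]) (auto simp: Mod_hom_def)

lemma hom_space_abelian_group:
  assumes K: "cring K" and V: "left_module K V" and W: "left_module K W"
  shows "abelian_group (hom_space K V W)"
proof -
  interpret K: cring K by fact
  interpret V: left_module K V by fact
  interpret W: left_module K W by fact
  have W_closed: "f v \<in> carrier W" if "f \<in> Mod_hom K V W" "v \<in> carrier V" for f v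
    using mod_homD(1)[OF Mod_homD[OF that(1)] that(2)] .
  have add: "(\<lambda>v\<in>carrier V. f v \<oplus>\<^bsub>W\<^esub> g v) \<in> Mod_hom K V W"
    if "f \<in> Mod_hom K V W" "g \<in> Mod_hom K V W" for f g
    by (rule restrict_Mod_hom[OF V mod_hom_add[OF V W]]) (simp_all add: that Mod_homD)
  have zero: "(\<lambda>v\<in>carrier V. \<zero>\<^bsub>W\<^esub>) \<in> Mod_hom K V W"
    by (rule restrict_Mod_hom[OF V]) (auto intro!: mod_homI simp: left_module_smult_zero[OF W])
  have ext: "f = (\<lambda>v\<in>carrier V. f v)" if "f \<in> Mod_hom K V W" for f
    using that by (intro extensionalityI[of _ "carrier V"]) (auto simp: Mod_hom_def)
  show ?thesis
  proof (rule abelian_groupI, unfold hom_space_simps)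
    fix f g h assume f: "f \<in> Mod_hom K V W" and g: "g \<in> Mod_hom K V W" and h: "h \<in> Mod_hom K V W"
    note c = W_closed[OF f] W_closed[OF g] W_closed[OF h]
    show "(\<lambda>v\<in>carrier V. (\<lambda>v\<in>carrier V. f v \<oplus>\<^bsub>W\<^esub> g v) v \<oplus>\<^bsub>W\<^esub> h v) =
      (\<lambda>v\<in>carrier V. f v \<oplus>\<^bsub>W\<^esub> (\<lambda>v\<in>carrier V. g v \<oplus>\<^bsub>W\<^esub> h v) v)"
      by (rule restrict_ext) (simp add: c W.M.a_assoc)
    show "(\<lambda>v\<in>carrier V. f v \<oplus>\<^bsub>W\<^esub> g v) = (\<lambda>v\<in>carrier V. g v \<oplus>\<^bsub>W\<^esub> f v)"
      by (rule restrict_ext) (simp add: c W.M.a_comm)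
    show "(\<lambda>v\<in>carrier V. f v \<oplus>\<^bsub>W\<^esub> g v) \<in> Mod_hom K V W" by (rule add[OF f g])
  next
    fix f assume f: "f \<in> Mod_hom K V W"
    note c = W_closed[OF f]
    show "(\<lambda>v\<in>carrier V. (\<lambda>v\<in>carrier V. \<zero>\<^bsub>W\<^esub>) v \<oplus>\<^bsub>W\<^esub> f v) = f"
      by (subst (2) ext[OF f]) (rule restrict_ext, simp add: c)
    \<comment> \<open>The negative of \<open>f\<close> is taken as the scalar multiple by -1, whose
      linearity is already known.\<close>
    have "(\<lambda>v\<in>carrier V. (\<ominus>\<^bsub>K\<^esub> \<one>\<^bsub>K\<^esub>) \<odot>\<^bsub>W\<^esub> f v) \<in> Mod_hom K V W"
      by (rule restrict_Mod_hom[OF V mod_hom_smult[OF K W Mod_homD[OF f]]]) simp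
    moreover have "(\<ominus>\<^bsub>K\<^esub> \<one>\<^bsub>K\<^esub>) \<odot>\<^bsub>W\<^esub> w \<oplus>\<^bsub>W\<^esub> w = \<zero>\<^bsub>W\<^esub>" if "w \<in> carrier W" for w
    proof -
      interpret Wm: module K W using W K by (simp add: module_iff_left_module)
      show ?thesis using that by (simp add: Wm.smult_l_minus W.M.l_neg)
    qed
    ultimately show "\<exists>g\<in>Mod_hom K V W. (\<lambda>v\<in>carrier V. g v \<oplus>\<^bsub>W\<^esub> f v) = (\<lambda>v\<in>carrier V. \<zero>\<^bsub>W\<^esub>)"
      by (intro bexI[of _ "\<lambda>v\<in>carrier V. (\<ominus>\<^bsub>K\<^esub> \<one>\<^bsub>K\<^esub>) \<odot>\<^bsub>W\<^esub> f v"] restrict_ext) (simp_all add: c)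
  qed (rule zero)
qed

lemma comodule_coact_mod_hom:
  assumes "is_comodule K H X"
  shows "coact X \<in> mod_hom K X (tensor K H X)"
  using assms by (simp add: is_comodule_def)

context measuring
begin

section \<open>The A-module \<open>[X, N]\<close> and its evaluation map\<close>

context
  fixes X :: "('k, 'h, 'x) comodule" and N :: "('b, 'n) module"
  assumes X: "is_comodule K H X" and N: "left_module B N"
begin

private abbreviation (input) "Hom \<equiv> hom_obj (X, N)"
text \<open>The linear map \<open>h \<otimes> y \<mapsto> \<rho> h a \<odot> \<nu> y\<close> on all
  of \<open>H \<otimes> X\<close>; the action on \<open>[X, N]\<close> is this map after the
  coaction. With the coaction split off, identities between actions can be tested on pure
  tensors.\<close>

private abbreviation (input) "L a \<nu> \<equiv> tensor_lift K (kmod B N) (\<lambda>x1 x0. \<rho> x1 a \<odot>\<^bsub>N\<^esub> \<nu> x0)"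

interpretation N: left_module B N by (rule N)

private lemmas XK = comodule_left_module[OF X]
private lemmas NK = kmod_left_module[OF B N]
private lemmas HX = tensor_left_module[OF field_K H_module XK]
private lemmas coact_c = coact_closed[OF X]
private lemmas act_b = bilinear_mapD[OF act_bilinear]

interpretation NK: left_module K "kmod B N" by (rule NK)

private lemma L_bilinear: "a \<in> carrier A \<Longrightarrow> \<nu> \<in> mod_hom K X (kmod B N) \<Longrightarrow>
  bilinear_map K H X (kmod B N) (\<lambda>x1 x0. \<rho> x1 a \<odot>\<^bsub>N\<^esub> \<nu> x0)"
  by (rule action_coact_bilinear[OF B N act_bilinear])

private lemmas L_hom = tensor_lift_mod_hom[OF field_K H_module XK NK L_bilinear]
private lemmas L_tens = tensor_lift_tens[OF field_K H_module XK NK L_bilinear]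

lemma hom_functor_simps:
  "carrier Hom = Mod_hom K X (kmod B N)" "zero Hom = (\<lambda>x\<in>carrier X. \<zero>\<^bsub>N\<^esub>)"
  "add Hom = (\<lambda>f g. \<lambda>x\<in>carrier X. f x \<oplus>\<^bsub>N\<^esub> g x)"
  "smult Hom = (\<lambda>a \<nu>. \<lambda>x\<in>carrier X. L a \<nu> (coact X x))"
  by (simp_all add: hom_functor_def hom_space_simps kmod_simps)

private lemma Lc_hom: "a \<in> carrier A \<Longrightarrow> \<nu> \<in> mod_hom K X (kmod B N) \<Longrightarrow>
  (\<lambda>x. L a \<nu> (coact X x)) \<in> mod_hom K X (kmod B N)"
  by (rule mod_hom_comp[OF comodule_coact_mod_hom[OF X] L_hom])

text \<open>The result of an action is a restricted function; this lemma removes the restriction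
  when actions or sums are nested under another action.\<close>

private lemma L_cong:
  assumes "a \<in> carrier A" "\<nu> \<in> mod_hom K X (kmod B N)" "\<And>x. x \<in> carrier X \<Longrightarrow> \<nu> x = \<mu> x"
    "t \<in> carrier (tensor K H X)"
  shows "L a \<mu> t = L a \<nu> t"
  by (rule tensor_lift_cong[OF field_K H_module XK NK L_bilinear[OF assms(1,2)] _ assms(4), symmetric])
    (simp add: assms(3))

private lemma counit_X_bilinear: "bilinear_map K H X X (\<lambda>h x. counit H h \<odot>\<^bsub>X\<^esub> x)"
proof -
  interpret XK: left_module K X by (rule XK)
  have "counit H \<in> mod_hom K H (self_module K)" using H by (simp add: is_coalgebra_def)
  then have c: "counit H h \<in> carrier K" "counit H (h \<oplus>\<^bsub>H\<^esub> h') = counit H h \<oplus>\<^bsub>K\<^esub> counit H h'"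
    "k \<in> carrier K \<Longrightarrow> counit H (k \<odot>\<^bsub>H\<^esub> h) = k \<otimes>\<^bsub>K\<^esub> counit H h"
    if "h \<in> carrier H" "h' \<in> carrier H" for h h' k
    using that by (auto simp: mod_hom_def self_module_def)
  show ?thesis
    by (rule bilinear_mapI) (simp_all add: c XK.lsmult_closed XK.lsmult_l_distr XK.lsmult_r_distr
        A.K.m_comm flip: XK.lsmult_assoc)
qed

text \<open>The unit axiom of the measuring replaces \<open>\<rho> h\<close> at the unit by the
  counit of h, and the counit axiom of X collapses the sum.\<close>

private lemma L_one:
  assumes \<nu>: "\<nu> \<in> mod_hom K X (kmod B N)" and x: "x \<in> carrier X"
  shows "L \<one>\<^bsub>A\<^esub> \<nu> (coact X x) = \<nu> x"
proof -
  have one: "\<rho> h \<one>\<^bsub>A\<^esub> = counit H h \<odot>\<^bsub>B\<^esub> \<one>\<^bsub>B\<^esub>" if "h \<in> carrier H" for h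
    using \<rho> that by (simp add: is_measuring_def)
  have "\<nu> x = \<nu> (tensor_lift K X (\<lambda>h y. counit H h \<odot>\<^bsub>X\<^esub> y) (coact X x))"
    using X x by (simp add: is_comodule_def)
  also have "\<dots> = tensor_lift K (kmod B N) (\<lambda>h y. \<nu> (counit H h \<odot>\<^bsub>X\<^esub> y)) (coact X x)"
    by (rule tensor_lift_comp[OF field_K H_module XK XK NK counit_X_bilinear \<nu> coact_c[OF x]])
  also have "\<dots> = L \<one>\<^bsub>A\<^esub> \<nu> (coact X x)"
    by (rule tensor_lift_cong[OF field_K H_module XK NK bilinear_map_comp[OF counit_X_bilinear \<nu>] _ coact_c[OF x]])
      (simp add: mod_homD(3)[OF \<nu>] counit_closed[OF A H] one kmod_simps)
  finally show ?thesis ..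
qed

text \<open>Acting twice involves the iterated coaction through \<open>coact X\<close>.
  Coassociativity rewrites it through \<open>comult H\<close>, where the product rule of the
  measuring recombines the two actions into one.\<close>

private lemma L_mult:
  assumes a: "a \<in> carrier A" "a' \<in> carrier A" and \<nu>: "\<nu> \<in> mod_hom K X (kmod B N)" and x: "x \<in> carrier X"
  shows "L (a \<otimes>\<^bsub>A\<^esub> a') \<nu> (coact X x) = L a (\<lambda>x. L a' \<nu> (coact X x)) (coact X x)"
proof -
  note HH = tensor_left_module[OF field_K H_module H_module]
  note HHX = tensor_left_module[OF field_K H_module HX]
  note l' = L_hom[OF a(2) \<nu>]
  have cm: "comult H \<in> mod_hom K H (tensor K H H)" using H by (simp add: is_coalgebra_def)
  have bl: "bilinear_map K H (tensor K H X) (kmod B N) (\<lambda>h s. \<rho> h a \<odot>\<^bsub>N\<^esub> L a' \<nu> s)"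
    by (rule action_coact_bilinear[OF B N act_bilinear a(1) l'])
  \<comment> \<open>On pure tensors \<open>u \<otimes> (v \<otimes> y)\<close> this is the action of
    \<open>\<rho> u a\<close> and \<open>\<rho> v a'\<close> on \<open>\<nu> y\<close>; it evaluates
    both forms of the iterated coaction.\<close>
  define \<Psi> where "\<Psi> = tensor_lift K (kmod B N) (\<lambda>h s. \<rho> h a \<odot>\<^bsub>N\<^esub> L a' \<nu> s)"
  have \<Psi>: "\<Psi> \<in> mod_hom K (tensor K H (tensor K H X)) (kmod B N)"
    unfolding \<Psi>_def by (rule tensor_lift_mod_hom[OF field_K H_module HX NK bl])
  have \<Psi>t: "\<Psi> (tens K H (tensor K H X) h s) = \<rho> h a \<odot>\<^bsub>N\<^esub> L a' \<nu> s"
    if "h \<in> carrier H" "s \<in> carrier (tensor K H X)" for h s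
    unfolding \<Psi>_def by (rule tensor_lift_tens[OF field_K H_module HX NK bl that])
  have "L a (\<lambda>x. L a' \<nu> (coact X x)) (coact X x) =
      \<Psi> (tensor_map K H (tensor K H X) (\<lambda>h. h) (coact X) (coact X x))"
    unfolding \<Psi>_def
    by (rule tensor_lift_tensor_map[OF field_K H_module XK H_module HX mod_hom_ident
          comodule_coact_mod_hom[OF X] NK bl coact_c[OF x], symmetric])
  \<comment> \<open>Coassociativity of the coaction of X.\<close>
  also have "\<dots> = \<Psi> (tensor_assoc K H H X (tensor_map K (tensor K H H) X (comult H) (\<lambda>y. y) (coact X x)))"
    using X x by (simp add: is_comodule_def)
  also have "\<dots> = L (a \<otimes>\<^bsub>A\<^esub> a') \<nu> (coact X x)"
  \<comment> \<open>What remains is linear in the coaction of x, so that element may be replaced by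
    a pure tensor \<open>h \<otimes> y\<close>.\<close>
  proof (rule tensor_ext[OF field_K H_module XK NK
        mod_hom_comp[OF mod_hom_comp[OF tensor_map_mod_hom[OF field_K H_module XK HH XK cm mod_hom_ident]
            tensor_assoc_mod_hom[OF field_K H_module H_module XK]] \<Psi>] L_hom[OF _ \<nu>] _ coact_c[OF x]])
    show "a \<otimes>\<^bsub>A\<^esub> a' \<in> carrier A" using a by simp
    fix h y assume h: "h \<in> carrier H" and y: "y \<in> carrier X"
    note ch = mod_homD(1)[OF cm h]
    have \<nu>y: "\<nu> y \<in> carrier N" using mod_homD(1)[OF \<nu> y] by (simp add: kmod_simps)
    have ay: "(\<lambda>b. b \<odot>\<^bsub>N\<^esub> \<nu> y) \<in> mod_hom K B (kmod B N)"
      by (rule bilinear_mapD(2)[OF action_bilinear[OF B N]]) (simp add: \<nu>y kmod_simps)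
    note ib = tensor_assoc_inner_bilinear[OF field_K H_module H_module XK y]
    have rb: "bilinear_map K H H B (\<lambda>h2 h1. \<rho> h2 a \<otimes>\<^bsub>B\<^esub> \<rho> h1 a')"
      by (rule bilinear_map_mult[OF B act_b(1)[OF a(1)] act_b(1)[OF a(2)]])
    have "\<Psi> (tensor_assoc K H H X (tensor_map K (tensor K H H) X (comult H) (\<lambda>y. y) (tens K H X h y))) =
       \<Psi> (tensor_assoc K H H X (tens K (tensor K H H) X (comult H h) y))"
      using tensor_map_tens[OF field_K H_module XK HH XK cm mod_hom_ident h y] by simp
    also have "\<dots> = \<Psi> (tensor_lift K (tensor K H (tensor K H X))
        (\<lambda>u v. tens K H (tensor K H X) u (tens K H X v y)) (comult H h))"
      unfolding tensor_assoc_tens[OF field_K H_module H_module XK ch y] ..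
    also have "\<dots> = tensor_lift K (kmod B N)
        (\<lambda>u v. \<Psi> (tens K H (tensor K H X) u (tens K H X v y))) (comult H h)"
      by (rule tensor_lift_comp[OF field_K H_module H_module HHX NK ib \<Psi> ch])
    also have "\<dots> = tensor_lift K (kmod B N) (\<lambda>u v. (\<rho> u a \<otimes>\<^bsub>B\<^esub> \<rho> v a') \<odot>\<^bsub>N\<^esub> \<nu> y) (comult H h)"
      by (rule tensor_lift_cong[OF field_K H_module H_module NK bilinear_map_comp[OF ib \<Psi>] _ ch])
        (simp add: \<Psi>t tens_closed[OF field_K H_module XK] y L_tens[OF a(2) \<nu>] N.lsmult_assoc \<nu>y act_b(3) a)
    also have "\<dots> = tensor_lift K B (\<lambda>u v. \<rho> u a \<otimes>\<^bsub>B\<^esub> \<rho> v a') (comult H h) \<odot>\<^bsub>N\<^esub> \<nu> y"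
      by (rule tensor_lift_comp[OF field_K H_module H_module B.left_module_K NK rb ay ch, symmetric])
    \<comment> \<open>The product rule of the measuring; the first tensor factor of
      \<open>comult H h\<close> is the one that acts on a, in agreement with the order of the nested
      actions.\<close>
    also have "\<dots> = \<rho> h (a \<otimes>\<^bsub>A\<^esub> a') \<odot>\<^bsub>N\<^esub> \<nu> y"
      using \<rho> a h by (simp add: is_measuring_def)
    also have "\<dots> = L (a \<otimes>\<^bsub>A\<^esub> a') \<nu> (tens K H X h y)"
      using a by (simp add: L_tens[OF _ \<nu> h y])
    finally show "\<Psi> (tensor_assoc K H H X (tensor_map K (tensor K H H) X (comult H) (\<lambda>y. y) (tens K H X h y))) =
      L (a \<otimes>\<^bsub>A\<^esub> a') \<nu> (tens K H X h y)" .
  qed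
  finally show ?thesis ..
qed

lemma hom_functor_left_module: "left_module A Hom"
proof (rule left_moduleI[OF A.A.ring_axioms])
  show "abelian_group Hom"
    unfolding hom_functor_def
    using with_action_abelian_group[OF hom_space_abelian_group[OF A.K.is_cring XK NK]] by simp
next
  fix a \<nu> assume a: "a \<in> carrier A" and \<nu>: "\<nu> \<in> carrier Hom"
  show "a \<odot>\<^bsub>Hom\<^esub> \<nu> \<in> carrier Hom"
    using \<nu> unfolding hom_functor_simps
    by (intro restrict_Mod_hom[OF XK] Lc_hom[OF a]) (rule Mod_homD)
next
  fix a b \<nu> assume a: "a \<in> carrier A" and b: "b \<in> carrier A" and \<nu>: "\<nu> \<in> carrier Hom"
  have \<nu>h: "\<nu> \<in> mod_hom K X (kmod B N)" using \<nu> unfolding hom_functor_simps by (rule Mod_homD)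
  have \<nu>c: "y \<in> carrier X \<Longrightarrow> \<nu> y \<in> carrier N" for y using mod_homD(1)[OF \<nu>h] by (simp add: kmod_simps)
  \<comment> \<open>The law is proved for every t, since the coaction of x need not be a pure
    tensor, and only then specialised to it.\<close>
  have "L (a \<oplus>\<^bsub>A\<^esub> b) \<nu> t = L a \<nu> t \<oplus>\<^bsub>kmod B N\<^esub> L b \<nu> t" if t: "t \<in> carrier (tensor K H X)" for t
    by (rule tensor_ext[OF field_K H_module XK NK L_hom[OF A.A.a_closed[OF a b] \<nu>h]
          mod_hom_add[OF HX NK L_hom[OF a \<nu>h] L_hom[OF b \<nu>h]] _ t])
      (simp add: L_tens \<nu>h a b \<nu>c kmod_simps act_b N.lsmult_l_distr)
  then show "(a \<oplus>\<^bsub>A\<^esub> b) \<odot>\<^bsub>Hom\<^esub> \<nu> = a \<odot>\<^bsub>Hom\<^esub> \<nu> \<oplus>\<^bsub>Hom\<^esub> b \<odot>\<^bsub>Hom\<^esub> \<nu>"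
    unfolding hom_functor_simps by (intro restrict_ext) (simp add: coact_c kmod_simps)
  show "(a \<otimes>\<^bsub>A\<^esub> b) \<odot>\<^bsub>Hom\<^esub> \<nu> = a \<odot>\<^bsub>Hom\<^esub> (b \<odot>\<^bsub>Hom\<^esub> \<nu>)"
    unfolding hom_functor_simps
  proof (rule restrict_ext)
    fix x assume x: "x \<in> carrier X"
    have "L a (\<lambda>x\<in>carrier X. L b \<nu> (coact X x)) (coact X x) = L a (\<lambda>x. L b \<nu> (coact X x)) (coact X x)"
      by (rule L_cong[OF a Lc_hom[OF b \<nu>h] _ coact_c[OF x]]) simp
    then show "L (a \<otimes>\<^bsub>A\<^esub> b) \<nu> (coact X x) = L a (\<lambda>x\<in>carrier X. L b \<nu> (coact X x)) (coact X x)"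
      by (simp only: L_mult[OF a b \<nu>h x])
  qed
next
  fix a \<mu> \<nu> assume a: "a \<in> carrier A" and \<mu>: "\<mu> \<in> carrier Hom" and \<nu>: "\<nu> \<in> carrier Hom"
  have \<mu>h: "\<mu> \<in> mod_hom K X (kmod B N)" using \<mu> unfolding hom_functor_simps by (rule Mod_homD)
  have \<nu>h: "\<nu> \<in> mod_hom K X (kmod B N)" using \<nu> unfolding hom_functor_simps by (rule Mod_homD)
  note s = mod_hom_add[OF XK NK \<mu>h \<nu>h, unfolded kmod_simps(3)]
  have c: "y \<in> carrier X \<Longrightarrow> \<nu> y \<in> carrier N" "y \<in> carrier X \<Longrightarrow> \<mu> y \<in> carrier N" for y
    using mod_homD(1)[OF \<nu>h] mod_homD(1)[OF \<mu>h] by (simp_all add: kmod_simps)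
  have "L a (\<lambda>x. \<mu> x \<oplus>\<^bsub>N\<^esub> \<nu> x) t = L a \<mu> t \<oplus>\<^bsub>kmod B N\<^esub> L a \<nu> t" if t: "t \<in> carrier (tensor K H X)" for t
    by (rule tensor_ext[OF field_K H_module XK NK L_hom[OF a s]
          mod_hom_add[OF HX NK L_hom[OF a \<mu>h] L_hom[OF a \<nu>h]] _ t])
      (simp add: L_tens s \<mu>h \<nu>h a c kmod_simps act_b N.lsmult_r_distr)
  then show "a \<odot>\<^bsub>Hom\<^esub> (\<mu> \<oplus>\<^bsub>Hom\<^esub> \<nu>) = a \<odot>\<^bsub>Hom\<^esub> \<mu> \<oplus>\<^bsub>Hom\<^esub> a \<odot>\<^bsub>Hom\<^esub> \<nu>"
    unfolding hom_functor_simps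
  proof (intro restrict_ext)
    fix x assume L: "\<And>t. t \<in> carrier (tensor K H X) \<Longrightarrow>
        L a (\<lambda>x. \<mu> x \<oplus>\<^bsub>N\<^esub> \<nu> x) t = L a \<mu> t \<oplus>\<^bsub>kmod B N\<^esub> L a \<nu> t"
      and x: "x \<in> carrier X"
    have "L a (\<lambda>x\<in>carrier X. \<mu> x \<oplus>\<^bsub>N\<^esub> \<nu> x) (coact X x) = L a (\<lambda>x. \<mu> x \<oplus>\<^bsub>N\<^esub> \<nu> x) (coact X x)"
      by (rule L_cong[OF a s _ coact_c[OF x]]) simp
    then show "L a (\<lambda>x\<in>carrier X. \<mu> x \<oplus>\<^bsub>N\<^esub> \<nu> x) (coact X x) =
      (\<lambda>x\<in>carrier X. L a \<mu> (coact X x)) x \<oplus>\<^bsub>N\<^esub> (\<lambda>x\<in>carrier X. L a \<nu> (coact X x)) x"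
      using L[OF coact_c[OF x]] x by (simp add: kmod_simps)
  qed
next
  fix \<nu> assume \<nu>: "\<nu> \<in> carrier Hom"
  have \<nu>h: "\<nu> \<in> Mod_hom K X (kmod B N)" using \<nu> unfolding hom_functor_simps .
  show "\<one>\<^bsub>A\<^esub> \<odot>\<^bsub>Hom\<^esub> \<nu> = \<nu>"
    unfolding hom_functor_simps using \<nu>h
    by (intro extensionalityI[of _ "carrier X"]) (auto simp: Mod_hom_def L_one)
qed

text \<open>The point is homogeneity in \<open>\<nu>\<close>: in \<open>kmod A Hom\<close> a scalar
  c acts as \<open>c \<odot> \<one>\<close> of A, and this has to be recognised as the pointwise
  multiple. Linearity of the measuring in a extracts c, and \<open>L_one\<close> removes the
  unit.\<close>

lemma eval_bilinear: "bilinear_map K (kmod A Hom) X (kmod B N) (\<lambda>\<nu> x. \<nu> x)"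
proof (rule bilinear_mapI)
  fix c \<nu> x assume c: "c \<in> carrier K" and \<nu>: "\<nu> \<in> carrier (kmod A Hom)" and x: "x \<in> carrier X"
  have \<nu>h: "\<nu> \<in> mod_hom K X (kmod B N)" using \<nu> unfolding hom_functor_simps kmod_simps by (rule Mod_homD)
  have \<nu>c: "y \<in> carrier X \<Longrightarrow> \<nu> y \<in> carrier (kmod B N)" for y using mod_homD(1)[OF \<nu>h] .
  note ab = bilinear_mapD[OF action_bilinear[OF B N]]
  have "L (c \<odot>\<^bsub>A\<^esub> \<one>\<^bsub>A\<^esub>) \<nu> (coact X x) = c \<odot>\<^bsub>kmod B N\<^esub> L \<one>\<^bsub>A\<^esub> \<nu> (coact X x)"
    by (rule tensor_ext[OF field_K H_module XK NK L_hom[OF _ \<nu>h]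
          mod_hom_smult[OF A.K.is_cring NK L_hom[OF _ \<nu>h] c] _ coact_c[OF x]])
      (simp_all add: c L_tens[OF _ \<nu>h] act_b \<nu>c ab)
  then show "(c \<odot>\<^bsub>kmod A Hom\<^esub> \<nu>) x = c \<odot>\<^bsub>kmod B N\<^esub> \<nu> x"
    using x L_one[OF \<nu>h x] by (simp add: kmod_simps hom_functor_simps)
  show "\<nu> (c \<odot>\<^bsub>X\<^esub> x) = c \<odot>\<^bsub>kmod B N\<^esub> \<nu> x" by (rule mod_homD(3)[OF \<nu>h c x])
qed (auto simp: kmod_simps hom_functor_simps Mod_hom_def mod_hom_def)

lemma eval_balanced: "balanced K A Hom X B N act (\<lambda>\<nu> x. \<nu> x)"
  by (simp add: balanced_def hom_functor_simps)

context
  fixes M :: "('a, 'm) module"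
  assumes M: "left_module A M"
begin

interpretation M: left_module A M by (rule M)

lemma uncurry_bilinear:
  assumes "\<theta> \<in> mod_hom A M Hom"
  shows "bilinear_map K (kmod A M) X (kmod B N) (\<lambda>m x. \<theta> m x)"
  by (rule bilinear_map_precomp[OF eval_bilinear mod_hom_kmod[OF A M assms] mod_hom_ident])

lemma uncurry_balanced:
  assumes \<theta>: "\<theta> \<in> mod_hom A M Hom"
  shows "balanced K A M X B N act (\<lambda>m x. \<theta> m x)"
  using mod_homD(3)[OF \<theta>] by (simp add: balanced_def hom_functor_simps)

lemma curry_Mod_hom:
  assumes \<beta>: "bilinear_map K (kmod A M) X (kmod B N) \<beta>" and bal: "balanced K A M X B N act \<beta>"
  shows "(\<lambda>m\<in>carrier M. \<lambda>x\<in>carrier X. \<beta> m x) \<in> Mod_hom A M Hom"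
proof (rule restrict_Mod_hom[OF M mod_homI])
  note b = bilinear_mapD[OF \<beta>, unfolded kmod_simps]
  have bm: "\<beta> m \<in> mod_hom K X (kmod B N)" if "m \<in> carrier M" for m
    by (rule bilinear_mapD(1)[OF \<beta>]) (simp add: that kmod_simps)
  show "(\<lambda>x\<in>carrier X. \<beta> m x) \<in> carrier Hom" if "m \<in> carrier M" for m
    unfolding hom_functor_simps by (rule restrict_Mod_hom[OF XK bm[OF that]])
  show "(\<lambda>x\<in>carrier X. \<beta> (m \<oplus>\<^bsub>M\<^esub> m') x) = (\<lambda>x\<in>carrier X. \<beta> m x) \<oplus>\<^bsub>Hom\<^esub> (\<lambda>x\<in>carrier X. \<beta> m' x)"
    if "m \<in> carrier M" "m' \<in> carrier M" for m m'
    unfolding hom_functor_simps using that by (intro restrict_ext) (simp add: b)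
  show "(\<lambda>x\<in>carrier X. \<beta> (a \<odot>\<^bsub>M\<^esub> m) x) = a \<odot>\<^bsub>Hom\<^esub> (\<lambda>x\<in>carrier X. \<beta> m x)"
    if a: "a \<in> carrier A" and m: "m \<in> carrier M" for a m
    unfolding hom_functor_simps
  proof (rule restrict_ext)
    fix x assume x: "x \<in> carrier X"
    \<comment> \<open>The curried map produces restricted functions, while the balanced identity
      speaks of \<open>\<beta> m\<close> itself.\<close>
    have "L a (\<lambda>x\<in>carrier X. \<beta> m x) (coact X x) = L a (\<beta> m) (coact X x)"
      by (rule L_cong[OF a bm[OF m] _ coact_c[OF x]]) simp
    then show "\<beta> (a \<odot>\<^bsub>M\<^esub> m) x = L a (\<lambda>x\<in>carrier X. \<beta> m x) (coact X x)"
      using bal a m x by (simp only: balanced_def)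
  qed
qed

end

end

end

section \<open>Categories of modules and comodules\<close>

lemma Mod_hom_closed: "f \<in> Mod_hom R M N \<Longrightarrow> x \<in> carrier M \<Longrightarrow> f x \<in> carrier N"
  by (rule mod_homD(1)[OF Mod_homD])

lemma compose_Mod_hom:
  assumes "left_module R L" "f \<in> Mod_hom R L M" "g \<in> Mod_hom R M N"
  shows "compose (carrier L) g f \<in> Mod_hom R L N"
  unfolding compose_def
  by (rule restrict_Mod_hom[OF assms(1) mod_hom_comp[OF assms(2,3)[THEN Mod_homD]]])

text \<open>Because \<open>f\<close> is extensional, both sides are \<open>undefined\<close> outside
  C; the identity laws hold as equalities of functions.\<close>

lemma compose_ident:
  assumes "f \<in> extensional C" "\<And>x. x \<in> C \<Longrightarrow> f x \<in> D"
  shows "compose C f (\<lambda>x\<in>C. x) = f" "compose C (\<lambda>x\<in>D. x) f = f"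
  using assms by (auto simp: compose_def extensional_def fun_eq_iff)

lemma compose_compose:
  assumes "\<And>x. x \<in> C \<Longrightarrow> f x \<in> D"
  shows "compose C (compose D h g) f = compose C h (compose C g f)"
  using assms by (auto simp: compose_def fun_eq_iff)

lemma Mod_cat_simps:
  "Obj (Mod_cat A) = {M. left_module A M}" "Arr (Mod_cat A) = Mod_hom A"
  "Ident (Mod_cat A) = (\<lambda>M. \<lambda>m\<in>carrier M. m)"
  "Comp (Mod_cat A) = (\<lambda>L M N g f. compose (carrier L) g f)"
  by (simp_all add: Mod_cat_def)

lemma Comod_cat_simps:
  "Obj (Comod_cat K H) = {X. is_comodule K H X}"
  "Arr (Comod_cat K H) = (\<lambda>X Y. comod_hom K H X Y \<inter> extensional (carrier X))"
  "Ident (Comod_cat K H) = (\<lambda>X. \<lambda>x\<in>carrier X. x)"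
  "Comp (Comod_cat K H) = (\<lambda>X Y Z g f. compose (carrier X) g f)"
  by (simp_all add: Comod_cat_def)

lemma Mod_cat_is_category:
  fixes A :: "('a, 'c) ring_scheme"
  shows "is_category (Mod_cat A :: (('a, 'm) module, 'm \<Rightarrow> 'm) category)"
proof -
  have "(\<lambda>m\<in>carrier M. m) \<in> Mod_hom A M M" if "left_module A M" for M :: "('a, 'm) module"
    by (rule restrict_Mod_hom[OF that mod_hom_ident])
  moreover have "compose (carrier M) f (\<lambda>m\<in>carrier M. m) = f \<and> compose (carrier M) (\<lambda>m\<in>carrier N. m) f = f"
    if "f \<in> Mod_hom A M N" for M N :: "('a, 'm) module" and f
    using that compose_ident[of f "carrier M" "carrier N"] Mod_hom_closed[OF that]
    by (simp add: Mod_hom_def)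
  moreover have "compose (carrier L) (compose (carrier M) h g) f = compose (carrier L) h (compose (carrier L) g f)"
    if "f \<in> Mod_hom A L M" for L M :: "('a, 'm) module" and f and g h :: "'m \<Rightarrow> 'm"
    by (rule compose_compose) (rule Mod_hom_closed[OF that])
  ultimately show ?thesis
    by (simp add: is_category_def Mod_cat_simps compose_Mod_hom)
qed

text \<open>\<open>id \<otimes> f\<close> depends only on the values of \<open>f\<close> on the
  carrier. This transfers the comodule condition to restricted identities and to
  \<open>compose\<close>.\<close>

lemma comod_hom_cong:
  assumes K: "field K" and H: "left_module K H" and X: "is_comodule K H X" and Y: "is_comodule K H Y"
    and f: "f \<in> comod_hom K H X Y" and eq: "\<And>x. x \<in> carrier X \<Longrightarrow> f x = g x"
  shows "g \<in> comod_hom K H X Y"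
proof -
  note XK = comodule_left_module[OF X] and YK = comodule_left_module[OF Y]
  note fm = comod_hom_mod_hom[OF f]
  have "tensor_map K H Y (\<lambda>h. h) f t = tensor_map K H Y (\<lambda>h. h) g t" if "t \<in> carrier (tensor K H X)" for t
    unfolding tensor_map_def
    by (rule tensor_lift_cong[OF K H XK tensor_left_module[OF K H YK]
          tensor_map_bilinear[OF K H XK H YK mod_hom_ident fm] _ that]) (simp add: eq)
  then show ?thesis
    using f mod_hom_cong[OF fm XK eq] eq coact_closed[OF X] by (simp add: comod_hom_def)
qed

lemma comod_hom_ident:
  assumes K: "field K" and H: "left_module K H" and X: "is_comodule K H X"
  shows "(\<lambda>x. x) \<in> comod_hom K H X X"
  using tensor_map_ident[OF K H comodule_left_module[OF X] coact_closed[OF X]]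
  by (simp add: comod_hom_def mod_hom_ident)

text \<open>Compatibility with the coactions follows from the composite of
  \<open>id \<otimes> f\<close> and \<open>id \<otimes> g\<close> being
  \<open>id \<otimes> (g \<circ> f)\<close>.\<close>

lemma comod_hom_comp:
  assumes K: "field K" and H: "left_module K H"
    and X: "is_comodule K H X" and Y: "is_comodule K H Y" and Z: "is_comodule K H Z"
    and f: "f \<in> comod_hom K H X Y" and g: "g \<in> comod_hom K H Y Z"
  shows "(\<lambda>x. g (f x)) \<in> comod_hom K H X Z"
proof -
  note XK = comodule_left_module[OF X] and YK = comodule_left_module[OF Y] and ZK = comodule_left_module[OF Z]
  note fm = comod_hom_mod_hom[OF f] and gm = comod_hom_mod_hom[OF g]
  have "tensor_map K H Z (\<lambda>h. h) g (tensor_map K H Y (\<lambda>h. h) f t) = tensor_map K H Z (\<lambda>h. h) (\<lambda>x. g (f x)) t"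
    if "t \<in> carrier (tensor K H X)" for t
    unfolding tensor_map_def[of K H Z]
    by (rule tensor_lift_tensor_map[OF K H XK H YK mod_hom_ident fm tensor_left_module[OF K H ZK]
          tensor_map_bilinear[OF K H YK H ZK mod_hom_ident gm] that])
  then show ?thesis
    using f g mod_hom_comp[OF fm gm] mod_homD(1)[OF fm] coact_closed[OF X]
    by (simp add: comod_hom_def)
qed

lemma Comod_cat_is_category:
  fixes H :: "('k, 'h) coalgebra"
  assumes K: "field K" and H: "left_module K H"
  shows "is_category (Comod_cat K H :: (('k, 'h, 'x) comodule, 'x \<Rightarrow> 'x) category)"
proof -
  have closed: "f x \<in> carrier Y" if "f \<in> comod_hom K H X Y" "x \<in> carrier X" for X Y :: "('k, 'h, 'x) comodule" and f x
    using that mod_homD(1)[of f K X Y] by (simp add: comod_hom_def)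
  have "(\<lambda>x\<in>carrier X. x) \<in> comod_hom K H X X" if "is_comodule K H X" for X :: "('k, 'h, 'x) comodule"
    by (rule comod_hom_cong[OF K H that that comod_hom_ident[OF K H that]]) simp
  moreover have "compose (carrier X) g f \<in> comod_hom K H X Z"
    if "is_comodule K H X" "is_comodule K H Y" "is_comodule K H Z"
      "f \<in> comod_hom K H X Y" "g \<in> comod_hom K H Y Z" for X Y Z :: "('k, 'h, 'x) comodule" and f g
    by (rule comod_hom_cong[OF K H that(1,3) comod_hom_comp[OF K H that]]) (simp add: compose_def)
  moreover have "compose (carrier X) f (\<lambda>x\<in>carrier X. x) = f \<and> compose (carrier X) (\<lambda>x\<in>carrier Y. x) f = f"
    if "f \<in> comod_hom K H X Y" "f \<in> extensional (carrier X)" for X Y :: "('k, 'h, 'x) comodule" and f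
    using compose_ident[OF that(2), where D = "carrier Y"] closed[OF that(1)] by simp
  moreover have "compose (carrier W) (compose (carrier X) h g) f = compose (carrier W) h (compose (carrier W) g f)"
    if "f \<in> comod_hom K H W X" for W X :: "('k, 'h, 'x) comodule" and f and g h :: "'x \<Rightarrow> 'x"
    by (rule compose_compose) (rule closed[OF that])
  ultimately show ?thesis
    by (auto simp: is_category_def Comod_cat_simps)
qed

lemma op_cat_is_category: "is_category C \<Longrightarrow> is_category (op_cat C)"
  by (simp add: is_category_def op_cat_def)

lemma prod_cat_is_category: "is_category C \<Longrightarrow> is_category D \<Longrightarrow> is_category (prod_cat C D)"
  unfolding is_category_def prod_cat_def by auto

section \<open>Functoriality and adjunction\<close>

context measuring
begin

text \<open>Both functor laws compare B-linear maps out of a Sweedler product, so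
  \<open>sw_functor_ext\<close> reduces them to \<open>univ_map m x\<close>, where the induced maps
  simply apply f and g to the two arguments.\<close>

lemma sw_functor_is_functor:
  "is_functor
     (prod_cat (Mod_cat A :: (('a, 'm) module, 'm \<Rightarrow> 'm) category)
               (Comod_cat K H :: (('k, 'h, 'x) comodule, 'x \<Rightarrow> 'x) category))
     (Mod_cat B) (sw_obj) (sw_map)"
  unfolding is_functor_def
proof (intro conjI ballI)
  let ?C = "prod_cat (Mod_cat A :: (('a, 'm) module, 'm \<Rightarrow> 'm) category)
     (Comod_cat K H :: (('k, 'h, 'x) comodule, 'x \<Rightarrow> 'x) category)"
  show C: "is_category ?C"
    by (intro prod_cat_is_category Mod_cat_is_category Comod_cat_is_category field_K H_module)
  show "is_category (Mod_cat B)" by (rule Mod_cat_is_category)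
  have Ob: "\<exists>M X. p = (M, X) \<and> left_module A M \<and> is_comodule K H X" if "p \<in> Obj ?C" for p
    using that by (auto simp: prod_cat_def Mod_cat_simps Comod_cat_simps)
  have Ar: "\<exists>f g. q = (f, g) \<and> f \<in> Mod_hom A M M' \<and> g \<in> comod_hom K H X X'"
    if "q \<in> Arr ?C (M, X) (M', X')" for q M M' X X'
    using that by (auto simp: prod_cat_def Mod_cat_simps Comod_cat_simps)
  fix p assume "p \<in> Obj ?C"
  then obtain M X where p: "p = (M, X)" and M: "left_module A M" and X: "is_comodule K H X"
    using Ob by blast
  show "sw_obj p \<in> Obj (Mod_cat B)"
    by (simp add: p Mod_cat_simps sw_functor_left_module[OF M X])
  have i: "Ident ?C p = (\<lambda>m\<in>carrier M. m, \<lambda>x\<in>carrier X. x)"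
    by (simp add: p prod_cat_def Mod_cat_simps Comod_cat_simps)
  have iM: "(\<lambda>m\<in>carrier M. m) \<in> mod_hom A M M"
    by (simp add: restrict_mod_hom[OF M] mod_hom_ident)
  have iX: "(\<lambda>x\<in>carrier X. x) \<in> comod_hom K H X X"
    by (rule comod_hom_cong[OF field_K H_module X X comod_hom_ident[OF field_K H_module X]]) simp
  note Z = sw_functor_left_module[OF M X]
  note iF = sw_functor_map_Mod_hom[OF M X M X iM iX]
  show "sw_map p p (Ident ?C p) = Ident (Mod_cat B) (sw_obj p)"
    unfolding i unfolding p Mod_cat_simps
  proof (rule Mod_hom_extensionalityI[OF iF restrict_Mod_hom[OF Z mod_hom_ident]])
    fix z assume z: "z \<in> carrier (sw_obj (M, X))"
    have "sw_map (M, X) (M, X) (\<lambda>m\<in>carrier M. m, \<lambda>x\<in>carrier X. x) z = z"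
      by (rule sw_functor_ext[OF M X Z Mod_homD[OF iF] mod_hom_ident _ z])
        (simp add: sw_functor_map_univ[OF M X M X iM iX])
    then show "sw_map (M, X) (M, X) (\<lambda>m\<in>carrier M. m, \<lambda>x\<in>carrier X. x) z = (\<lambda>m\<in>carrier (sw_obj (M, X)). m) z"
      using z by simp
  qed
  fix p' assume "p' \<in> Obj ?C"
  then obtain M' X' where p': "p' = (M', X')" and M': "left_module A M'" and X': "is_comodule K H X'"
    using Ob by blast
  fix q assume "q \<in> Arr ?C p p'"
  then obtain f g where q: "q = (f, g)" and f: "f \<in> Mod_hom A M M'" and g: "g \<in> comod_hom K H X X'"
    using Ar unfolding p p' by blast
  note fm = Mod_homD[OF f]
  note F = sw_functor_map_Mod_hom[OF M X M' X' fm g]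
  show "sw_map p p' q \<in> Arr (Mod_cat B) (sw_obj p) (sw_obj p')"
    using F by (simp add: p p' q Mod_cat_simps)
  fix p'' assume "p'' \<in> Obj ?C"
  then obtain M'' X'' where p'': "p'' = (M'', X'')" and M'': "left_module A M''" and X'': "is_comodule K H X''"
    using Ob by blast
  fix q' assume "q' \<in> Arr ?C p' p''"
  then obtain f' g' where q': "q' = (f', g')" and f': "f' \<in> Mod_hom A M' M''" and g': "g' \<in> comod_hom K H X' X''"
    using Ar unfolding p' p'' by blast
  note fm' = Mod_homD[OF f']
  note F' = sw_functor_map_Mod_hom[OF M' X' M'' X'' fm' g']
  have c: "Comp ?C p p' p'' q' q = (compose (carrier M) f' f, compose (carrier X) g' g)"
    by (simp add: p q q' prod_cat_def Mod_cat_simps Comod_cat_simps)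
  have ff: "compose (carrier M) f' f \<in> mod_hom A M M''"
    by (rule Mod_homD[OF compose_Mod_hom[OF M f f']])
  have gg: "compose (carrier X) g' g \<in> comod_hom K H X X''"
    by (rule comod_hom_cong[OF field_K H_module X X'' comod_hom_comp[OF field_K H_module X X' X'' g g']])
      (simp add: compose_def)
  note FF = sw_functor_map_Mod_hom[OF M X M'' X'' ff gg]
  show "sw_map p p'' (Comp ?C p p' p'' q' q) =
    Comp (Mod_cat B) (sw_obj p) (sw_obj p') (sw_obj p'') (sw_map p' p'' q') (sw_map p p' q)"
    unfolding c unfolding p p' p'' q q' Mod_cat_simps
  proof (rule Mod_hom_extensionalityI[OF FF compose_Mod_hom[OF Z F F']])
    fix z assume z: "z \<in> carrier (sw_obj (M, X))"
    have gX: "g x \<in> carrier X'" if "x \<in> carrier X" for x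
      by (rule mod_homD(1)[OF comod_hom_mod_hom[OF g] that])
    have "sw_map (M, X) (M'', X'') (compose (carrier M) f' f, compose (carrier X) g' g) z =
      sw_map (M', X') (M'', X'') (f', g') (sw_map (M, X) (M', X') (f, g) z)"
      by (rule sw_functor_ext[OF M X sw_functor_left_module[OF M'' X''] Mod_homD[OF FF]
            mod_hom_comp[OF Mod_homD[OF F] Mod_homD[OF F']] _ z])
        (simp add: sw_functor_map_univ[OF M X M'' X'' ff gg] sw_functor_map_univ[OF M X M' X' fm g]
          sw_functor_map_univ[OF M' X' M'' X'' fm' g'] mod_homD(1)[OF fm] gX compose_eq)
    then show "sw_map (M, X) (M'', X'') (compose (carrier M) f' f, compose (carrier X) g' g) z =
      compose (carrier (sw_obj (M, X))) (sw_map (M', X') (M'', X'') (f', g')) (sw_map (M, X) (M', X') (f, g)) z"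
      using z by (simp add: compose_def)
  qed
qed

text \<open>Take \<open>[X, N]\<close> itself as M. Evaluation, precomposed with g in the comodule
  variable and followed by h, is again balanced; currying it yields exactly this map.\<close>

lemma hom_functor_map_Mod_hom:
  fixes X X' :: "('k, 'h, 'x) comodule" and N N' :: "('b, 'n) module"
  assumes X: "is_comodule K H X" and X': "is_comodule K H X'"
    and N: "left_module B N" and N': "left_module B N'"
    and g: "g \<in> comod_hom K H X' X" and h: "h \<in> mod_hom B N N'"
  shows "hom_map (X, N) (X', N') (g, h) \<in>
    Mod_hom A (hom_obj (X, N)) (hom_obj (X', N'))"
proof -
  let ?M = "hom_obj (X, N)"
  note M = hom_functor_left_module[OF X N]
  note gm = comod_hom_mod_hom[OF g]
  note b = eval_bilinear[OF X N] and bal = eval_balanced[OF X N]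
  note b1 = bilinear_map_precomp[OF b mod_hom_ident gm]
  note bal1 = balanced_precomp[OF X' X M M B N act_bilinear b bal mod_hom_ident g]
  note b2 = bilinear_map_comp[OF b1 mod_hom_kmod[OF B N h]]
  have bal2: "balanced K A ?M X' B N' act (\<lambda>\<nu> x. h (\<nu> (g x)))"
    by (rule balanced_comp[OF X' M B N B N' act_bilinear b1 bal1 mod_hom_kmod[OF B N h]])
      (simp add: mod_homD(3)[OF h] bilinear_mapD(3)[OF act_bilinear])
  show ?thesis
    using curry_Mod_hom[OF X' N' M b2 bal2] by (simp add: hom_functor_map_def)
qed

lemma hom_functor_map_apply:
  "\<nu> \<in> carrier (hom_obj XN) \<Longrightarrow> x \<in> carrier X' \<Longrightarrow>
    hom_map XN (X', N') (g, h) \<nu> x = h (\<nu> (g x))"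
  by (simp add: hom_functor_map_def)

lemma hom_functor_carrier_extI:
  fixes X :: "('k, 'h, 'x) comodule" and N :: "('b, 'n) module"
  assumes X: "is_comodule K H X" and N: "left_module B N"
    and "\<mu> \<in> carrier (hom_obj (X, N))" "\<nu> \<in> carrier (hom_obj (X, N))"
    and "\<And>x. x \<in> carrier X \<Longrightarrow> \<mu> x = \<nu> x"
  shows "\<mu> = \<nu>"
  using assms(3-) unfolding hom_functor_simps[OF X N] by (rule Mod_hom_extensionalityI)

lemma hom_functor_carrierD:
  fixes X :: "('k, 'h, 'x) comodule" and N :: "('b, 'n) module"
  assumes X: "is_comodule K H X" and N: "left_module B N"
    and "\<nu> \<in> carrier (hom_obj (X, N))" "x \<in> carrier X"
  shows "\<nu> x \<in> carrier N"
  using Mod_hom_closed[of \<nu> K X "kmod B N" x] assms(3,4) unfolding hom_functor_simps[OF X N]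
  by (simp add: kmod_simps)

lemma hom_functor_is_functor:
  "is_functor
     (prod_cat (op_cat (Comod_cat K H :: (('k, 'h, 'x) comodule, 'x \<Rightarrow> 'x) category))
               (Mod_cat B :: (('b, 'n) module, 'n \<Rightarrow> 'n) category))
     (Mod_cat A) (hom_obj) (hom_map)"
  unfolding is_functor_def
proof (intro conjI ballI)
  let ?C = "prod_cat (op_cat (Comod_cat K H :: (('k, 'h, 'x) comodule, 'x \<Rightarrow> 'x) category))
               (Mod_cat B :: (('b, 'n) module, 'n \<Rightarrow> 'n) category)"
  note C_simps = prod_cat_def op_cat_def Mod_cat_simps Comod_cat_simps
  show C: "is_category ?C"
    by (intro prod_cat_is_category op_cat_is_category Mod_cat_is_category Comod_cat_is_category
        field_K H_module)
  show "is_category (Mod_cat A)" by (rule Mod_cat_is_category)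
  have Ob: "\<exists>X N. p = (X, N) \<and> is_comodule K H X \<and> left_module B N" if "p \<in> Obj ?C" for p
    using that by (auto simp: C_simps)
  have Ar: "\<exists>g h. q = (g, h) \<and> g \<in> comod_hom K H X' X \<and> h \<in> Mod_hom B N N'"
    if "q \<in> Arr ?C (X, N) (X', N')" for q N N' X X'
    using that by (auto simp: C_simps)
  fix p assume "p \<in> Obj ?C"
  then obtain X N where p: "p = (X, N)" and X: "is_comodule K H X" and N: "left_module B N"
    using Ob by blast
  note M = hom_functor_left_module[OF X N]
  show "hom_obj p \<in> Obj (Mod_cat A)" by (simp add: p Mod_cat_simps M)
  have i: "Ident ?C p = (\<lambda>x\<in>carrier X. x, \<lambda>n\<in>carrier N. n)"
    by (simp add: p C_simps)
  have iN: "(\<lambda>n\<in>carrier N. n) \<in> mod_hom B N N"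
    by (simp add: restrict_mod_hom[OF N] mod_hom_ident)
  have iX: "(\<lambda>x\<in>carrier X. x) \<in> comod_hom K H X X"
    by (rule comod_hom_cong[OF field_K H_module X X comod_hom_ident[OF field_K H_module X]]) simp
  note iF = hom_functor_map_Mod_hom[OF X X N N iX iN]
  show "hom_map p p (Ident ?C p) = Ident (Mod_cat A) (hom_obj p)"
    unfolding i unfolding p Mod_cat_simps
  proof (rule Mod_hom_extensionalityI[OF iF restrict_Mod_hom[OF M mod_hom_ident]])
    fix \<nu> assume \<nu>: "\<nu> \<in> carrier (hom_obj (X, N))"
    have "hom_map (X, N) (X, N) (\<lambda>x\<in>carrier X. x, \<lambda>n\<in>carrier N. n) \<nu> = \<nu>"
      by (rule hom_functor_carrier_extI[OF X N Mod_hom_closed[OF iF \<nu>] \<nu>])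
        (simp add: hom_functor_map_apply \<nu> hom_functor_carrierD[OF X N \<nu>])
    then show "hom_map (X, N) (X, N) (\<lambda>x\<in>carrier X. x, \<lambda>n\<in>carrier N. n) \<nu> = (\<lambda>\<nu>\<in>carrier (hom_obj (X, N)). \<nu>) \<nu>"
      using \<nu> by simp
  qed
  fix p' assume "p' \<in> Obj ?C"
  then obtain X' N' where p': "p' = (X', N')" and X': "is_comodule K H X'" and N': "left_module B N'"
    using Ob by blast
  fix q assume "q \<in> Arr ?C p p'"
  then obtain g h where q: "q = (g, h)" and g: "g \<in> comod_hom K H X' X" and h: "h \<in> Mod_hom B N N'"
    using Ar unfolding p p' by blast
  note F = hom_functor_map_Mod_hom[OF X X' N N' g Mod_homD[OF h]]
  show "hom_map p p' q \<in> Arr (Mod_cat A) (hom_obj p) (hom_obj p')"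
    using F by (simp add: p p' q Mod_cat_simps)
  fix p'' assume "p'' \<in> Obj ?C"
  then obtain X'' N'' where p'': "p'' = (X'', N'')" and X'': "is_comodule K H X''" and N'': "left_module B N''"
    using Ob by blast
  fix q' assume "q' \<in> Arr ?C p' p''"
  then obtain g' h' where q': "q' = (g', h')" and g': "g' \<in> comod_hom K H X'' X'" and h': "h' \<in> Mod_hom B N' N''"
    using Ar unfolding p' p'' by blast
  note F' = hom_functor_map_Mod_hom[OF X' X'' N' N'' g' Mod_homD[OF h']]
  \<comment> \<open>In the opposite category the comodule parts compose in reverse: first g', then
    g, starting at X''.\<close>
  have c: "Comp ?C p p' p'' q' q = (compose (carrier X'') g g', compose (carrier N) h' h)"
    by (simp add: p p'' q q' C_simps)
  have hh: "compose (carrier N) h' h \<in> mod_hom B N N''"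
    by (rule Mod_homD[OF compose_Mod_hom[OF N h h']])
  have gg: "compose (carrier X'') g g' \<in> comod_hom K H X'' X"
    by (rule comod_hom_cong[OF field_K H_module X'' X comod_hom_comp[OF field_K H_module X'' X' X g' g]])
      (simp add: compose_def)
  note FF = hom_functor_map_Mod_hom[OF X X'' N N'' gg hh]
  show "hom_map p p'' (Comp ?C p p' p'' q' q) =
    Comp (Mod_cat A) (hom_obj p) (hom_obj p') (hom_obj p'') (hom_map p' p'' q') (hom_map p p' q)"
    unfolding c unfolding p p' p'' q q' Mod_cat_simps
  proof (rule Mod_hom_extensionalityI[OF FF compose_Mod_hom[OF M F F']])
    fix \<nu> assume \<nu>: "\<nu> \<in> carrier (hom_obj (X, N))"
    note F\<nu> = Mod_hom_closed[OF F \<nu>]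
    have gX: "g x \<in> carrier X" if "x \<in> carrier X'" for x
      by (rule mod_homD(1)[OF comod_hom_mod_hom[OF g] that])
    have gX': "g' x \<in> carrier X'" if "x \<in> carrier X''" for x
      by (rule mod_homD(1)[OF comod_hom_mod_hom[OF g'] that])
    have "hom_map (X, N) (X'', N'') (compose (carrier X'') g g', compose (carrier N) h' h) \<nu> =
      hom_map (X', N') (X'', N'') (g', h') (hom_map (X, N) (X', N') (g, h) \<nu>)"
      by (rule hom_functor_carrier_extI[OF X'' N'' Mod_hom_closed[OF FF \<nu>] Mod_hom_closed[OF F' F\<nu>]])
        (simp add: hom_functor_map_apply \<nu> F\<nu> compose_def hom_functor_carrierD[OF X N \<nu>] gX gX')
    then show "hom_map (X, N) (X'', N'') (compose (carrier X'') g g', compose (carrier N) h' h) \<nu> =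
      compose (carrier (hom_obj (X, N))) (hom_map (X', N') (X'', N'') (g', h')) (hom_map (X, N) (X', N') (g, h)) \<nu>"
      using \<nu> by (simp add: compose_def)
  qed
qed

text \<open>The choice is harmless: a module map out of \<open>M \<triangleleft> X\<close> is
  determined by its values on \<open>univ_map\<close>, so at most one candidate exists. Defining the
  map by this property avoids unfolding the lift through the two quotients.\<close>

definition adj where
  "adj M X N \<theta> = (SOME \<psi>. \<psi> \<in> Mod_hom B (sw_obj (M, X)) N \<and>
     (\<forall>m\<in>carrier M. \<forall>x\<in>carrier X. \<psi> (univ_map M X m x) = \<theta> m x))"

context
  fixes M :: "('a, 'm) module" and X :: "('k, 'h, 'x) comodule" and N :: "('b, 'n) module"
  assumes M: "left_module A M" and X: "is_comodule K H X" and N: "left_module B N"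
begin

private abbreviation (input) "MX_B \<equiv> sw_obj (M, X)"

text \<open>Uncurrying \<open>\<theta>\<close> gives a balanced map, which factors through
  \<open>univ_map\<close>; the factor is restricted to its carrier to be extensional.\<close>

lemma adj:
  assumes \<theta>: "\<theta> \<in> Mod_hom A M (hom_obj (X, N))"
  shows adj_Mod_hom: "adj M X N \<theta> \<in> Mod_hom B MX_B N"
    and adj_univ: "\<And>m x. m \<in> carrier M \<Longrightarrow> x \<in> carrier X \<Longrightarrow> adj M X N \<theta> (univ_map M X m x) = \<theta> m x"
proof -
  note \<theta>m = Mod_homD[OF \<theta>]
  obtain f where f: "f \<in> mod_hom B MX_B N"
    "\<And>m x. m \<in> carrier M \<Longrightarrow> x \<in> carrier X \<Longrightarrow> f (univ_map M X m x) = \<theta> m x"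
    using sw_functor_lift[OF M X N uncurry_bilinear[OF X N M \<theta>m] uncurry_balanced[OF X N M \<theta>m]] by blast
  have "\<exists>\<psi>. \<psi> \<in> Mod_hom B MX_B N \<and>
     (\<forall>m\<in>carrier M. \<forall>x\<in>carrier X. \<psi> (univ_map M X m x) = \<theta> m x)"
    using restrict_Mod_hom[OF sw_functor_left_module[OF M X] f(1)] f(2) univ_map_closed[OF M X]
    by (intro exI[of _ "restrict f (carrier MX_B)"]) simp
  from someI_ex[OF this, folded adj_def]
  show "adj M X N \<theta> \<in> Mod_hom B MX_B N"
    "\<And>m x. m \<in> carrier M \<Longrightarrow> x \<in> carrier X \<Longrightarrow> adj M X N \<theta> (univ_map M X m x) = \<theta> m x"
    by auto
qed

lemma Mod_hom_sw_functor_eqI: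
  assumes f: "f \<in> Mod_hom B MX_B N" and g: "g \<in> Mod_hom B MX_B N"
    and eq: "\<And>m x. m \<in> carrier M \<Longrightarrow> x \<in> carrier X \<Longrightarrow> f (univ_map M X m x) = g (univ_map M X m x)"
  shows "f = g"
  by (rule Mod_hom_extensionalityI[OF f g])
    (rule sw_functor_ext[OF M X N Mod_homD[OF f] Mod_homD[OF g] eq])

text \<open>The values of \<open>adj M X N \<theta>\<close> on \<open>univ_map\<close> give back all
  values of \<open>\<theta>\<close>, whence injectivity. For surjectivity, a module map is composed
  with \<open>univ_map\<close> and curried.\<close>

lemma adj_bij_betw:
  "bij_betw (adj M X N) (Mod_hom A M (hom_obj (X, N))) (Mod_hom B MX_B N)"
proof (rule bij_betw_imageI)
  let ?H = "hom_obj (X, N)"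
  show "inj_on (adj M X N) (Mod_hom A M ?H)"
  proof (rule inj_onI)
    fix \<theta> \<theta>' assume \<theta>: "\<theta> \<in> Mod_hom A M ?H" and \<theta>': "\<theta>' \<in> Mod_hom A M ?H"
      and eq: "adj M X N \<theta> = adj M X N \<theta>'"
    show "\<theta> = \<theta>'"
    proof (rule Mod_hom_extensionalityI[OF \<theta> \<theta>'])
      fix m assume m: "m \<in> carrier M"
      show "\<theta> m = \<theta>' m"
        by (rule hom_functor_carrier_extI[OF X N Mod_hom_closed[OF \<theta> m] Mod_hom_closed[OF \<theta>' m]])
          (simp add: adj_univ[OF \<theta> m, symmetric] adj_univ[OF \<theta>' m, symmetric] eq)
    qed
  qed
  show "adj M X N ` Mod_hom A M ?H = Mod_hom B MX_B N"
  proof (intro equalityI image_subsetI subsetI)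
    show "adj M X N \<theta> \<in> Mod_hom B MX_B N" if "\<theta> \<in> Mod_hom A M ?H" for \<theta> by (rule adj_Mod_hom[OF that])
    fix \<psi> assume \<psi>: "\<psi> \<in> Mod_hom B MX_B N"
    note Z = sw_functor_left_module[OF M X]
    note \<psi>m = Mod_homD[OF \<psi>]
    note \<psi>k = mod_hom_kmod[OF B Z \<psi>m]
    note b = bilinear_map_comp[OF univ_map_bilinear[OF M X] \<psi>k]
    have bal: "balanced K A M X B N act (\<lambda>m x. \<psi> (univ_map M X m x))"
      by (rule balanced_comp[OF X M B Z B N act_bilinear univ_map_bilinear[OF M X] univ_map_balanced[OF M X] \<psi>k])
        (simp add: mod_homD(3)[OF \<psi>m] bilinear_mapD(3)[OF act_bilinear])
    note \<theta> = curry_Mod_hom[OF X N M b bal]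
    \<comment> \<open>The preimage of \<open>\<psi>\<close> is the curried composite with
      \<open>univ_map\<close>; its adjoint has the same values on \<open>univ_map\<close> as
      \<open>\<psi>\<close>.\<close>
    have "adj M X N (\<lambda>m\<in>carrier M. \<lambda>x\<in>carrier X. \<psi> (univ_map M X m x)) = \<psi>"
      by (rule Mod_hom_sw_functor_eqI[OF adj_Mod_hom[OF \<theta>] \<psi>]) (simp add: adj_univ[OF \<theta>])
    then show "\<psi> \<in> adj M X N ` Mod_hom A M ?H"
      by (rule image_eqI[OF sym \<theta>])
  qed
qed

end

text \<open>Both sides are module maps on \<open>M' \<triangleleft> X'\<close>, so values on
  \<open>univ_map M' X' m x\<close> decide; there both give \<open>h (\<theta> (f m) (g x))\<close>.
  One equation covers naturality in all three arguments.\<close>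

lemma adj_natural:
  fixes M M' :: "('a, 'm) module" and X X' :: "('k, 'h, 'x) comodule" and N N' :: "('b, 'n) module"
  assumes M: "left_module A M" and M': "left_module A M'"
    and X: "is_comodule K H X" and X': "is_comodule K H X'"
    and N: "left_module B N" and N': "left_module B N'"
    and f: "f \<in> Mod_hom A M' M" and g: "g \<in> comod_hom K H X' X" and h: "h \<in> Mod_hom B N N'"
    and \<theta>: "\<theta> \<in> Mod_hom A M (hom_obj (X, N))"
  shows "adj M' X' N' (compose (carrier M') (hom_map (X, N) (X', N') (g, h))
      (compose (carrier M') \<theta> f)) =
    compose (carrier (sw_obj (M', X'))) h
      (compose (carrier (sw_obj (M', X'))) (adj M X N \<theta>)
        (sw_map (M', X') (M, X) (f, g)))"
proof -
  let ?Z' = "sw_obj (M', X')"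
  note Z' = sw_functor_left_module[OF M' X']
  note F = hom_functor_map_Mod_hom[OF X X' N N' g Mod_homD[OF h]]
  note T = sw_functor_map_Mod_hom[OF M' X' M X Mod_homD[OF f] g]
  note Tu = sw_functor_map_univ[OF M' X' M X Mod_homD[OF f] g]
  note \<theta>' = compose_Mod_hom[OF M' compose_Mod_hom[OF M' f \<theta>] F]
  show ?thesis
  proof (rule Mod_hom_sw_functor_eqI[OF M' X' N' adj_Mod_hom[OF M' X' N' \<theta>']
        compose_Mod_hom[OF Z' compose_Mod_hom[OF Z' T adj_Mod_hom[OF M X N \<theta>]] h]])
    fix m x assume m: "m \<in> carrier M'" and x: "x \<in> carrier X'"
    have fm: "f m \<in> carrier M" by (rule Mod_hom_closed[OF f m])
    have gx: "g x \<in> carrier X" by (rule mod_homD(1)[OF comod_hom_mod_hom[OF g] x])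
    show "adj M' X' N' (compose (carrier M') (hom_map (X, N) (X', N') (g, h))
        (compose (carrier M') \<theta> f)) (univ_map M' X' m x) =
      compose (carrier ?Z') h (compose (carrier ?Z') (adj M X N \<theta>)
        (sw_map (M', X') (M, X) (f, g))) (univ_map M' X' m x)"
      unfolding adj_univ[OF M' X' N' \<theta>' m x]
      by (simp add: compose_def m x hom_functor_map_apply Mod_hom_closed[OF \<theta> fm]
          univ_map_closed[OF M' X' m x] Tu[OF m x] adj_univ[OF M X N \<theta> fm gx])
  qed
qed

end

theorem theorem4p13:
  fixes K :: "('k, 'c) ring_scheme"
    and A :: "('k, 'a) module" and B :: "('k, 'b) module"
    and P :: "('k, 'p) coalgebra" and \<pi> :: "'p \<Rightarrow> 'a \<Rightarrow> 'b"
  assumes "field K" and "k_algebra K A" and "k_algebra K B"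
    and "universal_measuring TYPE('u) K A B P \<pi>"
  shows
    "is_functor
       (prod_cat (Mod_cat A :: (('a, 'm) module, 'm \<Rightarrow> 'm) category)
                 (Comod_cat K P :: (('k, 'p, 'x) comodule, 'x \<Rightarrow> 'x) category))
       (Mod_cat B)
       (sw_functor K A B P \<pi>) (sw_functor_map K A B P \<pi>) \<and>
     is_functor
       (prod_cat (op_cat (Comod_cat K P :: (('k, 'p, 'x) comodule, 'x \<Rightarrow> 'x) category))
                 (Mod_cat B :: (('b, 'n) module, 'n \<Rightarrow> 'n) category))
       (Mod_cat A)
       (hom_functor K A B P \<pi>) (hom_functor_map K A B P \<pi>) \<and>
     (\<exists>\<Phi> :: ('a, 'm) module \<Rightarrow> ('k, 'p, 'x) comodule \<Rightarrow> ('b, 'n) module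
              \<Rightarrow> ('m \<Rightarrow> 'x \<Rightarrow> 'n)
              \<Rightarrow> (('k, 'b, ('k, 'a, 'p, 'm, 'x) swfree set) tensors set \<Rightarrow> 'n).
       (\<forall>M X N. left_module A M \<longrightarrow> is_comodule K P X \<longrightarrow> left_module B N \<longrightarrow>
          bij_betw (\<Phi> M X N)
            (Mod_hom A M (hom_functor K A B P \<pi> (X, N)))
            (Mod_hom B (sw_functor K A B P \<pi> (M, X)) N)) \<and>
       (\<forall>M M' X X' N N' f g h \<theta>.
          left_module A M \<longrightarrow> left_module A M' \<longrightarrow>
          is_comodule K P X \<longrightarrow> is_comodule K P X' \<longrightarrow>
          left_module B N \<longrightarrow> left_module B N' \<longrightarrow>
          f \<in> Arr (Mod_cat A) M' M \<longrightarrow>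
          g \<in> Arr (Comod_cat K P) X' X \<longrightarrow>
          h \<in> Arr (Mod_cat B) N N' \<longrightarrow>
          \<theta> \<in> Mod_hom A M (hom_functor K A B P \<pi> (X, N)) \<longrightarrow>
          \<Phi> M' X' N'
            (compose (carrier M') (hom_functor_map K A B P \<pi> (X, N) (X', N') (g, h))
              (compose (carrier M') \<theta> f)) =
          compose (carrier (sw_functor K A B P \<pi> (M', X'))) h
            (compose (carrier (sw_functor K A B P \<pi> (M', X'))) (\<Phi> M X N \<theta>)
              (sw_functor_map K A B P \<pi> (M', X') (M, X) (f, g)))))"
proof -
  have \<pi>: "is_measuring K A B P \<pi>" using assms(4) by (simp add: universal_measuring_def)
  then have P: "is_coalgebra K P" by (simp add: is_measuring_def)
  interpret measuring K A P B \<pi>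
    by (intro measuring.intro algebra_coalgebra.intro measuring_axioms.intro assms(2,3) P \<pi>)
  show ?thesis
    \<comment> \<open>The family of bijections is \<open>adj\<close>, taken for the measuring given
      by P.\<close>
    by (intro conjI sw_functor_is_functor hom_functor_is_functor exI[of _ adj] allI impI adj_bij_betw)
      (simp_all add: Mod_cat_simps Comod_cat_simps adj_natural)
qed

end
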